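(* Let $F\in\mathbb{K}[[x]][y]$ be a square-free Weierstrass polynomial of degree $d$ over a perfect field $\mathbb{K}$ of characteristic $0$ or greater than $d$, and let $\mathbb{L}$ be a field extension of $\mathbb{K}$. The algorithm $\mathtt{Irreducible}(F,\mathbb{L})$ described in the context returns the correct answer: it returns True if $F$ is irreducible in $\mathbb{L}[[x]][y]$, and False otherwise.
   Context: A polynomial is Weierstrass if it is monic in $y$ and all its lower coefficients vanish at $x=0$. For $N\mid d$ (with $d$ invertible in the coefficient ring) the $N$-th approximate root of $F$ is the unique monic $\psi$ of degree $d/N$ with $\deg_y(F-\psi^N)<d-d/N$. A polynomial $\bar H\in\mathbb{L}[x,y]$, monic in $y$ and quasi-homogeneous, is degenerated over the field $\mathbb{L}$ if $\bar H=(P(y^q/x^m)\,x^{m\deg P})^N$ with $q,m$ coprime, $q>0$, $N\in\mathbb{N}$ and $P\in\mathbb{L}[Z]$ monic irreducible; its edge data is then $(q,m,P,N)$. Algorithm $\mathtt{Irreducible}(F,\mathbb{L})$. Initialise $N_0=d$, $\mathbb{L}_0=\mathbb{L}$, $V=(v_{0,-1},v_{0,0})=(1,0)$, $\Lambda=(\lambda_{0,-1},\lambda_{0,0})=(1,1)$, $\psi_{-1}=x$. For $k=0,1,2,\dots$, as long as $N_k>1$: (1) Let $\psi_k$ be the $N_k$-th approximate root of $F$, $\Psi=(\psi_{-1},\dots,\psi_k)$, and $F=\sum_{B\in\mathcal{B}}f_B\Psi^B$ its $\Psi$-adic expansion, where $\Psi^B=\prod_{i=-1}^k\psi_i^{b_i}$,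 $f_B\in\mathbb{K}$ and $\mathcal{B}=\{(b_{-1},\dots,b_k)\in\mathbb{N}^{k+2}:b_{i-1}<q_i\ell_i,\ 1\le i\le k\}$. (2) With $V=(v_{k,-1},\dots,v_{k,k})$, $\Lambda=(\lambda_{k,-1},\dots,\lambda_{k,k})$ and $B_0=(0,\dots,0,N_k)$, set $w_i=\min\{\langle B,V\rangle: b_k=i,f_B\neq0\}-N_kv_{k,k}$ ($\infty$ for the empty set), let $\Delta$ be the lowest edge (the one ending at $(N_k,0)$) of the lower convex hull of the points $(i,w_i)_{0\le i\le N_k}$, and $$\bar H=\sum_{(i,w_i)\in\Delta}\Big(\sum_{B\in\mathcal{B},\,b_k=i,\,\langle B,V\rangle=w_i+N_kv_{k,k}}f_B\Lambda^{B-B_0}\Big)x^{w_i}y^i\in\mathbb{L}_k[x,y],$$ where $\Lambda^B=\prod_i\lambda_{k,i}^{b_i}$. (3) If $\bar H$ is not degenerated over $\mathbb{L}_k$, return False. (4) Otherwise let $(q_{k+1},m_{k+1},P_{k+1},N_{k+1})$ be the edge data of $\bar H$, $\ell_{k+1}=\deg P_{k+1}$, $\mathbb{L}_{k+1}=\mathbb{L}_k[Z]/(P_{k+1}(Z))$, $z_{k+1}$ the class of $Z$, and let $(s_{k+1},t_{k+1})$ be the unique integers with $q_{k+1}s_{k+1}-m_{k+1}t_{k+1}=1$, $0\le t_{k+1}<q_{k+1}$. Update $V$ and $\Lambda$ from rank $k$ to rank $j=k+1$ by: $v_{j,i}=q_jv_{j-1,i}$ and $\lambda_{j,i}=\lambda_{j-1,i}z_j^{t_jv_{j-1,i}}$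 for $-1\le i<j-1$; $v_{j,j-1}=q_jv_{j-1,j-1}+m_j$ and $\lambda_{j,j-1}=\lambda_{j-1,j-1}z_j^{t_jv_{j-1,j-1}+s_j}$; $v_{j,j}=q_j\ell_jv_{j,j-1}$ and $\lambda_{j,j}=q_jz_j^{1-s_j-\ell_j}P_j'(z_j)\lambda_{j,j-1}^{q_j\ell_j}$. When $N_k=1$ is reached, return True. (All power series are considered here with exact, untruncated coefficients.) *)

theory Defs
  imports
    "HOL-Algebra.Algebraic_Closure_Type"
    "HOL-Computational_Algebra.Computational_Algebra"
begin

(* HOL-Algebra's versions of these names are for records with explicit carriers; the type-class
   versions of HOL-Computational_Algebra are used throughout. *)
hide_const (open) Polynomials.degree UnivPoly.monom UnivPoly.coeff Divisibility.irreducible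

definition perfect_field :: "'a::field itself \<Rightarrow> bool" where
  "perfect_field _ \<longleftrightarrow> CHAR('a) = 0 \<or> surj (\<lambda>a::'a. a ^ CHAR('a))"

definition field_embedding :: "('a::field \<Rightarrow> 'b::field) \<Rightarrow> bool" where
  "field_embedding h \<longleftrightarrow>
     h 1 = 1 \<and> (\<forall>a b. h (a + b) = h a + h b) \<and> (\<forall>a b. h (a * b) = h a * h b)"

text \<open>
  The ring \<open>R[[x]][y]\<close> is the type \<open>R fps poly\<close>, with outer variable \<open>y\<close>; similarly \<open>R[x,y]\<close>
  is \<open>R poly poly\<close>. The next function is the base change \<open>K[[x]][y] \<rightarrow> L[[x]][y]\<close> along \<open>h\<close>.
\<close>

definition extend_scalars :: "('a::zero \<Rightarrow> 'b::zero) \<Rightarrow> 'a fps poly \<Rightarrow> 'b fps poly" where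
  "extend_scalars h F = map_poly (\<lambda>c. Abs_fps (\<lambda>n. h (fps_nth c n))) F"

definition weierstrass :: "'a::comm_ring_1 fps poly \<Rightarrow> bool" where
  "weierstrass F \<longleftrightarrow> lead_coeff F = 1 \<and> (\<forall>i<degree F. fps_nth (coeff F i) 0 = 0)"

text \<open>The case \<open>F = \<psi>\<^sup>N\<close> is separate because the zero polynomial has degree \<open>0\<close> here, not \<open>-\<infinity>\<close>.\<close>

definition is_approx_root :: "nat \<Rightarrow> 'a::comm_ring_1 poly \<Rightarrow> 'a poly \<Rightarrow> bool" where
  "is_approx_root N F \<psi> \<longleftrightarrow>
     N dvd degree F \<and> lead_coeff \<psi> = 1 \<and> degree \<psi> = degree F div N \<and>
     (F = \<psi> ^ N \<or> degree (F - \<psi> ^ N) < degree F - degree F div N)"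

text \<open>
  Families indexed by \<open>-1, \<dots>, k\<close> are functions on \<^typ>\<open>int\<close>, of which only the values on
  \<open>{-1..k}\<close> matter. In \<open>admissible_exponents k q l\<close>, \<open>q\<close> and \<open>l\<close> carry the numbers
  \<open>q\<^sub>i\<close> and \<open>\<ell>\<^sub>i\<close> for \<open>1 \<le> i \<le> k\<close>; vanishing outside \<open>{-1..k}\<close> makes an exponent vector a
  unique function.
\<close>

definition admissible_exponents ::
    "nat \<Rightarrow> (int \<Rightarrow> nat) \<Rightarrow> (int \<Rightarrow> nat) \<Rightarrow> (int \<Rightarrow> nat) set" where
  "admissible_exponents k q l =
     {B. (\<forall>i. i \<notin> {-1..int k} \<longrightarrow> B i = 0) \<and> (\<forall>i\<in>{1..int k}. B (i - 1) < q i * l i)}"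

definition multi_power :: "nat \<Rightarrow> (int \<Rightarrow> 'a::comm_monoid_mult) \<Rightarrow> (int \<Rightarrow> nat) \<Rightarrow> 'a" where
  "multi_power k \<Psi> B = (\<Prod>i\<in>{-1..int k}. \<Psi> i ^ B i)"

text \<open>
  \<open>F = (\<Sum>B. f B \<Psi>\<^sup>B)\<close> is in general an infinite sum, since the exponent of \<open>\<psi>\<^bsub>-1\<^esub> = x\<close> is
  unbounded. It is read as an \<open>x\<close>-adically convergent sum: for every \<open>n\<close> only finitely many
  terms have \<open>x\<close>-exponent below \<open>n\<close>, and their sum is \<open>F\<close> modulo \<open>x\<^sup>n\<close>.
\<close>

definition is_adic_expansion ::
    "nat \<Rightarrow> (int \<Rightarrow> nat) \<Rightarrow> (int \<Rightarrow> nat) \<Rightarrow> (int \<Rightarrow> 'a::field fps poly) \<Rightarrow>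
     'a fps poly \<Rightarrow> ((int \<Rightarrow> nat) \<Rightarrow> 'a) \<Rightarrow> bool" where
  "is_adic_expansion k q l \<Psi> F f \<longleftrightarrow>
     (\<forall>B. f B \<noteq> 0 \<longrightarrow> B \<in> admissible_exponents k q l) \<and>
     (\<forall>n. finite {B. f B \<noteq> 0 \<and> B (-1) < n} \<and>
          [:fps_X ^ n:] dvd
            F - (\<Sum>B | f B \<noteq> 0 \<and> B (-1) < n. smult (fps_const (f B)) (multi_power k \<Psi> B)))"

definition exponent_value :: "nat \<Rightarrow> (int \<Rightarrow> nat) \<Rightarrow> (int \<Rightarrow> nat) \<Rightarrow> nat" where
  "exponent_value k B V = (\<Sum>i\<in>{-1..int k}. B i * V i)"

text \<open>The ordinate \<open>w\<^sub>i\<close>, where \<^const>\<open>None\<close> stands for \<open>\<infinity>\<close>.\<close>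

definition ordinate ::
    "nat \<Rightarrow> nat \<Rightarrow> (int \<Rightarrow> nat) \<Rightarrow> ((int \<Rightarrow> nat) \<Rightarrow> 'a::zero) \<Rightarrow> nat \<Rightarrow> int option" where
  "ordinate k N V f i =
     (let M = {exponent_value k B V |B. f B \<noteq> 0 \<and> B (int k) = i}
      in if M = {} then None else Some (int (Inf M) - int (N * V (int k))))"

definition polygon_points ::
    "nat \<Rightarrow> nat \<Rightarrow> (int \<Rightarrow> nat) \<Rightarrow> ((int \<Rightarrow> nat) \<Rightarrow> 'a::zero) \<Rightarrow> (nat \<times> int) set" where
  "polygon_points k N V f = {(i, w). i \<le> N \<and> ordinate k N V f i = Some w}"

text \<open>
  \<open>E\<close> is the set of points of \<open>S\<close> on one edge of the lower convex hull of \<open>S\<close>: those on a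
  non-vertical line that has no point of \<open>S\<close> below it and at least two points of \<open>S\<close> on it.
\<close>

definition is_lower_edge :: "(nat \<times> int) set \<Rightarrow> (nat \<times> int) set \<Rightarrow> bool" where
  "is_lower_edge S E \<longleftrightarrow>
     (\<exists>a b::real. (\<forall>(i, w)\<in>S. a * real i + b \<le> real_of_int w) \<and>
        E = {(i, w)\<in>S. real_of_int w = a * real i + b}) \<and>
     (\<exists>p\<in>E. \<exists>p'\<in>E. p \<noteq> p')"

text \<open>
  The polynomial \<open>\<Sum>(i,w)\<in>E. (\<dots>) x\<^sup>w y\<^sup>i\<close>, where \<open>h\<close> embeds \<open>K\<close> into the field of the \<open>\<Lambda>\<close>.
  Exponents of \<open>\<Lambda>\<close> may be negative. The ordinates on the edge are nonnegative whenever the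
  edge ends at \<open>(N,0)\<close> and has nonpositive slope, so that \<^const>\<open>nat\<close> does not truncate.
\<close>

definition edge_polynomial ::
    "('a::field \<Rightarrow> 'e::field) \<Rightarrow> nat \<Rightarrow> nat \<Rightarrow> (int \<Rightarrow> nat) \<Rightarrow> (int \<Rightarrow> 'e) \<Rightarrow>
     ((int \<Rightarrow> nat) \<Rightarrow> 'a) \<Rightarrow> (nat \<times> int) set \<Rightarrow> 'e poly poly" where
  "edge_polynomial h k N V \<Lambda> f E =
     (let B\<^sub>0 = (\<lambda>j. if j = int k then N else 0)
      in \<Sum>(i, w)\<in>E. monom (monom
           (\<Sum>B | f B \<noteq> 0 \<and> B (int k) = i \<and> int (exponent_value k B V) = w + int (N * V (int k)).
              h (f B) * (\<Prod>j\<in>{-1..int k}. \<Lambda> j powi (int (B j) - int (B\<^sub>0 j)))) (nat w)) i)"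

text \<open>
  The fields \<open>L\<^sub>k\<close> of the algorithm vary with \<open>k\<close>; they are represented as subfields of one
  ambient field \<open>'e\<close> (below: an algebraic closure of \<open>L\<close>), and polynomials over
  \<open>L\<^sub>k\<close> as polynomials over \<open>'e\<close> with coefficients in \<open>L\<^sub>k\<close>.
\<close>

definition polys_over :: "'e::field set \<Rightarrow> 'e poly set" where
  "polys_over S = {A. \<forall>i. coeff A i \<in> S}"

definition irreducible_over :: "'e::field set \<Rightarrow> 'e poly \<Rightarrow> bool" where
  "irreducible_over S P \<longleftrightarrow>
     P \<in> polys_over S \<and> degree P > 0 \<and>
     (\<forall>A\<in>polys_over S. \<forall>B\<in>polys_over S. P = A * B \<longrightarrow> degree A = 0 \<or> degree B = 0)"

text \<open>\<open>P(y\<^sup>q/x\<^sup>m) x\<^bsup>m deg P\<^esup>\<close>, with denominators cleared.\<close>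

definition quasi_homogenize :: "nat \<Rightarrow> nat \<Rightarrow> 'e::field poly \<Rightarrow> 'e poly poly" where
  "quasi_homogenize q m P =
     (\<Sum>j\<le>degree P. monom (monom (coeff P j) (m * (degree P - j))) (q * j))"

definition edge_data :: "'e::field set \<Rightarrow> 'e poly poly \<Rightarrow> nat \<Rightarrow> nat \<Rightarrow> 'e poly \<Rightarrow> nat \<Rightarrow> bool" where
  "edge_data S H q m P N \<longleftrightarrow>
     q > 0 \<and> coprime q m \<and> lead_coeff P = 1 \<and> irreducible_over S P \<and>
     H = quasi_homogenize q m P ^ N"

definition degenerated :: "'e::field set \<Rightarrow> 'e poly poly \<Rightarrow> bool" where
  "degenerated S H \<longleftrightarrow> (\<exists>q m P N. edge_data S H q m P N)"

text \<open>
  Evaluation at \<open>z\<close> is a surjection \<open>S[Z] \<rightarrow> S'\<close> with kernel \<open>(P)\<close>. That is, \<open>S'\<close> is a copy of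
  \<open>S[Z]/(P)\<close> inside the ambient field, and \<open>z\<close> is the class of \<open>Z\<close>.
\<close>

definition is_quotient_field :: "'e::field set \<Rightarrow> 'e poly \<Rightarrow> 'e \<Rightarrow> 'e set \<Rightarrow> bool" where
  "is_quotient_field S P z S' \<longleftrightarrow>
     S' = (\<lambda>A. poly A z) ` polys_over S \<and>
     (\<forall>A\<in>polys_over S. poly A z = 0 \<longleftrightarrow> (\<exists>Q\<in>polys_over S. A = P * Q))"

text \<open>
  The state on entering round \<open>k = rank\<close>: \<open>mult\<close> is \<open>N\<^sub>k\<close>, \<open>fld\<close> is \<open>L\<^sub>k\<close>, \<open>vals i\<close> and \<open>lams i\<close>
  are \<open>v\<^sub>k\<^sub>,\<^sub>i\<close> and \<open>\<lambda>\<^sub>k\<^sub>,\<^sub>i\<close> for \<open>-1 \<le> i \<le> k\<close>, \<open>psis i\<close> is \<open>\<psi>\<^sub>i\<close> for \<open>-1 \<le> i < k\<close>, and \<open>qs i\<close>,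
  \<open>ells i\<close> are \<open>q\<^sub>i\<close>, \<open>\<ell>\<^sub>i\<close> for \<open>1 \<le> i \<le> k\<close>.
\<close>

record (overloaded) ('a, 'e) irr_state =
  rank :: nat
  mult :: nat
  fld :: "'e set"
  vals :: "int \<Rightarrow> nat"
  lams :: "int \<Rightarrow> 'e"
  psis :: "int \<Rightarrow> 'a fps poly"
  qs :: "int \<Rightarrow> nat"
  ells :: "int \<Rightarrow> nat"

definition initial_state :: "nat \<Rightarrow> 'e::field set \<Rightarrow> ('a::field, 'e) irr_state" where
  "initial_state d L =
     \<lparr>rank = 0, mult = d, fld = L,
      vals = (\<lambda>i. if i = -1 then 1 else 0),
      lams = (\<lambda>i. 1),
      psis = (\<lambda>i. if i = -1 then [:fps_X:] else 0),
      qs = (\<lambda>i. 0), ells = (\<lambda>i. 0)\<rparr>"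

text \<open>Steps (1) and (2): \<open>\<psi>\<close> is the new approximate root and \<open>H\<close> the polynomial of the lowest edge.\<close>

definition round_polynomial ::
    "('a::field \<Rightarrow> 'e::field) \<Rightarrow> 'a fps poly \<Rightarrow> ('a, 'e) irr_state \<Rightarrow>
     'a fps poly \<Rightarrow> 'e poly poly \<Rightarrow> bool" where
  "round_polynomial h F st \<psi> H \<longleftrightarrow>
     is_approx_root (mult st) F \<psi> \<and>
     (\<exists>f E. is_adic_expansion (rank st) (qs st) (ells st)
              ((psis st)(int (rank st) := \<psi>)) F f \<and>
            is_lower_edge (polygon_points (rank st) (mult st) (vals st) f) E \<and>
            (mult st, 0) \<in> E \<and>
            H = edge_polynomial h (rank st) (mult st) (vals st) (lams st) f E)"

definition update_vals :: "nat \<Rightarrow> nat \<Rightarrow> nat \<Rightarrow> nat \<Rightarrow> (int \<Rightarrow> nat) \<Rightarrow> int \<Rightarrow> nat" where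
  "update_vals k q m l V i =
     (let u = q * V (int k) + m
      in if i < int k then q * V i else if i = int k then u else q * l * u)"

definition update_lams ::
    "nat \<Rightarrow> nat \<Rightarrow> 'e::field poly \<Rightarrow> 'e \<Rightarrow> int \<Rightarrow> int \<Rightarrow>
     (int \<Rightarrow> nat) \<Rightarrow> (int \<Rightarrow> 'e) \<Rightarrow> int \<Rightarrow> 'e" where
  "update_lams k q P z s t V \<Lambda> i =
     (let l = degree P; \<mu> = \<Lambda> (int k) * z powi (t * int (V (int k)) + s)
      in if i < int k then \<Lambda> i * z powi (t * int (V i))
         else if i = int k then \<mu>
         else of_nat q * z powi (1 - s - int l) * poly (pderiv P) z * \<mu> ^ (q * l))"

definition next_state ::
    "('a::field, 'e::field) irr_state \<Rightarrow> 'a fps poly \<Rightarrow> nat \<Rightarrow> nat \<Rightarrow> 'e poly \<Rightarrow> nat \<Rightarrow>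
     'e \<Rightarrow> 'e set \<Rightarrow> int \<Rightarrow> int \<Rightarrow> ('a, 'e) irr_state" where
  "next_state st \<psi> q m P N z L s t =
     \<lparr>rank = Suc (rank st), mult = N, fld = L,
      vals = update_vals (rank st) q m (degree P) (vals st),
      lams = update_lams (rank st) q P z s t (vals st) (lams st),
      psis = (psis st)(int (rank st) := \<psi>),
      qs = (qs st)(int (Suc (rank st)) := q),
      ells = (ells st)(int (Suc (rank st)) := degree P)\<rparr>"

text \<open>
  \<open>irreducible_run h F st b\<close>: the loop, entered in state \<open>st\<close>, stops and returns \<open>b\<close>. This is a
  relation and not a function because the copy of the quotient field in the ambient field,
  equivalently the root \<open>z\<close> of \<open>P\<close> representing the class of \<open>Z\<close>, is not unique.
\<close>

inductive irreducible_run ::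
    "('a::field \<Rightarrow> 'e::field) \<Rightarrow> 'a fps poly \<Rightarrow> ('a, 'e) irr_state \<Rightarrow> bool \<Rightarrow> bool"
  for h F where
  finished:
    "mult st = 1 \<Longrightarrow> irreducible_run h F st True"
| not_degenerated:
    "mult st > 1 \<Longrightarrow> round_polynomial h F st \<psi> H \<Longrightarrow> \<not> degenerated (fld st) H \<Longrightarrow>
     irreducible_run h F st False"
| continue:
    "mult st > 1 \<Longrightarrow> round_polynomial h F st \<psi> H \<Longrightarrow> edge_data (fld st) H q m P N \<Longrightarrow>
     is_quotient_field (fld st) P z L \<Longrightarrow>
     int q * s - int m * t = 1 \<Longrightarrow> 0 \<le> t \<Longrightarrow> t < int q \<Longrightarrow>
     irreducible_run h F (next_state st \<psi> q m P N z L s t) b \<Longrightarrow>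
     irreducible_run h F st b"

definition Irreducible_returns ::
    "('k::field \<Rightarrow> 'l::field) \<Rightarrow> 'k fps poly \<Rightarrow> bool \<Rightarrow> bool" where
  "Irreducible_returns \<iota> F b \<longleftrightarrow>
     irreducible_run (\<lambda>a. to_ac (\<iota> a)) F
       (initial_state (degree F) (range (to_ac :: 'l \<Rightarrow> 'l alg_closure))) b"

end

theory Submission
  imports Defs
begin

text \<open>
  The proof uses MacLane's inductive valuations. Stage \<open>k\<close> of the algorithm carries a discrete
  valuation of \<open>L[[x]][y]\<close>, together with a description of its graded ring: the polynomials of
  degree less than \<open>deg \<psi>\<^sub>k\<close> have initial forms in \<open>L\<^sub>k\<close> (times a power of the uniformizer), and
  \<open>\<psi>\<^sub>k\<close> contributes a variable \<open>Y\<close>. For a slope \<open>m/q > 0\<close> the augmented valuation giving \<open>\<psi>\<^sub>k\<close> the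
  value \<open>q v\<^sub>k\<^sub>,\<^sub>k + m\<close> is multiplicative with initial forms in \<open>L\<^sub>k[Y]\<close>, since the carries in
  \<open>\<psi>\<^sub>k\<close>-adic multiplication have strictly larger value. The edge polynomial is the initial form of
  \<open>F\<close>. Reducing modulo \<open>P(Y\<^sup>q)\<close> yields the next stage; uniqueness of approximate roots, applied
  both to \<open>F\<close> and to its initial form, shows that \<open>\<psi>\<^sub>k\<^sub>+\<^sub>1\<close> has initial form \<open>P(Y\<^sup>q)\<close>.

  If the edge polynomial is degenerated, the initial form of every monic factor of \<open>F\<close> is a power of
  \<open>P(Y\<^sup>q)\<close>, so \<open>deg \<psi>\<^sub>k\<^sub>+\<^sub>1\<close> divides the degree of the factor; when \<open>N\<^sub>k = 1\<close> this makes \<open>F\<close>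
  irreducible. Otherwise the edge polynomial is a product of two coprime polynomials over \<open>L\<^sub>k\<close>, and
  Hensel lifting along the filtration factors \<open>F\<close>.
\<close>
section \<open>Expansions in powers of a monic polynomial\<close>

text \<open>A homogeneous piece of the graded ring is a line over L_k without a distinguished
  generator, yet the algorithm attaches an element \<Lambda>^B of L_k to every monomial. The
  trivialization behind this is evaluation at Y = \<zeta>, where \<zeta>^q = z in the algebraic
  closure, multiplied by \<zeta>^(t \<alpha>) in degree \<alpha>: since q s - m t = 1, the total
  exponent of \<zeta> is a multiple of q and the result lies in L_(k+1). Applied to monomials, it
  gives the update formulas for V and \<Lambda>. Values are recorded by predicates "value at least
  \<alpha>" with one coefficient map for each integer degree. Multiplying old values by q keeps them
  integral, and 0 causes no exception. Slopes are positive because the lower digits of F stay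
  strictly above the values forced by \<psi>_k, a condition handed from round to round. The
  condition on the characteristic makes N_k, q and P'(z) invertible; square-freeness excludes F =
  \<psi>_k^(N_k), where no edge exists. The loop ends because q deg P = 1 is impossible: on the edge
  the coefficient after the leading one vanishes.\<close>

locale monic_poly =
  fixes g :: "'b::idom poly"
  assumes monic: "lead_coeff g = 1" and degree_pos: "degree g > 0"
begin

lemma g_nonzero: "g \<noteq> 0"
  using degree_pos by auto

lemma lead_coeff_power_g [simp]: "lead_coeff (g ^ n) = 1"
  by (simp add: lead_coeff_power monic)

lemma degree_power_g [simp]: "degree (g ^ n) = n * degree g"
  by (simp add: degree_power_eq g_nonzero)

text \<open>K[[x]] is not a field. \<open>pseudo_divmod\<close> multiplies the dividend by a power
  of the leading coefficient of g, which is 1, so it is a true division here.\<close>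

lemma division_exists: "\<exists>s. degree (f - s * g) < degree g"
proof -
  obtain s r where sr: "pseudo_divmod f g = (s, r)" by fastforce
  have "f = g * s + r" using pseudo_divmod(1)[OF g_nonzero sr] monic by simp
  moreover have "degree r < degree g" using pseudo_divmod(2)[OF g_nonzero sr] degree_pos by auto
  ultimately show ?thesis by (intro exI[of _ s]) (simp add: mult.commute)
qed

lemma division_unique:
  assumes "degree (f - s * g) < degree g" "degree (f - s' * g) < degree g"
  shows "s = s'"
proof (rule ccontr)
  assume "s \<noteq> s'"
  then have "degree ((s - s') * g) = degree (s - s') + degree g"
    by (intro degree_mult_eq) (auto simp: g_nonzero)
  moreover have "(s - s') * g = (f - s' * g) - (f - s * g)" by (simp add: algebra_simps)
  then have "degree ((s - s') * g) < degree g"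
    using degree_diff_less[OF assms(2,1)] by simp
  ultimately show False by simp
qed

definition quo :: "'b poly \<Rightarrow> 'b poly" where
  "quo f = (THE s. degree (f - s * g) < degree g)"

definition rem :: "'b poly \<Rightarrow> 'b poly" where
  "rem f = f - quo f * g"

lemma degree_rem: "degree (rem f) < degree g"
  unfolding rem_def quo_def
  by (rule theI') (use division_exists[of f] division_unique[of f] in blast)

lemma quo_rem: "f = quo f * g + rem f"
  by (simp add: rem_def)

lemma quo_eqI:
  assumes "f = s * g + r" "degree r < degree g"
  shows "quo f = s" "rem f = r"
proof -
  show "quo f = s"
    using division_unique[of f "quo f" s] degree_rem[of f] assms unfolding rem_def by simp
  then show "rem f = r" using assms by (simp add: rem_def)
qed

lemma quo_diff: "quo (f - h) = quo f - quo h" and rem_diff: "rem (f - h) = rem f - rem h"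
proof -
  have "f - h = (quo f - quo h) * g + (rem f - rem h)"
    using quo_rem[of f] quo_rem[of h] by (simp add: algebra_simps)
  from quo_eqI[OF this degree_diff_less[OF degree_rem degree_rem]]
  show "quo (f - h) = quo f - quo h" "rem (f - h) = rem f - rem h" by auto
qed

lemma quo_add: "quo (f + h) = quo f + quo h" and rem_add: "rem (f + h) = rem f + rem h"
proof -
  have "f + h = (quo f + quo h) * g + (rem f + rem h)"
    using quo_rem[of f] quo_rem[of h] by (simp add: algebra_simps)
  from quo_eqI[OF this degree_add_less[OF degree_rem degree_rem]]
  show "quo (f + h) = quo f + quo h" "rem (f + h) = rem f + rem h" by auto
qed

lemma quo_smult: "quo (smult c f) = smult c (quo f)" and rem_smult: "rem (smult c f) = smult c (rem f)"
proof -
  have "smult c f = smult c (quo f) * g + smult c (rem f)"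
    by (subst quo_rem[of f]) (simp add: smult_add_right)
  from quo_eqI[OF this] show "quo (smult c f) = smult c (quo f)" "rem (smult c f) = smult c (rem f)"
    using degree_smult_le[of c "rem f"] degree_rem[of f] by (auto intro: order.strict_trans1)
qed

lemma quo_small: "degree f < degree g \<Longrightarrow> quo f = 0" and rem_small: "degree f < degree g \<Longrightarrow> rem f = f"
  using quo_eqI[of f 0 f] by auto

lemma degree_quo: "degree (quo f) = degree f - degree g"
proof (cases "quo f = 0")
  case True
  then have "f = rem f" using quo_rem[of f] by simp
  then show ?thesis using True degree_rem[of f] by simp
next
  case False
  then have "degree (quo f * g) = degree (quo f) + degree g"
    by (intro degree_mult_eq) (auto simp: g_nonzero)
  moreover have "degree (quo f * g + rem f) = degree (quo f * g)"
    using degree_rem[of f] calculation by (intro degree_add_eq_left) linarith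
  ultimately show ?thesis using quo_rem[of f] by simp
qed

text \<open>The coefficient of \<open>g ^ j\<close> in the g-adic expansion of f. Iterating
  \<open>quo\<close> defines it for all j without a degree bound and makes it additive in f.\<close>

definition dig :: "nat \<Rightarrow> 'b poly \<Rightarrow> 'b poly" where
  "dig j f = rem ((quo ^^ j) f)"

lemma dig_0: "dig 0 f = rem f"
  by (simp add: dig_def)

lemma dig_Suc: "dig (Suc j) f = dig j (quo f)"
  by (simp add: dig_def funpow_swap1)

lemma degree_dig: "degree (dig j f) < degree g"
  by (simp add: dig_def degree_rem)

lemma dig_diff: "dig j (f - h) = dig j f - dig j h"
  by (induction j arbitrary: f h) (simp_all add: dig_0 dig_Suc rem_diff quo_diff)

lemma dig_add: "dig j (f + h) = dig j f + dig j h"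
  by (induction j arbitrary: f h) (simp_all add: dig_0 dig_Suc rem_add quo_add)

lemma dig_zero [simp]: "dig j 0 = 0"
  using dig_diff[of j 0 0] by simp

lemma dig_sum: "dig j (\<Sum>i\<in>A. f i) = (\<Sum>i\<in>A. dig j (f i))"
  by (induction A rule: infinite_finite_induct) (simp_all add: dig_add)

lemma dig_smult: "dig j (smult c f) = smult c (dig j f)"
  by (induction j arbitrary: f) (simp_all add: dig_0 dig_Suc rem_smult quo_smult)

lemma dig_monomial:
  assumes "degree c < degree g"
  shows "dig j (c * g ^ i) = (if j = i then c else 0)"
  using assms
proof (induction i arbitrary: j)
  case 0
  then show ?case by (cases j) (simp_all add: dig_0 dig_Suc quo_small rem_small)
next
  case (Suc i)
  have "c * g ^ Suc i = (c * g ^ i) * g + 0" by simp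
  from quo_eqI[OF this] have "quo (c * g ^ Suc i) = c * g ^ i" "rem (c * g ^ Suc i) = 0"
    using degree_pos by auto
  then show ?case using Suc by (cases j) (simp_all add: dig_0 dig_Suc)
qed

lemma dig_eq_0: "degree f < j * degree g \<Longrightarrow> dig j f = 0"
proof (induction j arbitrary: f)
  case (Suc j)
  show ?case
  proof (cases "degree f < degree g")
    case True then show ?thesis by (simp add: dig_Suc quo_small)
  next
    case False
    have "degree (quo f) < j * degree g" using Suc.prems False by (simp add: degree_quo)
    then show ?thesis by (simp add: dig_Suc Suc.IH)
  qed
qed simp

lemma dig_expansion: "degree f < J * degree g \<Longrightarrow> f = (\<Sum>j<J. dig j f * g ^ j)"
proof (induction J arbitrary: f)
  case (Suc J)
  show ?case
  proof (cases "J = 0")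
    case True
    then show ?thesis using Suc.prems by (simp add: dig_0 rem_small)
  next
    case False
    have "0 < J * degree g" using False degree_pos by simp
    then have "degree (quo f) < J * degree g" using Suc.prems unfolding degree_quo mult_Suc by linarith
    then have "quo f = (\<Sum>j<J. dig j (quo f) * g ^ j)" by (rule Suc.IH)
    then have "quo f * g = (\<Sum>j<J. dig (Suc j) f * g ^ Suc j)"
      by (metis (no_types, lifting) dig_Suc mult.assoc power_Suc2 sum.cong sum_distrib_right)
    moreover have "f = quo f * g + dig 0 f" by (simp add: dig_0 flip: quo_rem)
    ultimately show ?thesis by (simp add: sum.lessThan_Suc_shift add.commute del: sum.lessThan_Suc power_Suc)
  qed
qed simp

lemma dig_of_sum:
  assumes "\<And>i. i < J \<Longrightarrow> degree (c i) < degree g"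
  shows "dig j (\<Sum>i<J. c i * g ^ i) = (if j < J then c j else 0)"
proof -
  have "dig j (\<Sum>i<J. c i * g ^ i) = (\<Sum>i<J. if j = i then c i else 0)"
    unfolding dig_sum using assms by (intro sum.cong) (auto simp: dig_monomial)
  then show ?thesis by simp
qed

lemma degree_digit_sum:
  assumes "\<And>i. i < J \<Longrightarrow> degree (c i) < degree g" "J > 0"
  shows "degree (\<Sum>i<J. c i * g ^ i) < J * degree g"
proof (rule degree_sum_less)
  fix i assume "i \<in> {..<J}"
  then have "degree (c i * g ^ i) < (1 + i) * degree g"
    using degree_mult_le[of "c i" "g ^ i"] assms(1)[of i] by simp
  also have "\<dots> \<le> J * degree g" using \<open>i \<in> {..<J}\<close> by (intro mult_right_mono) auto
  finally show "degree (c i * g ^ i) < J * degree g" .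
qed (use assms degree_pos in simp)

lemma degree_minus_top_digit:
  assumes "degree f < Suc J * degree g" "J > 0"
  shows "degree (f - dig J f * g ^ J) < J * degree g"
proof -
  have "f - dig J f * g ^ J = (\<Sum>j<J. dig j f * g ^ j)"
    by (subst dig_expansion[OF assms(1)]) (simp add: dig_sum dig_monomial degree_dig)
  then show ?thesis using degree_digit_sum[of J "\<lambda>j. dig j f"] degree_dig assms by simp
qed

lemma dig_top_monic:
  assumes "lead_coeff f = 1" "degree f = n * degree g"
  shows "dig n f = 1"
proof (cases "n = 0")
  case True
  then show ?thesis using assms degree_pos by (simp add: dig_0 rem_small) (metis degree_eq_zeroE lead_coeff_pCons(2) one_pCons)
next
  case False
  have deg: "degree (f - g ^ n) < n * degree g"
  proof (rule ccontr)
    assume neg: "\<not> ?thesis"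
    then have "degree (f - g ^ n) = n * degree g"
      using degree_diff_le_max[of f "g ^ n"] assms by simp
    then have "f - g ^ n = 0"
      using assms lead_coeff_power_g[of n] by (metis coeff_diff degree_power_g diff_self leading_coeff_0_iff)
    then show False using neg False degree_pos by simp
  qed
  have "dig n f = dig n (f - g ^ n) + dig n (1 * g ^ n)" by (simp flip: dig_add)
  then show ?thesis using dig_eq_0[OF deg] dig_monomial[of 1 n n] degree_pos by simp
qed

lemma degree_diff_power_less:
  assumes "lead_coeff f = 1" "degree f = n * degree g" "n > 0"
  shows "degree (f - g ^ n) < n * degree g"
proof -
  have "degree f < Suc n * degree g" using assms degree_pos by simp
  from degree_minus_top_digit[OF this \<open>n > 0\<close>] show ?thesis
    using dig_top_monic[OF assms(1,2)] by simp
qed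

end

section \<open>Approximate roots\<close>

text \<open>\<open>\<psi> ^ N - \<phi> ^ N\<close> is \<open>\<psi> - \<phi>\<close> times a sum of
  N monic polynomials of degree (N - 1) n. The coefficient of that sum in degree (N - 1) n is N,
  which is nonzero.\<close>

lemma degree_power_diff:
  fixes \<psi> \<phi> :: "'b::idom poly"
  assumes "lead_coeff \<psi> = 1" "lead_coeff \<phi> = 1" "degree \<psi> = n" "degree \<phi> = n"
    and N: "of_nat N \<noteq> (0::'b)" and "\<psi> \<noteq> \<phi>"
  shows "\<psi> ^ N \<noteq> \<phi> ^ N" "degree (\<psi> ^ N - \<phi> ^ N) \<ge> (N - 1) * n"
proof -
  define S where "S = (\<Sum>i<N. \<phi> ^ (N - Suc i) * \<psi> ^ i)"
  have nz: "\<psi> \<noteq> 0" "\<phi> \<noteq> 0" using assms by auto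
  have "N > 0" using N by (cases N) auto
  have mon: "lead_coeff (\<phi> ^ (N - Suc i) * \<psi> ^ i) = 1" "degree (\<phi> ^ (N - Suc i) * \<psi> ^ i) = (N - 1) * n"
    if "i < N" for i
  proof -
    show "lead_coeff (\<phi> ^ (N - Suc i) * \<psi> ^ i) = 1"
      using assms(1,2) by (simp only: lead_coeff_mult lead_coeff_power power_one mult_1)
    have "degree (\<phi> ^ (N - Suc i) * \<psi> ^ i) = (N - Suc i) * n + i * n"
      using nz assms(3,4) by (simp add: degree_mult_eq degree_power_eq)
    also have "\<dots> = (N - 1) * n" using that by (simp flip: add_mult_distrib)
    finally show "degree (\<phi> ^ (N - Suc i) * \<psi> ^ i) = (N - 1) * n" .
  qed
  have "coeff S ((N - 1) * n) = (\<Sum>i<N. 1)"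
    unfolding S_def coeff_sum using mon by (intro sum.cong) (auto simp flip: mon(2))
  then have top: "coeff S ((N - 1) * n) \<noteq> 0" using N by simp
  then have S: "S \<noteq> 0" "degree S \<ge> (N - 1) * n" by (auto simp: le_degree)
  have eq: "\<psi> ^ N - \<phi> ^ N = (\<psi> - \<phi>) * S" unfolding S_def by (rule power_diff_sumr2)
  show "\<psi> ^ N \<noteq> \<phi> ^ N" using eq S \<open>\<psi> \<noteq> \<phi>\<close> by auto
  show "degree (\<psi> ^ N - \<phi> ^ N) \<ge> (N - 1) * n"
    unfolding eq using S \<open>\<psi> \<noteq> \<phi>\<close> by (simp add: degree_mult_eq)
qed

lemma approx_root_degree:
  assumes "is_approx_root N F \<psi>"
  shows "degree F = N * degree \<psi>"
  using assms by (simp add: is_approx_root_def)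

lemma diff_div_eq: "N > 0 \<Longrightarrow> N * n - N * n div N = (N - 1) * (n::nat)"
  by (simp add: diff_mult_distrib)

text \<open>Two polynomials that approximate F this well have N-th powers differing in degree below
  (N - 1) n, against \<open>degree_power_diff\<close>. The domain is arbitrary because the lemma is
  applied to F over K[[x]], to initial forms over the residue field, and to the reduction of F at x
  = 0.\<close>

lemma power_near_unique:
  fixes F :: "'b::idom poly"
  assumes "lead_coeff \<psi> = 1" "degree \<psi> = n" "F = \<psi> ^ N \<or> degree (F - \<psi> ^ N) < (N - 1) * n"
    and "lead_coeff \<phi> = 1" "degree \<phi> = n" "F = \<phi> ^ N \<or> degree (F - \<phi> ^ N) < (N - 1) * n"
    and "of_nat N \<noteq> (0::'b)"
  shows "\<psi> = \<phi>"
proof (rule ccontr)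
  assume neq: "\<psi> \<noteq> \<phi>"
  note d = degree_power_diff[OF assms(1,4,2,5,7) neq]
  have "\<psi> ^ N - \<phi> ^ N = (F - \<phi> ^ N) - (F - \<psi> ^ N)" by simp
  moreover have "F - \<phi> ^ N = 0 \<or> F - \<psi> ^ N = 0 \<or> degree ((F - \<phi> ^ N) - (F - \<psi> ^ N)) < (N - 1) * n"
    using assms(3,6) degree_diff_less by fastforce
  ultimately have "degree (\<psi> ^ N - \<phi> ^ N) < (N - 1) * n"
    using assms(3,6) d(1) by (metis diff_zero right_minus_eq degree_minus minus_diff_eq)
  then show False using d(2) by simp
qed

lemma approx_root_unique:
  fixes F :: "'b::idom poly"
  assumes "is_approx_root N F \<psi>" "is_approx_root N F \<phi>" "of_nat N \<noteq> (0::'b)"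
  shows "\<psi> = \<phi>"
proof -
  have "N > 0" using assms(3) by (cases N) auto
  have eq: "degree \<psi> = degree F div N" "degree \<phi> = degree F div N"
    using assms by (auto simp: is_approx_root_def)
  have F: "degree F = N * (degree F div N)"
    using assms(1) by (simp add: is_approx_root_def)
  have "degree F - degree F div N = (N - 1) * (degree F div N)"
    by (metis F \<open>N > 0\<close> diff_div_eq)
  then show ?thesis
    using assms(1,2) by (intro power_near_unique[OF _ eq(1) _ _ eq(2) _ assms(3), of F])
      (auto simp: is_approx_root_def)
qed

text \<open>To first order \<open>(\<phi> + a) ^ N\<close> adds
  \<open>of_nat N * a * \<phi> ^ (N - 1)\<close>, which cancels the digit of index N - 1 of the
  error. The higher binomial terms stay below the degree of the old error because deg a < n.\<close>

lemma tschirnhaus_step: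
  fixes F :: "'b::idom poly"
  assumes \<phi>: "lead_coeff \<phi> = 1" "degree \<phi> = n" "n > 0"
    and F: "lead_coeff F = 1" "degree F = N * n" "N > 1"
    and a: "of_nat N * a = monic_poly.dig \<phi> (N - 1) (F - \<phi> ^ N)" "of_nat N \<noteq> (0::'b)"
    and large: "degree (F - \<phi> ^ N) \<ge> (N - 1) * n"
  shows "degree a < n" "degree (F - (\<phi> + a) ^ N) < degree (F - \<phi> ^ N)"
proof -
  interpret monic_poly \<phi> using \<phi> by unfold_locales auto
  define E where "E = F - \<phi> ^ N"
  have Na: "degree (of_nat N * a) = degree a"
    using a(2) by (simp add: of_nat_poly)
  then show da: "degree a < n" using a(1) degree_dig \<phi> by metis
  have E: "degree E < N * n"
    unfolding E_def using degree_diff_power_less[OF F(1), of N] F \<phi> by simp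
  define E' where "E' = E - of_nat N * a * \<phi> ^ (N - 1)"
  have E': "degree E' < (N - 1) * n"
    unfolding E'_def using degree_minus_top_digit[of E "N - 1"] E F \<phi> a(1) by (simp add: E_def)
  have Epos: "degree E \<ge> (N - 1) * n" using large by (simp add: E_def)
  have a0: "a \<noteq> 0"
  proof
    assume "a = 0"
    then show False using E' Epos by (simp add: E'_def)
  qed
  \<comment> \<open>E has no digit above index N - 1, and that digit is N a, so deg a determines deg
    E. The binomial terms are compared with this value.\<close>
  have degE: "degree E = degree a + (N - 1) * n"
  proof -
    have "degree (of_nat N * a * \<phi> ^ (N - 1)) = degree a + (N - 1) * n"
      using Na a0 a(2) by (subst degree_mult_eq) (auto simp: g_nonzero \<phi>(2) of_nat_poly)
    moreover have "E = of_nat N * a * \<phi> ^ (N - 1) + E'" by (simp add: E'_def)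
    ultimately show ?thesis using E' by (metis degree_add_eq_left le_add2 order_less_le_trans)
  qed
  have "(\<phi> + a) ^ N = (\<Sum>i\<le>N. of_nat (N choose i) * a ^ i * \<phi> ^ (N - i))"
    by (subst add.commute) (rule binomial_ring)
  also have "{..N} = insert 0 (insert 1 {2..N})" using F(3) by auto
  also have "(\<Sum>i\<in>insert 0 (insert 1 {2..N}). of_nat (N choose i) * a ^ i * \<phi> ^ (N - i)) =
      \<phi> ^ N + (of_nat N * a * \<phi> ^ (N - 1) + (\<Sum>i\<in>{2..N}. of_nat (N choose i) * a ^ i * \<phi> ^ (N - i)))"
    by simp
  finally have eq: "F - (\<phi> + a) ^ N = E' - (\<Sum>i\<in>{2..N}. of_nat (N choose i) * a ^ i * \<phi> ^ (N - i))"
    by (simp add: E'_def E_def)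
  have Eg0: "degree E > 0" using Epos F(3) \<phi>(3) by (metis less_le_trans nat_0_less_mult_iff zero_less_diff)
  have "degree (\<Sum>i\<in>{2..N}. of_nat (N choose i) * a ^ i * \<phi> ^ (N - i)) < degree E"
  proof (rule degree_sum_less)
    fix i assume i: "i \<in> {2..N}"
    have "degree (of_nat (N choose i) * a ^ i * \<phi> ^ (N - i)) \<le> degree (of_nat (N choose i) * a ^ i) + (N - i) * n"
      using degree_mult_le[of "of_nat (N choose i) * a ^ i" "\<phi> ^ (N - i)"] \<phi>(2) by simp
    also have "degree (of_nat (N choose i) * a ^ i) \<le> degree (a ^ i)"
      by (simp add: of_nat_poly degree_smult_le)
    also have "degree (a ^ i) = i * degree a" using a0 by (simp add: degree_power_eq)
    \<comment> \<open>Compared with the first-order term, i - 1 factors of degree n have been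
      replaced by factors a of smaller degree.\<close>
    also have "i * degree a + (N - i) * n < degree a + (N - 1) * n"
    proof -
      obtain r where r: "i = Suc (Suc r)" using i by (metis atLeastAtMost_iff add_2_eq_Suc le_Suc_ex)
      have "i * degree a = degree a + (i - 1) * degree a" using r by simp
      moreover have "(i - 1) * degree a < (i - 1) * n" using da r by (intro mult_strict_left_mono) auto
      moreover have "(i - 1) * n + (N - i) * n = (N - 1) * n"
        using i r unfolding add_mult_distrib[symmetric] by (intro arg_cong2[of _ _ _ _ "(*)"]) auto
      ultimately show ?thesis by linarith
    qed
    also have "\<dots> = degree E" by (simp add: degE)
    finally show "degree (of_nat (N choose i) * a ^ i * \<phi> ^ (N - i)) < degree E" by simp
  qed (rule Eg0)
  then show "degree (F - (\<phi> + a) ^ N) < degree (F - \<phi> ^ N)"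
    unfolding eq using E' Epos by (intro degree_diff_less) (auto simp: E_def)
qed

text \<open>Tschirnhaus corrections lower the degree of the error until \<phi> is an approximate
  root. The invariant Q is threaded through so that a bound on the value of the starting polynomial
  passes to the root itself.\<close>

lemma approx_root_exists:
  fixes F :: "'b::idom poly"
  assumes F: "lead_coeff F = 1" "degree F = N * n" and N: "N > 1" and n: "n > 0"
    and unit: "of_nat N * (u::'b) = 1"
    and \<phi>: "lead_coeff \<phi> = 1" "degree \<phi> = n" "Q \<phi>"
    and step: "\<And>\<phi> a. Q \<phi> \<Longrightarrow> lead_coeff \<phi> = 1 \<Longrightarrow> degree \<phi> = n \<Longrightarrow> degree a < n \<Longrightarrow>
       a = smult u (monic_poly.dig \<phi> (N - 1) (F - \<phi> ^ N)) \<Longrightarrow> Q (\<phi> + a)"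
  shows "\<exists>\<psi>. Q \<psi> \<and> is_approx_root N F \<psi>"
  using \<phi>
proof (induction "degree (F - \<phi> ^ N)" arbitrary: \<phi> rule: less_induct)
  case (less \<phi>)
  have N0: "of_nat N \<noteq> (0::'b)" using unit by auto
  have div: "degree F div N = n" using F N by simp
  show ?case
  proof (cases "degree (F - \<phi> ^ N) < (N - 1) * n")
    case True
    then have "is_approx_root N F \<phi>"
      using less.prems F N by (simp add: is_approx_root_def div diff_mult_distrib)
    then show ?thesis using less.prems by blast
  next
    case False
    define a where "a = smult u (monic_poly.dig \<phi> (N - 1) (F - \<phi> ^ N))"
    have "of_nat N * a = monic_poly.dig \<phi> (N - 1) (F - \<phi> ^ N)"
      unfolding a_def using unit by (simp add: of_nat_poly mult.commute)
    from tschirnhaus_step[OF less.prems(1,2) n F N this N0] False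
    have *: "degree a < n" "degree (F - (\<phi> + a) ^ N) < degree (F - \<phi> ^ N)" by auto
    have "degree (\<phi> + a) = n" "lead_coeff (\<phi> + a) = 1"
      using * less.prems by (simp_all add: degree_add_eq_left lead_coeff_add_le coeff_eq_0)
    moreover have "Q (\<phi> + a)" using step[OF less.prems(3,1,2) *(1)] by (simp add: a_def)
    ultimately show ?thesis using less.hyps[OF *(2)] by blast
  qed
qed

section \<open>Polynomials over a subfield\<close>

definition is_subfield :: "'e::field set \<Rightarrow> bool" where
  "is_subfield S \<longleftrightarrow> 1 \<in> S \<and> (\<forall>a\<in>S. \<forall>b\<in>S. a - b \<in> S \<and> a * b \<in> S \<and> inverse a \<in> S)"

locale subfield_of =
  fixes S :: "'e::field set"
  assumes sub: "is_subfield S"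
begin

lemma one_mem: "1 \<in> S"
  and diff_mem: "a \<in> S \<Longrightarrow> b \<in> S \<Longrightarrow> a - b \<in> S"
  and mult_mem: "a \<in> S \<Longrightarrow> b \<in> S \<Longrightarrow> a * b \<in> S"
  and inverse_mem: "a \<in> S \<Longrightarrow> inverse a \<in> S"
  using sub by (auto simp: is_subfield_def)

lemma zero_mem: "0 \<in> S"
  using diff_mem[OF one_mem one_mem] by simp

lemma uminus_mem: "a \<in> S \<Longrightarrow> - a \<in> S"
  using diff_mem[OF zero_mem] by force

lemma add_mem: "a \<in> S \<Longrightarrow> b \<in> S \<Longrightarrow> a + b \<in> S"
  using diff_mem[of a "- b"] uminus_mem by force

lemma divide_mem: "a \<in> S \<Longrightarrow> b \<in> S \<Longrightarrow> a / b \<in> S"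
  by (simp add: divide_inverse mult_mem inverse_mem)

lemma power_mem: "a \<in> S \<Longrightarrow> a ^ n \<in> S"
  by (induction n) (auto simp: one_mem mult_mem)

lemma powi_mem: "a \<in> S \<Longrightarrow> a powi n \<in> S"
  by (simp add: power_int_def power_mem inverse_mem)

lemma of_nat_mem: "of_nat n \<in> S"
  by (induction n) (auto simp: zero_mem one_mem add_mem)

lemma sum_mem: "(\<And>i. i \<in> A \<Longrightarrow> f i \<in> S) \<Longrightarrow> sum f A \<in> S"
  by (induction A rule: infinite_finite_induct) (auto simp: zero_mem add_mem)

abbreviation PS where "PS \<equiv> polys_over S"

lemma PS_coeff: "p \<in> PS \<Longrightarrow> coeff p i \<in> S"
  by (simp add: polys_over_def)

lemma PS_0: "0 \<in> PS" and PS_1: "1 \<in> PS"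
  by (auto simp: polys_over_def zero_mem one_mem coeff_pCons one_pCons split: nat.split)

lemma PS_diff: "p \<in> PS \<Longrightarrow> r \<in> PS \<Longrightarrow> p - r \<in> PS"
  by (simp add: polys_over_def diff_mem)

lemma PS_add: "p \<in> PS \<Longrightarrow> r \<in> PS \<Longrightarrow> p + r \<in> PS"
  by (simp add: polys_over_def add_mem)

lemma PS_mult: "p \<in> PS \<Longrightarrow> r \<in> PS \<Longrightarrow> p * r \<in> PS"
  by (auto simp: polys_over_def coeff_mult intro!: sum_mem mult_mem)

lemma PS_power: "p \<in> PS \<Longrightarrow> p ^ n \<in> PS"
  by (induction n) (auto simp: PS_1 PS_mult)

lemma PS_smult: "c \<in> S \<Longrightarrow> p \<in> PS \<Longrightarrow> smult c p \<in> PS"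
  by (simp add: polys_over_def mult_mem)

lemma PS_monom: "c \<in> S \<Longrightarrow> monom c n \<in> PS"
  by (simp add: polys_over_def zero_mem)

lemma PS_sum: "(\<And>i. i \<in> A \<Longrightarrow> f i \<in> PS) \<Longrightarrow> sum f A \<in> PS"
  by (induction A rule: infinite_finite_induct) (auto simp: PS_0 PS_add)

lemma PS_pderiv: "p \<in> PS \<Longrightarrow> pderiv p \<in> PS"
  unfolding polys_over_def coeff_pderiv mem_Collect_eq by (intro allI mult_mem of_nat_mem) auto

lemma PS_const: "c \<in> S \<Longrightarrow> [:c:] \<in> PS"
  using PS_monom[of c 0] by (simp add: monom_0)

section \<open>Division and Bezout relations with coefficients in the subfield\<close>

lemma PS_division:
  assumes "p \<in> PS" "r \<in> PS" "r \<noteq> 0"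
  shows "\<exists>s\<in>PS. \<exists>t\<in>PS. p = s * r + t \<and> (t = 0 \<or> degree t < degree r)"
  using assms(1)
proof (induction "degree p" arbitrary: p rule: less_induct)
  case (less p)
  show ?case
  proof (cases "p = 0 \<or> degree p < degree r")
    case True
    then have "p = 0 * r + p \<and> (p = 0 \<or> degree p < degree r)" by simp
    then show ?thesis using less.prems PS_0 by blast
  next
    case False
    define c where "c = lead_coeff p / lead_coeff r"
    define m where "m = monom c (degree p - degree r)"
    have m: "m \<in> PS" unfolding m_def c_def
      using less.prems assms(2) by (intro PS_monom divide_mem PS_coeff)
    have "c \<noteq> 0" using False assms(3) by (simp add: c_def)
    then have degm: "degree m = degree p - degree r"
      unfolding m_def by (rule Polynomial.degree_monom_eq)
    have dm: "degree (m * r) = degree p"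
      using False assms(3) degm \<open>c \<noteq> 0\<close> by (subst degree_mult_eq) (auto simp: m_def)
    have lm: "lead_coeff (m * r) = lead_coeff p"
    proof -
      have "lead_coeff m = c" unfolding degm by (simp add: m_def)
      then show ?thesis using assms(3) by (simp only: lead_coeff_mult) (simp add: c_def)
    qed
    have pm: "p - m * r \<in> PS" by (intro PS_diff PS_mult m less.prems assms(2))
    have "\<exists>s\<in>PS. \<exists>t\<in>PS. p - m * r = s * r + t \<and> (t = 0 \<or> degree t < degree r)"
    proof (cases "degree (p - m * r) < degree p")
      case True
      then show ?thesis using less.hyps pm by blast
    next
      case ge: False
      have "degree (p - m * r) \<le> degree p" using degree_diff_le_max[of p "m * r"] dm by simp
      then have "degree (p - m * r) = degree p" using ge by simp
      then have "lead_coeff (p - m * r) = 0" using lm dm by simp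
      then have "p - m * r = 0" by (rule leading_coeff_0_iff[THEN iffD1])
      then show ?thesis using PS_0 by (intro bexI[of _ 0] bexI[of _ 0]) auto
    qed
    then obtain s t where "s \<in> PS" "t \<in> PS" "p - m * r = s * r + t" "t = 0 \<or> degree t < degree r"
      by blast
    then show ?thesis using PS_add[OF \<open>s \<in> PS\<close> m]
      by (intro bexI[of _ "s + m"] bexI[of _ t]) (auto simp: algebra_simps)
  qed
qed

text \<open>Quotient and remainder are unique over the ambient field, so those found inside S are
  the ambient \<open>div\<close> and \<open>mod\<close>.\<close>

lemma PS_div: "p \<in> PS \<Longrightarrow> r \<in> PS \<Longrightarrow> p div r \<in> PS"
  and PS_mod: "p \<in> PS \<Longrightarrow> r \<in> PS \<Longrightarrow> p mod r \<in> PS"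
proof -
  assume pr: "p \<in> PS" "r \<in> PS"
  have "p div r \<in> PS \<and> p mod r \<in> PS"
  proof (cases "r = 0")
    case False
    obtain s t where st: "s \<in> PS" "t \<in> PS" "p = s * r + t" "t = 0 \<or> degree t < degree r"
      using PS_division[OF pr False] by blast
    have "t div r = 0" "t mod r = t" using st(4) div_poly_less mod_poly_less by auto
    then have "p div r = s" "p mod r = t" using False by (auto simp: st(3))
    then show ?thesis using st by simp
  qed (simp add: PS_0 pr)
  then show "p div r \<in> PS" "p mod r \<in> PS" by auto
qed

lemma PS_dvdE:
  assumes "r dvd p" "p \<in> PS" "r \<in> PS"
  obtains s where "s \<in> PS" "p = r * s"
  using assms PS_div[OF assms(2,3)] by (metis dvd_mult_div_cancel)

text \<open>A nonzero combination of p and r of least degree divides both: the remainder of another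
  combination by it is again a combination, of smaller degree.\<close>

lemma bezout_or_common_factor:
  assumes "p \<in> PS" "r \<in> PS" "r \<noteq> 0"
  shows "\<exists>u\<in>PS. \<exists>v\<in>PS. u * p + v * r \<noteq> 0 \<and> u * p + v * r dvd p \<and> u * p + v * r dvd r"
proof -
  define I where "I = {w. w \<noteq> 0 \<and> (\<exists>u\<in>PS. \<exists>v\<in>PS. w = u * p + v * r)}"
  have "r = 0 * p + 1 * r" "p = 1 * p + 0 * r" by simp_all
  note * = this
  have "r \<in> I" using assms(3) PS_0 PS_1 *(1) unfolding I_def by blast
  then obtain w where w: "w \<in> I" "\<And>y. y \<in> I \<Longrightarrow> degree w \<le> degree y"
    using ex_has_least_nat[of "\<lambda>w. w \<in> I" r degree] by blast
  then obtain u v where uv: "u \<in> PS" "v \<in> PS" "w = u * p + v * r" "w \<noteq> 0" by (auto simp: I_def)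
  have wPS: "w \<in> PS" using uv assms by (auto intro: PS_add PS_mult)
  have dvd: "w dvd y" if y: "y \<in> PS" "\<exists>a\<in>PS. \<exists>b\<in>PS. y = a * p + b * r" for y
  proof (rule ccontr)
    assume "\<not> w dvd y"
    then have nz: "y mod w \<noteq> 0" by (simp add: mod_eq_0_iff_dvd)
    obtain a b where ab: "a \<in> PS" "b \<in> PS" "y = a * p + b * r" using y by blast
    define s where "s = y div w"
    have s: "s \<in> PS" unfolding s_def by (rule PS_div[OF y(1) wPS])
    have "y mod w = y - s * w" by (simp add: s_def minus_div_mult_eq_mod)
    also have "\<dots> = (a - s * u) * p + (b - s * v) * r" by (simp add: ab uv(3) algebra_simps)
    finally have "y mod w \<in> I"
      using nz PS_diff[OF ab(1) PS_mult[OF s uv(1)]] PS_diff[OF ab(2) PS_mult[OF s uv(2)]]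
      unfolding I_def by blast
    then have "degree w \<le> degree (y mod w)" by (rule w(2))
    moreover have "degree (y mod w) < degree w" using nz degree_mod_less[OF uv(4), of y] by simp
    ultimately show False by simp
  qed
  have "w dvd p" "w dvd r" using dvd[OF assms(1)] dvd[OF assms(2)] PS_0 PS_1 * by blast+
  then show ?thesis using uv by blast
qed

lemma bezout_scale:
  assumes "p \<in> PS" "r \<in> PS" "u \<in> PS" "v \<in> PS" "degree (u * p + v * r) = 0" "u * p + v * r \<noteq> 0"
  shows "\<exists>u\<in>PS. \<exists>v\<in>PS. u * p + v * r = 1"
proof -
  define w where "w = u * p + v * r"
  obtain c where c: "w = [:c:]" using assms(5) degree_eq_zeroE w_def by metis
  have "w \<in> PS" using assms by (auto simp: w_def intro: PS_add PS_mult)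
  then have cS: "inverse c \<in> S" using c PS_coeff[of w 0] inverse_mem by simp
  have "c \<noteq> 0" using assms(6) c by (auto simp: w_def)
  have "smult (inverse c) u * p + smult (inverse c) v * r = smult (inverse c) w"
    by (simp add: w_def smult_add_right)
  also have "\<dots> = 1" using c \<open>c \<noteq> 0\<close> by simp
  finally show ?thesis using assms cS by (intro bexI[of _ "smult (inverse c) u"] bexI[of _ "smult (inverse c) v"] PS_smult) auto
qed

text \<open>The combination from \<open>bezout_or_common_factor\<close> divides P, so it is constant
  or an associate of P; in the second case P would divide A.\<close>

lemma irreducible_bezout:
  assumes P: "irreducible_over S P" and A: "A \<in> PS" "\<not> P dvd A"
  shows "\<exists>u\<in>PS. \<exists>v\<in>PS. u * A + v * P = 1"
proof -
  have P': "P \<in> PS" "P \<noteq> 0" using P by (auto simp: irreducible_over_def)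
  obtain u v where uv: "u \<in> PS" "v \<in> PS" "u * A + v * P \<noteq> 0" "u * A + v * P dvd A" "u * A + v * P dvd P"
    using bezout_or_common_factor[OF A(1) P'] by blast
  define w where "w = u * A + v * P"
  have wPS: "w \<in> PS" using uv A P' by (auto simp: w_def intro: PS_add PS_mult)
  obtain s where s: "s \<in> PS" "P = w * s" using PS_dvdE[OF _ P'(1) wPS] uv(5) w_def by metis
  have "degree w = 0 \<or> degree s = 0" using P s wPS by (auto simp: irreducible_over_def)
  then have "degree w = 0"
  proof
    assume "degree s = 0"
    then have "s dvd 1" using s P'(2) by (metis is_unit_iff_degree mult_zero_right)
    then have "P dvd w" using s by (metis dvd_refl dvd_mult_unit_iff' mult.commute)
    then show ?thesis using uv(4) A(2) dvd_trans w_def by blast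
  qed
  then show ?thesis using bezout_scale[OF A(1) P'(1) uv(1,2)] uv(3) w_def by simp
qed

lemma bezout_power:
  assumes "A \<in> PS" "P \<in> PS" "u \<in> PS" "v \<in> PS" "u * A + v * P = 1"
  shows "\<exists>u\<in>PS. \<exists>v\<in>PS. u * A + v * P ^ n = 1"
proof (induction n)
  case 0
  then show ?case using PS_0 PS_1 by (intro bexI[of _ 0] bexI[of _ 1]) auto
next
  case (Suc n)
  then obtain a b where ab: "a \<in> PS" "b \<in> PS" "a * A + b * P ^ n = 1" by blast
  have "1 = (u * A + v * P) * (a * A + b * P ^ n)" using ab assms by simp
  also have "\<dots> = (u * (a * A + b * P ^ n) + v * P * a) * A + (v * b) * P ^ Suc n"
    by (simp add: algebra_simps)
  finally show ?case using ab assms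
    by (intro bexI[of _ "u * (a * A + b * P ^ n) + v * P * a"] bexI[of _ "v * b"] PS_add PS_mult PS_power) auto
qed

lemma irreducible_factor_exists:
  assumes "f \<in> PS" "degree f > 0"
  shows "\<exists>P. irreducible_over S P \<and> lead_coeff P = 1 \<and> P dvd f"
  using assms
proof (induction "degree f" arbitrary: f rule: less_induct)
  case (less f)
  show ?case
  proof (cases "irreducible_over S f")
    case True
    define c where "c = inverse (lead_coeff f)"
    have c: "c \<noteq> 0" "c \<in> S" using less.prems by (auto simp: c_def intro: inverse_mem PS_coeff)
    have "irreducible_over S (smult c f)"
      unfolding irreducible_over_def
    proof (intro conjI ballI impI)
      show "smult c f \<in> PS" using c less.prems by (simp add: PS_smult)
      show "degree (smult c f) > 0" using c less.prems by simp
      fix A B assume AB: "A \<in> PS" "B \<in> PS" "smult c f = A * B"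
      have "f = smult (inverse c) (smult c f)" using c by simp
      also have "\<dots> = smult (inverse c) A * B" using AB by simp
      finally have "degree (smult (inverse c) A) = 0 \<or> degree B = 0"
        using True AB(2) PS_smult[OF inverse_mem[OF c(2)] AB(1)] unfolding irreducible_over_def by metis
      then show "degree A = 0 \<or> degree B = 0" using c by auto
    qed
    moreover have "lead_coeff (smult c f) = 1" using less.prems by (auto simp: c_def)
    moreover have "smult c f dvd f" using c by (simp add: smult_dvd_iff)
    ultimately show ?thesis by blast
  next
    case False
    then obtain A B where AB: "A \<in> PS" "B \<in> PS" "f = A * B" "degree A > 0" "degree B > 0"
      using less.prems by (auto simp: irreducible_over_def)
    then have "degree f = degree A + degree B" by (metis degree_0 degree_mult_eq less_irrefl)
    then obtain P where "irreducible_over S P" "lead_coeff P = 1" "P dvd A"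
      using less.hyps[of A] AB by auto
    then show ?thesis using AB by auto
  qed
qed

lemma power_factor_split:
  fixes f P :: "'e poly"
  assumes "f \<noteq> 0" "degree P > 0"
  shows "\<exists>n B. f = P ^ n * B \<and> \<not> P dvd B"
  using assms(1)
proof (induction "degree f" arbitrary: f rule: less_induct)
  case (less f)
  show ?case
  proof (cases "P dvd f")
    case True
    then obtain h where h: "f = P * h" by (auto simp: dvd_def)
    then have "h \<noteq> 0" "degree f = degree P + degree h" using less.prems by (auto simp: degree_mult_eq)
    then obtain n B where "h = P ^ n * B" "\<not> P dvd B" using less.hyps[of h] assms(2) by auto
    then have "f = P ^ Suc n * B \<and> \<not> P dvd B" by (simp add: h)
    then show ?thesis by blast
  next
    case False
    then show ?thesis by (intro exI[of _ 0] exI[of _ f]) simp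
  qed
qed

lemma monic_mult_cancel:
  fixes A B :: "'b::idom poly"
  assumes "lead_coeff (A * B) = 1" "lead_coeff A = 1"
  shows "lead_coeff B = 1"
  using assms by (simp add: lead_coeff_mult)

text \<open>Strip from f all powers of one irreducible factor P. What remains is 1, so that f is a
  power of P, or it has positive degree and is coprime to the stripped power.\<close>

lemma power_of_irreducible_or_coprime_split:
  assumes f: "f \<in> PS" "lead_coeff f = 1" "degree f > 0"
  shows "(\<exists>P N. irreducible_over S P \<and> lead_coeff P = 1 \<and> f = P ^ N) \<or>
    (\<exists>A\<in>PS. \<exists>B\<in>PS. lead_coeff A = 1 \<and> lead_coeff B = 1 \<and> degree A > 0 \<and> degree B > 0 \<and> f = A * B \<and>
      (\<exists>u\<in>PS. \<exists>v\<in>PS. u * A + v * B = 1))"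
proof -
  obtain P where P: "irreducible_over S P" "lead_coeff P = 1" "P dvd f"
    using irreducible_factor_exists f by blast
  have P': "P \<in> PS" "degree P > 0" using P by (auto simp: irreducible_over_def)
  obtain n B where nB: "f = P ^ n * B" "\<not> P dvd B" using power_factor_split[of f P] f(3) P' by fastforce
  have PnS: "P ^ n \<in> PS" "lead_coeff (P ^ n) = 1" using P P' by (auto simp: PS_power lead_coeff_power)
  have B1: "lead_coeff B = 1" using f nB PnS by (metis monic_mult_cancel)
  obtain s where s: "s \<in> PS" "f = P ^ n * s" by (rule PS_dvdE[of "P ^ n" f]) (use nB f PnS in auto)
  moreover have "P ^ n \<noteq> 0" using P' by auto
  ultimately have BS: "B \<in> PS" using nB(1) by (metis mult_cancel_left)
  have "n > 0" using nB P(3) by (cases n) auto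
  show ?thesis
  proof (cases "degree B = 0")
    case True
    then have "B = 1" using B1 by (metis degree_eq_zeroE lead_coeff_pCons(2) one_pCons)
    then show ?thesis using P nB by auto
  next
    case False
    obtain u v where "u \<in> PS" "v \<in> PS" "u * B + v * P = 1"
      using irreducible_bezout[OF P(1) BS nB(2)] by blast
    then obtain u v where "u \<in> PS" "v \<in> PS" "u * B + v * P ^ n = 1"
      using bezout_power[OF BS P'(1)] by blast
    moreover have "degree (P ^ n) > 0" using \<open>n > 0\<close> P' by (subst degree_power_eq) auto
    ultimately show ?thesis using False nB BS B1 PnS
      by (intro disjI2 bexI[of _ "P ^ n"] bexI[of _ B]) (auto simp: add.commute)
  qed
qed

text \<open>Divide out P as long as it divides A. When it does not, a Bezout relation between A and
  \<open>P ^ Suc n\<close>, itself a multiple of A, makes A a unit.\<close>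

lemma monic_factor_of_power:
  assumes P: "irreducible_over S P" "lead_coeff P = 1"
    and "A \<in> PS" "lead_coeff A = 1" "A * B = P ^ n"
  shows "\<exists>a. A = P ^ a"
  using assms(3-)
proof (induction n arbitrary: A)
  case 0
  then have "A dvd 1" by (metis dvd_triv_left power_0)
  then have "degree A = 0" using 0 by (metis is_unit_iff_degree zero_neq_one leading_coeff_0_iff)
  then have "A = P ^ 0" using 0 by (metis degree_eq_zeroE lead_coeff_pCons(2) one_pCons power_0)
  then show ?case by blast
next
  case (Suc n)
  have P': "P \<in> PS" "P \<noteq> 0" using P by (auto simp: irreducible_over_def)
  show ?case
  proof (cases "P dvd A")
    case True
    obtain s where s: "s \<in> PS" "A = P * s" using PS_dvdE[OF True Suc.prems(1) P'(1)] by blast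
    have "s * B = P ^ n" using Suc.prems(3) s P' by simp
    moreover have "lead_coeff s = 1" using Suc.prems(2) P(2) s by (simp add: lead_coeff_mult)
    ultimately obtain a where "s = P ^ a" using Suc.IH s by blast
    then have "A = P ^ Suc a" using s by simp
    then show ?thesis by blast
  next
    case False
    obtain u v where "u \<in> PS" "v \<in> PS" "u * A + v * P = 1"
      using irreducible_bezout[OF P(1) Suc.prems(1) False] by blast
    then obtain u v where "u * A + v * P ^ Suc n = 1"
      using bezout_power[OF Suc.prems(1) P'(1)] by blast
    then have "u * A + v * (A * B) = 1" by (simp only: Suc.prems(3))
    then have "A * (u + v * B) = 1" by (simp add: algebra_simps)
    then have "A dvd 1" by (metis dvd_triv_left)
    then have "degree A = 0" using Suc.prems(2) by (metis is_unit_iff_degree zero_neq_one leading_coeff_0_iff)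
    then have "A = P ^ 0" using Suc.prems(2) by (metis degree_eq_zeroE lead_coeff_pCons(2) one_pCons power_0)
    then show ?thesis by blast
  qed
qed

end

section \<open>Graded filtrations attached to key polynomials\<close>

text \<open>
  \<open>Fil \<alpha> f\<close> says that the MacLane valuation of \<open>f\<close> is at least \<open>\<alpha>\<close>, for \<open>f\<close> of degree less than
  that of the key polynomial \<open>\<psi>\<close>; then \<open>\<kappa> \<alpha> f\<close> is the coefficient of its initial form in degree \<open>\<alpha>\<close>
  (zero if the valuation exceeds \<open>\<alpha>\<close>). \<open>v\<close> is a lower bound for the value of \<open>\<psi>\<close>.
\<close>

locale key_level = monic_poly \<psi> + subfield_of S
  for \<psi> :: "'a::field fps poly" and S :: "'e::field set" +
  fixes v :: int and Fil :: "int \<Rightarrow> 'a fps poly \<Rightarrow> bool" and \<kappa> :: "int \<Rightarrow> 'a fps poly \<Rightarrow> 'e"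
  assumes v_nonneg: "0 \<le> v"
    and Fil_0: "Fil \<alpha> 0"
    and Fil_diff: "degree f < degree \<psi> \<Longrightarrow> degree h < degree \<psi> \<Longrightarrow> Fil \<alpha> f \<Longrightarrow> Fil \<alpha> h \<Longrightarrow> Fil \<alpha> (f - h)"
    and \<kappa>_diff: "degree f < degree \<psi> \<Longrightarrow> degree h < degree \<psi> \<Longrightarrow> Fil \<alpha> f \<Longrightarrow> Fil \<alpha> h \<Longrightarrow>
      \<kappa> \<alpha> (f - h) = \<kappa> \<alpha> f - \<kappa> \<alpha> h"
    and Fil_succ: "degree f < degree \<psi> \<Longrightarrow> Fil (\<alpha> + 1) f \<longleftrightarrow> Fil \<alpha> f \<and> \<kappa> \<alpha> f = 0"
    and Fil_nonpos: "degree f < degree \<psi> \<Longrightarrow> \<alpha> \<le> 0 \<Longrightarrow> Fil \<alpha> f"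
    and Fil_mult: "degree f < degree \<psi> \<Longrightarrow> degree h < degree \<psi> \<Longrightarrow> f * h = s * \<psi> + r \<Longrightarrow> degree r < degree \<psi> \<Longrightarrow>
      Fil \<alpha> f \<Longrightarrow> Fil \<beta> h \<Longrightarrow> Fil (\<alpha> + \<beta> - v) s \<and> Fil (\<alpha> + \<beta>) r \<and> \<kappa> (\<alpha> + \<beta>) r = \<kappa> \<alpha> f * \<kappa> \<beta> h"
    and \<kappa>_one: "\<kappa> 0 1 = 1"
    and \<kappa>_mem: "degree f < degree \<psi> \<Longrightarrow> Fil \<alpha> f \<Longrightarrow> \<kappa> \<alpha> f \<in> S"
    and \<kappa>_surj: "v \<le> \<alpha> \<Longrightarrow> c \<in> S \<Longrightarrow> \<exists>f. degree f < degree \<psi> \<and> Fil \<alpha> f \<and> \<kappa> \<alpha> f = c"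
    and Fil_dvd: "\<exists>\<beta>. \<forall>f. degree f < degree \<psi> \<longrightarrow> Fil \<beta> f \<longrightarrow> [:fps_X ^ M:] dvd f"
begin

lemma \<kappa>_0 [simp]: "\<kappa> \<alpha> 0 = 0"
  using \<kappa>_diff[of 0 0 \<alpha>] Fil_0 degree_pos by simp

lemma Fil_mono:
  assumes "degree f < degree \<psi>" "\<alpha> \<le> \<beta>" "Fil \<beta> f"
  shows "Fil \<alpha> f"
proof -
  have "Fil (\<alpha> + int n) f \<Longrightarrow> Fil \<alpha> f" for n
  proof (induction n)
    case (Suc n)
    then have "Fil (\<alpha> + int n + 1) f" by (simp add: algebra_simps)
    then show ?case using Fil_succ[OF assms(1)] Suc.IH by blast
  qed simp
  from this[of "nat (\<beta> - \<alpha>)"] show ?thesis using assms by simp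
qed

lemma \<kappa>_eq_0: "degree f < degree \<psi> \<Longrightarrow> \<alpha> < \<beta> \<Longrightarrow> Fil \<beta> f \<Longrightarrow> \<kappa> \<alpha> f = 0"
  using Fil_succ[of f \<alpha>] Fil_mono[of f "\<alpha> + 1" \<beta>] by simp

end

text \<open>The values of digits are multiplied by q and \<psi> gets the integer u = q v + m, that
  is v + m/q in the old scale. m > 0 raises \<psi> strictly above the bound v. The unit
  \<open>lam\<close> fixes the scale of Y: the initial form of \<psi> is lam Y.\<close>

locale key_slope = key_level \<psi> S v Fil \<kappa>
  for \<psi> :: "'a::field fps poly" and S :: "'e::field set" and v Fil \<kappa> +
  fixes q m :: nat and lam :: 'e
  assumes q_pos: "q > 0" and m_pos: "m > 0" and lam: "lam \<in> S" "lam \<noteq> 0"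
begin

section \<open>The augmented filtration, its initial forms and their multiplicativity\<close>

definition u :: int where "u = int q * v + int m"

text \<open>\<open>\<lceil>(\<alpha> - j u)/q\<rceil>\<close>\<close>

definition cl :: "int \<Rightarrow> nat \<Rightarrow> int" where
  "cl \<alpha> j = - ((int j * u - \<alpha>) div int q)"

lemma u_pos: "u > 0"
  using v_nonneg m_pos by (simp add: u_def add_nonneg_pos)

text \<open>The adjunction that characterizes the ceiling; it turns comparisons of values into
  linear inequalities.\<close>

lemma cl_le_iff: "cl \<alpha> j \<le> x \<longleftrightarrow> \<alpha> \<le> int q * x + int j * u"
proof -
  have q: "int q > 0" using q_pos by simp
  have "cl \<alpha> j \<le> x \<longleftrightarrow> - x \<le> (int j * u - \<alpha>) div int q" unfolding cl_def by linarith
  also have "\<dots> \<longleftrightarrow> - x * int q \<le> int j * u - \<alpha>"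
  proof
    assume "- x \<le> (int j * u - \<alpha>) div int q"
    then have "- x * int q \<le> (int j * u - \<alpha>) div int q * int q" using q by (intro mult_right_mono) auto
    also have "\<dots> \<le> int j * u - \<alpha>"
      using pos_mod_sign[OF q, of "int j * u - \<alpha>"] by (simp add: minus_mod_eq_div_mult[symmetric])
    finally show "- x * int q \<le> int j * u - \<alpha>" .
  next
    assume "- x * int q \<le> int j * u - \<alpha>"
    from zdiv_mono1[OF this q] show "- x \<le> (int j * u - \<alpha>) div int q"
      using q nonzero_mult_div_cancel_right[of "int q" "- x"] by simp
  qed
  finally show ?thesis by (simp add: algebra_simps)
qed

lemma cl_bound: "\<alpha> \<le> int q * cl \<alpha> j + int j * u"
  using cl_le_iff by blast

lemma cl_exact: "\<alpha> = int q * x + int j * u \<Longrightarrow> cl \<alpha> j = x"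
proof -
  assume *: "\<alpha> = int q * x + int j * u"
  then have "cl \<alpha> j \<le> x" by (simp add: cl_le_iff)
  moreover have "\<not> cl \<alpha> j \<le> x - 1" unfolding cl_le_iff * right_diff_distrib using q_pos by simp
  ultimately show ?thesis by linarith
qed

lemma div_exact: "int q dvd \<alpha> - int j * u \<Longrightarrow> (\<alpha> - int j * u) div int q = cl \<alpha> j"
  using cl_exact[of \<alpha> "(\<alpha> - int j * u) div int q" j] by simp

lemma cl_dvd: "int q dvd \<alpha> - int j * u \<Longrightarrow> \<alpha> = int q * cl \<alpha> j + int j * u"
  using div_exact[of \<alpha> j] by (metis add.commute diff_add_cancel dvd_mult_div_cancel)

lemma cl_shift: "cl (\<alpha> - int M * u) j = cl \<alpha> (j + M)"
  by (simp add: cl_def algebra_simps)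

lemma cl_succ: "cl (\<alpha> + 1) j = (if int q dvd \<alpha> - int j * u then cl \<alpha> j + 1 else cl \<alpha> j)"
proof -
  have le: "cl \<alpha> j \<le> cl (\<alpha> + 1) j" "cl (\<alpha> + 1) j \<le> cl \<alpha> j + 1"
  proof -
    show "cl \<alpha> j \<le> cl (\<alpha> + 1) j"
      unfolding cl_le_iff using cl_bound[of "\<alpha> + 1" j] by linarith
    show "cl (\<alpha> + 1) j \<le> cl \<alpha> j + 1"
      unfolding cl_le_iff distrib_left using cl_bound[of \<alpha> j] q_pos by linarith
  qed
  have "cl (\<alpha> + 1) j \<le> cl \<alpha> j \<longleftrightarrow> \<alpha> \<noteq> int q * cl \<alpha> j + int j * u"
    unfolding cl_le_iff using cl_bound[of \<alpha> j] by linarith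
  also have "\<dots> \<longleftrightarrow> \<not> int q dvd \<alpha> - int j * u"
    using cl_dvd[of \<alpha> j] by (metis add_diff_cancel_right' dvd_triv_left)
  finally show ?thesis using le by auto
qed

text \<open>The value of G is the minimum over its \<psi>-adic terms. A term c \<psi>^j has q times
  the value of c, plus j u, so c must have value at least the ceiling of (\<alpha> - j u)/q.\<close>

definition FW :: "int \<Rightarrow> 'a fps poly \<Rightarrow> bool" where
  "FW \<alpha> G \<longleftrightarrow> (\<forall>j. Fil (cl \<alpha> j) (dig j G))"

definition kw :: "int \<Rightarrow> nat \<Rightarrow> 'a fps poly \<Rightarrow> 'e" where
  "kw \<alpha> j c = (if int q dvd \<alpha> - int j * u then \<kappa> (cl \<alpha> j) c * lam ^ j else 0)"

text \<open>The initial form of G in degree \<alpha>, a polynomial in Y; it is zero when the value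
  of G exceeds \<alpha>. Digits of index above \<open>degree G\<close> vanish because \<psi> has
  positive degree.\<close>

definition KW :: "int \<Rightarrow> 'a fps poly \<Rightarrow> 'e poly" where
  "KW \<alpha> G = (\<Sum>j\<le>degree G. monom (kw \<alpha> j (dig j G)) j)"

lemma kw_0 [simp]: "kw \<alpha> j 0 = 0"
  by (simp add: kw_def)

lemma dig_high: "degree G < j \<Longrightarrow> dig j G = 0"
  using degree_pos by (intro dig_eq_0) (metis Suc_leI less_le_trans mult.right_neutral mult_le_mono2 One_nat_def)

lemma coeff_KW: "coeff (KW \<alpha> G) j = kw \<alpha> j (dig j G)"
  by (auto simp: KW_def coeff_sum dig_high not_le)

lemma Fil_clI: "degree f < degree \<psi> \<Longrightarrow> Fil x f \<Longrightarrow> \<alpha> \<le> int q * x + int j * u \<Longrightarrow> Fil (cl \<alpha> j) f"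
  using Fil_mono[of f "cl \<alpha> j" x] cl_le_iff by simp

lemma FW_0: "FW \<alpha> 0"
  by (simp add: FW_def Fil_0)

lemma FW_diff: "FW \<alpha> G \<Longrightarrow> FW \<alpha> H \<Longrightarrow> FW \<alpha> (G - H)"
  by (simp add: FW_def dig_diff Fil_diff degree_dig)

lemma kw_diff:
  "degree f < degree \<psi> \<Longrightarrow> degree h < degree \<psi> \<Longrightarrow> Fil (cl \<alpha> j) f \<Longrightarrow> Fil (cl \<alpha> j) h \<Longrightarrow>
    kw \<alpha> j (f - h) = kw \<alpha> j f - kw \<alpha> j h"
  by (simp add: kw_def \<kappa>_diff algebra_simps)

lemma KW_diff: "FW \<alpha> G \<Longrightarrow> FW \<alpha> H \<Longrightarrow> KW \<alpha> (G - H) = KW \<alpha> G - KW \<alpha> H"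
  by (intro poly_eqI) (simp add: coeff_KW FW_def dig_diff kw_diff degree_dig)

lemma KW_0 [simp]: "KW \<alpha> 0 = 0"
  by (intro poly_eqI) (simp add: coeff_KW)

lemma FW_uminus: "FW \<alpha> G \<Longrightarrow> FW \<alpha> (- G)"
  using FW_diff[OF FW_0] by simp

lemma KW_uminus: "FW \<alpha> G \<Longrightarrow> KW \<alpha> (- G) = - KW \<alpha> G"
  using KW_diff[OF FW_0] by simp

lemma FW_add: "FW \<alpha> G \<Longrightarrow> FW \<alpha> H \<Longrightarrow> FW \<alpha> (G + H)"
  using FW_diff[of \<alpha> G "- H"] FW_uminus by simp

lemma KW_add: "FW \<alpha> G \<Longrightarrow> FW \<alpha> H \<Longrightarrow> KW \<alpha> (G + H) = KW \<alpha> G + KW \<alpha> H"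
  using KW_diff[of \<alpha> G "- H"] FW_uminus KW_uminus by simp

lemma FW_KW_sum:
  "(\<And>i. i \<in> A \<Longrightarrow> FW \<alpha> (f i)) \<Longrightarrow> FW \<alpha> (sum f A) \<and> KW \<alpha> (sum f A) = (\<Sum>i\<in>A. KW \<alpha> (f i))"
  by (induction A rule: infinite_finite_induct) (auto simp: FW_0 FW_add KW_add)

lemma FW_mono: "\<alpha> \<le> \<beta> \<Longrightarrow> FW \<beta> G \<Longrightarrow> FW \<alpha> G"
  unfolding FW_def
proof
  fix j assume *: "\<alpha> \<le> \<beta>" "\<forall>j. Fil (cl \<beta> j) (dig j G)"
  have "\<alpha> \<le> int q * cl \<beta> j + int j * u" using cl_bound[of \<beta> j] *(1) by linarith
  then show "Fil (cl \<alpha> j) (dig j G)" using * by (intro Fil_clI[OF degree_dig]) auto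
qed

text \<open>Digit by digit: if q divides \<alpha> - j u, the ceiling moves up by one and
  \<open>Fil_succ\<close> tests the coefficient; otherwise the ceiling stays and the coefficient is
  0 by definition.\<close>

lemma FW_succ: "FW (\<alpha> + 1) G \<longleftrightarrow> FW \<alpha> G \<and> KW \<alpha> G = 0"
proof -
  have "Fil (cl (\<alpha> + 1) j) (dig j G) \<longleftrightarrow> Fil (cl \<alpha> j) (dig j G) \<and> kw \<alpha> j (dig j G) = 0" for j
    using Fil_succ[OF degree_dig, of "cl \<alpha> j" j G] lam by (auto simp: cl_succ kw_def)
  then show ?thesis unfolding FW_def poly_eq_iff coeff_KW by auto
qed

lemma FW_nonpos: "\<alpha> \<le> 0 \<Longrightarrow> FW \<alpha> G"
  unfolding FW_def
proof
  fix j assume "\<alpha> \<le> 0"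
  moreover have "0 \<le> int j * u" using u_pos by simp
  ultimately have "cl \<alpha> j \<le> 0" unfolding cl_le_iff by simp
  then show "Fil (cl \<alpha> j) (dig j G)" by (rule Fil_nonpos[OF degree_dig])
qed

lemma FW_single: "degree c < degree \<psi> \<Longrightarrow> FW \<alpha> (c * \<psi> ^ i) \<longleftrightarrow> Fil (cl \<alpha> i) c"
  by (auto simp: FW_def dig_monomial Fil_0 split: if_splits)

lemma KW_single: "degree c < degree \<psi> \<Longrightarrow> KW \<alpha> (c * \<psi> ^ i) = monom (kw \<alpha> i c) i"
  by (intro poly_eqI) (auto simp: coeff_KW dig_monomial)

text \<open>The product of two digits is s \<psi> + r. In s a value v is lost, hence q v in the new
  scale, but its term has a further factor \<psi> of value u = q v + m. It therefore lies at least m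
  above \<alpha> + \<beta>, and only r contributes to the initial form.\<close>

lemma FW_KW_mult_single:
  assumes "degree f < degree \<psi>" "degree h < degree \<psi>" "Fil (cl \<alpha> j) f" "Fil (cl \<beta> i) h"
  shows "FW (\<alpha> + \<beta>) ((f * \<psi> ^ j) * (h * \<psi> ^ i)) \<and>
    KW (\<alpha> + \<beta>) ((f * \<psi> ^ j) * (h * \<psi> ^ i)) = KW \<alpha> (f * \<psi> ^ j) * KW \<beta> (h * \<psi> ^ i)"
proof -
  define s where "s = quo (f * h)"
  define r where "r = rem (f * h)"
  have fh: "f * h = s * \<psi> + r" unfolding s_def r_def by (rule quo_rem)
  have ds: "degree s < degree \<psi>"
    using degree_mult_le[of f h] assms(1,2) degree_quo[of "f * h"] unfolding s_def by linarith
  have dr: "degree r < degree \<psi>" unfolding r_def by (rule degree_rem)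
  define A where "A = cl \<alpha> j"
  define B where "B = cl \<beta> i"
  have A: "\<alpha> \<le> int q * A + int j * u" and B: "\<beta> \<le> int q * B + int i * u"
    unfolding A_def B_def by (rule cl_bound)+
  from Fil_mult[OF assms(1,2) fh dr assms(3,4)]
  have s: "Fil (A + B - v) s" and r: "Fil (A + B) r" "\<kappa> (A + B) r = \<kappa> A f * \<kappa> B h"
    unfolding A_def B_def by auto
  have split: "(f * \<psi> ^ j) * (h * \<psi> ^ i) = r * \<psi> ^ (j + i) + s * \<psi> ^ (j + i + 1)"
  proof -
    have "(f * \<psi> ^ j) * (h * \<psi> ^ i) = (f * h) * \<psi> ^ (j + i)" by (simp add: power_add ac_simps)
    also have "\<dots> = r * \<psi> ^ (j + i) + s * \<psi> ^ (j + i + 1)"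
      unfolding fh by (simp add: power_add algebra_simps)
    finally show ?thesis .
  qed
  have "\<alpha> + \<beta> + 1 \<le> int q * (A + B - v) + int (j + i + 1) * u"
    using A B m_pos by (simp add: algebra_simps u_def)
  then have "FW (\<alpha> + \<beta> + 1) (s * \<psi> ^ (j + i + 1))"
    by (simp only: FW_single[OF ds]) (rule Fil_clI[OF ds s])
  then have s': "FW (\<alpha> + \<beta>) (s * \<psi> ^ (j + i + 1))" "KW (\<alpha> + \<beta>) (s * \<psi> ^ (j + i + 1)) = 0"
    by (simp_all only: FW_succ)
  have AB: "\<alpha> + \<beta> \<le> int q * (A + B) + int (j + i) * u" using A B by (simp add: algebra_simps)
  then have r': "FW (\<alpha> + \<beta>) (r * \<psi> ^ (j + i))"
    by (simp only: FW_single[OF dr]) (rule Fil_clI[OF dr r(1)])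
  \<comment> \<open>Unless both degrees are met exactly, one of the two ceilings was rounded up;
    then r lies strictly above \<alpha> + \<beta> and both sides vanish.\<close>
  have "kw (\<alpha> + \<beta>) (j + i) r = kw \<alpha> j f * kw \<beta> i h"
  proof (cases "int q dvd \<alpha> - int j * u \<and> int q dvd \<beta> - int i * u")
    case True
    then have "\<alpha> + \<beta> = int q * (A + B) + int (j + i) * u"
      using cl_dvd[of \<alpha> j] cl_dvd[of \<beta> i] by (simp add: A_def B_def algebra_simps)
    moreover from this have "cl (\<alpha> + \<beta>) (j + i) = A + B" by (rule cl_exact)
    ultimately show ?thesis using True r(2)
      by (simp add: kw_def A_def B_def power_add flip: A_def B_def)
  next
    case False
    have "\<alpha> + \<beta> < int q * (A + B) + int (j + i) * u"
    proof -
      have "\<alpha> \<noteq> int q * A + int j * u \<or> \<beta> \<noteq> int q * B + int i * u" using False by auto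
      then show ?thesis using A B by (auto simp: algebra_simps)
    qed
    then have "int q dvd \<alpha> + \<beta> - int (j + i) * u \<Longrightarrow> cl (\<alpha> + \<beta>) (j + i) < A + B"
      using cl_dvd[of "\<alpha> + \<beta>" "j + i"] q_pos by (metis add_less_cancel_right mult_less_cancel_left_pos of_nat_0_less_iff)
    then have "kw (\<alpha> + \<beta>) (j + i) r = 0" using \<kappa>_eq_0[OF dr _ r(1)] by (simp add: kw_def)
    moreover have "kw \<alpha> j f * kw \<beta> i h = 0" using False by (auto simp: kw_def)
    ultimately show ?thesis by simp
  qed
  then show ?thesis
    unfolding split using s' r' assms dr by (simp add: FW_add KW_add KW_single mult_monom)
qed

lemma FW_KW_mult:
  assumes "FW \<alpha> G" "FW \<beta> H"
  shows "FW (\<alpha> + \<beta>) (G * H) \<and> KW (\<alpha> + \<beta>) (G * H) = KW \<alpha> G * KW \<beta> H"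
proof -
  define J where "J = Suc (degree G + degree H)"
  define g where "g j = dig j G * \<psi> ^ j" for j
  define h where "h j = dig j H * \<psi> ^ j" for j
  have J: "degree G < J * degree \<psi>" "degree H < J * degree \<psi>" using degree_pos
    unfolding J_def by (metis Suc_leI less_Suc_eq_le less_le_trans le_add1 le_add2 mult.right_neutral mult_le_mono2 One_nat_def)+
  have G: "G = (\<Sum>j<J. g j)" and H: "H = (\<Sum>i<J. h i)"
    unfolding g_def h_def using J dig_expansion by auto
  have gh: "FW (\<alpha> + \<beta>) (g j * h i) \<and> KW (\<alpha> + \<beta>) (g j * h i) = KW \<alpha> (g j) * KW \<beta> (h i)" for i j
    unfolding g_def h_def using assms by (intro FW_KW_mult_single degree_dig) (auto simp: FW_def)
  have GH: "G * H = (\<Sum>j<J. \<Sum>i<J. g j * h i)" by (subst G, subst H) (rule sum_product)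
  have in1: "FW (\<alpha> + \<beta>) (\<Sum>i<J. g j * h i) \<and>
     KW (\<alpha> + \<beta>) (\<Sum>i<J. g j * h i) = (\<Sum>i<J. KW \<alpha> (g j) * KW \<beta> (h i))" for j
    using FW_KW_sum[of "{..<J}" "\<alpha> + \<beta>" "\<lambda>i. g j * h i"] gh by simp
  have in2: "FW (\<alpha> + \<beta>) (G * H) \<and>
     KW (\<alpha> + \<beta>) (G * H) = (\<Sum>j<J. \<Sum>i<J. KW \<alpha> (g j) * KW \<beta> (h i))"
    unfolding GH using FW_KW_sum[of "{..<J}" "\<alpha> + \<beta>" "\<lambda>j. \<Sum>i<J. g j * h i"] in1 by simp
  have "KW \<alpha> G = (\<Sum>j<J. KW \<alpha> (g j))"
    by (subst G) (rule FW_KW_sum[THEN conjunct2], use assms FW_single[OF degree_dig] in \<open>simp add: g_def FW_def\<close>)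
  moreover have "KW \<beta> H = (\<Sum>j<J. KW \<beta> (h j))"
    by (subst H) (rule FW_KW_sum[THEN conjunct2], use assms FW_single[OF degree_dig] in \<open>simp add: h_def FW_def\<close>)
  ultimately show ?thesis using in2 by (simp add: sum_product)
qed

lemmas FW_mult = FW_KW_mult[THEN conjunct1]
lemmas KW_mult = FW_KW_mult[THEN conjunct2]

lemma FW_one: "FW 0 1"
  by (simp add: FW_nonpos)

lemma KW_one: "KW 0 1 = 1"
  using KW_single[of 1 0 0] degree_pos cl_exact[of 0 0 0] by (simp add: kw_def \<kappa>_one)

lemma FW_KW_power: "FW \<alpha> G \<Longrightarrow> FW (int n * \<alpha>) (G ^ n) \<and> KW (int n * \<alpha>) (G ^ n) = KW \<alpha> G ^ n"
proof (induction n)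
  case (Suc n)
  then show ?case using FW_KW_mult[of \<alpha> G "int n * \<alpha>" "G ^ n"] by (simp add: algebra_simps)
qed (simp add: FW_one KW_one)

lemma FW_smult: "FW \<alpha> G \<Longrightarrow> FW \<alpha> (smult c G)"
  using FW_mult[of 0 "[:c:]" \<alpha> G] FW_nonpos[of 0 "[:c:]"] by simp

lemma KW_PS: "FW \<alpha> G \<Longrightarrow> KW \<alpha> G \<in> PS"
  unfolding polys_over_def mem_Collect_eq coeff_KW kw_def FW_def
  using degree_dig by (auto intro!: mult_mem power_mem lam \<kappa>_mem zero_mem)

lemma coeff_KW_dvd: "coeff (KW \<alpha> G) j \<noteq> 0 \<Longrightarrow> int q dvd \<alpha> - int j * u"
  by (auto simp: coeff_KW kw_def split: if_splits)

lemma coeff_KW_eq_0: "degree G < J * degree \<psi> \<Longrightarrow> j \<ge> J \<Longrightarrow> coeff (KW \<alpha> G) j = 0"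
  using dig_eq_0[of G j] by (simp add: coeff_KW less_le_trans mult_le_mono1)

lemma degree_KW_less: "degree G < J * degree \<psi> \<Longrightarrow> J > 0 \<Longrightarrow> degree (KW \<alpha> G) < J"
  using coeff_KW_eq_0[of G J _ \<alpha>] by (metis degree_0 leading_coeff_0_iff not_le)

lemma KW_monic:
  assumes "lead_coeff G = 1" "degree G = n * degree \<psi>"
  shows "coeff (KW (int n * u) G) n = lam ^ n" "degree (KW (int n * u) G) = n"
proof -
  show c: "coeff (KW (int n * u) G) n = lam ^ n"
    using dig_top_monic[OF assms] cl_exact[of "int n * u" 0 n] by (simp add: coeff_KW kw_def \<kappa>_one)
  have "degree (KW (int n * u) G) < Suc n"
    using assms(2) degree_pos by (intro degree_KW_less) auto
  moreover have "degree (KW (int n * u) G) \<ge> n" using c lam by (intro le_degree) simp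
  ultimately show "degree (KW (int n * u) G) = n" by simp
qed

lemma not_FW_monic:
  assumes "lead_coeff G = 1" "degree G = n * degree \<psi>" "FW \<alpha> G"
  shows "\<alpha> \<le> int n * u"
proof (rule ccontr)
  assume "\<not> ?thesis"
  then have "FW (int n * u + 1) G" using assms(3) by (intro FW_mono[OF _ assms(3)]) simp
  then show False using KW_monic(1)[OF assms(1,2)] lam by (simp add: FW_succ)
qed

text \<open>Digits are lifted one by one. \<open>\<kappa>_surj\<close> realizes coefficients in
  degrees at least v, which is the origin of the bound \<open>int q * v\<close> on the exponents
  that occur.\<close>

lemma KW_lift:
  assumes e: "e \<in> PS" "\<And>j. coeff e j \<noteq> 0 \<Longrightarrow> int q dvd \<alpha> - int j * u"
    "\<And>j. coeff e j \<noteq> 0 \<Longrightarrow> int q * v \<le> \<alpha> - int j * u" "degree e < J"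
  shows "\<exists>G. degree G < J * degree \<psi> \<and> FW \<alpha> G \<and> KW \<alpha> G = e"
proof -
  have "\<exists>c. degree c < degree \<psi> \<and> Fil (cl \<alpha> j) c \<and> kw \<alpha> j c = coeff e j" for j
  proof (cases "coeff e j = 0")
    case True
    then show ?thesis using degree_pos by (intro exI[of _ 0]) (simp add: Fil_0)
  next
    case False
    have "int q * v \<le> int q * cl \<alpha> j" using e(3)[OF False] cl_dvd[OF e(2)[OF False]] by linarith
    then have "v \<le> cl \<alpha> j" using q_pos by simp
    moreover have "coeff e j / lam ^ j \<in> S" by (intro divide_mem PS_coeff e power_mem lam)
    ultimately obtain c where "degree c < degree \<psi>" "Fil (cl \<alpha> j) c" "\<kappa> (cl \<alpha> j) c = coeff e j / lam ^ j"
      using \<kappa>_surj by blast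
    then show ?thesis using e(2)[OF False] lam by (intro exI[of _ c]) (simp add: kw_def)
  qed
  then obtain c where c: "\<And>j. degree (c j) < degree \<psi>" "\<And>j. Fil (cl \<alpha> j) (c j)" "\<And>j. kw \<alpha> j (c j) = coeff e j"
    by metis
  define G where "G = (\<Sum>j<J. c j * \<psi> ^ j)"
  have dG: "dig j G = (if j < J then c j else 0)" for j
    unfolding G_def using c(1) by (rule dig_of_sum)
  have "degree G < J * degree \<psi>" unfolding G_def using c(1) e(4) by (intro degree_digit_sum) auto
  moreover have "FW \<alpha> G" by (auto simp: FW_def dG c(2) Fil_0)
  moreover have "KW \<alpha> G = e"
    using e(4) by (intro poly_eqI) (auto simp: coeff_KW dG c(3) coeff_eq_0)
  ultimately show ?thesis by blast
qed

text \<open>In bounded degree, high value forces divisibility by powers of x. This turns convergence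
  in the filtration into x-adic convergence.\<close>

lemma FW_dvd: "\<exists>\<beta>. \<forall>G. degree G < J * degree \<psi> \<longrightarrow> FW \<beta> G \<longrightarrow> [:fps_X ^ M:] dvd G"
proof -
  obtain \<beta>0 where \<beta>0: "\<And>f. degree f < degree \<psi> \<Longrightarrow> Fil \<beta>0 f \<Longrightarrow> [:fps_X ^ M:] dvd f"
    using Fil_dvd by blast
  \<comment> \<open>Large enough for the ceiling at every j < J to be at least \<beta>0.\<close>
  define \<beta> where "\<beta> = int q * \<beta>0 + int J * u"
  have "[:fps_X ^ M:] dvd G" if G: "degree G < J * degree \<psi>" "FW \<beta> G" for G
  proof -
    have "[:fps_X ^ M:] dvd dig j G" if "j < J" for j
    proof -
      have "int j * u \<le> int J * u" using that u_pos by (intro mult_right_mono) auto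
      then have "\<not> cl \<beta> j \<le> \<beta>0 - 1"
        using q_pos unfolding cl_le_iff \<beta>_def by (simp add: algebra_simps)
      then have "\<beta>0 \<le> cl \<beta> j" by simp
      then have "Fil \<beta>0 (dig j G)" using G(2) Fil_mono[OF degree_dig] unfolding FW_def by blast
      then show ?thesis using \<beta>0[OF degree_dig] by blast
    qed
    then show ?thesis by (subst dig_expansion[OF G(1)]) (intro dvd_sum dvd_mult2, simp)
  qed
  then show ?thesis by blast
qed

text \<open>Division by a monic \<Phi> that attains the maximal value M u loses no value. The whole
  leading \<psi>-adic digit of G is removed in one step, since the filtration controls digits and
  not single leading coefficients.\<close>

lemma FW_division:
  assumes \<Phi>: "lead_coeff \<Phi> = 1" "degree \<Phi> = M * degree \<psi>" "M > 0" "FW (int M * u) \<Phi>"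
    and G: "G = s * \<Phi> + r" "degree r < degree \<Phi>" "FW \<alpha> G"
  shows "FW (\<alpha> - int M * u) s \<and> FW \<alpha> r"
  using G
proof (induction "degree G" arbitrary: G s r rule: less_induct)
  case (less G)
  interpret P: monic_poly \<Phi> using \<Phi> degree_pos by unfold_locales auto
  show ?case
  proof (cases "degree G < degree \<Phi>")
    case True
    then have "s = 0" "r = G" using P.quo_eqI[OF less.prems(1,2)] P.quo_small P.rem_small by auto
    then show ?thesis using less.prems FW_0 by auto
  next
    case False
    define J where "J = degree G div degree \<psi>"
    define c where "c = dig J G"
    have J: "degree G < Suc J * degree \<psi>" "J * degree \<psi> \<le> degree G"
      unfolding J_def mult_Suc using degree_pos dividend_less_div_times[of "degree \<psi>" "degree G"]
      by simp_all
    have "M * degree \<psi> < Suc J * degree \<psi>" using J(1) False \<Phi>(2) by linarith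
    then have MJ: "M \<le> J" by (metis less_Suc_eq_le mult_less_cancel2)
    then have "J > 0" using \<Phi>(3) by simp
    define K where "K = c * \<psi> ^ (J - M)"
    have dc: "degree c < degree \<psi>" unfolding c_def by (rule degree_dig)
    have "Fil (cl (\<alpha> - int M * u) (J - M)) c"
      using less.prems(3) MJ by (simp add: cl_shift FW_def c_def)
    then have FK: "FW (\<alpha> - int M * u) K" unfolding K_def using FW_single[OF dc] by blast
    define G' where "G' = G - K * \<Phi>"
    have "FW \<alpha> (K * \<Phi>)" using FW_mult[OF FK \<Phi>(4)] by simp
    then have FG': "FW \<alpha> G'" unfolding G'_def using less.prems(3) by (intro FW_diff)
    \<comment> \<open>\<Phi> and \<open>\<psi> ^ M\<close> differ in lower degree, so K \<Phi>
      reproduces the leading digit term of G up to lower degree.\<close>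
    have "degree G' < degree G"
    proof -
      have 1: "degree (G - c * \<psi> ^ J) < J * degree \<psi>"
        unfolding c_def by (rule degree_minus_top_digit[OF J(1) \<open>J > 0\<close>])
      have cn: "c \<noteq> 0"
      proof
        assume "c = 0" then show False using 1 J(2) by simp
      qed
      have "lead_coeff (\<psi> ^ M) = 1" "degree (\<psi> ^ M) = degree \<Phi>" using \<Phi>(2) lead_coeff_power_g[of M] by auto
      have "degree (\<Phi> - \<psi> ^ M) < M * degree \<psi>"
        by (rule degree_diff_power_less[OF \<Phi>(1,2,3)])
      have e: "K * (\<Phi> - \<psi> ^ M) = K * \<Phi> - c * \<psi> ^ J"
        using MJ by (simp add: K_def algebra_simps flip: power_add)
      have Kn: "K \<noteq> 0" using cn g_nonzero by (simp add: K_def)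
      have dK: "degree K = degree c + (J - M) * degree \<psi>"
        unfolding K_def using cn g_nonzero by (subst degree_mult_eq) auto
      have "degree (K * (\<Phi> - \<psi> ^ M)) < degree c + J * degree \<psi>"
      proof -
        have "degree (K * (\<Phi> - \<psi> ^ M)) \<le> degree K + degree (\<Phi> - \<psi> ^ M)" by (rule degree_mult_le)
        also have "\<dots> < degree c + (J - M) * degree \<psi> + M * degree \<psi>"
          using dK \<open>degree (\<Phi> - \<psi> ^ M) < M * degree \<psi>\<close> by simp
        also have "\<dots> = degree c + J * degree \<psi>" using MJ by (simp flip: add_mult_distrib)
        finally show ?thesis .
      qed
      moreover have dG: "degree G = degree c + J * degree \<psi>"
      proof -
        have "degree (c * \<psi> ^ J) = degree c + J * degree \<psi>" using cn g_nonzero by (subst degree_mult_eq) auto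
        moreover have "G = c * \<psi> ^ J + (G - c * \<psi> ^ J)" by simp
        ultimately show ?thesis using 1 by (metis degree_add_eq_left le_add2 order_less_le_trans)
      qed
      moreover have "G' = (G - c * \<psi> ^ J) - K * (\<Phi> - \<psi> ^ M)"
        by (simp add: G'_def e)
      ultimately show ?thesis using 1 by (metis degree_diff_less le_add2 order_less_le_trans)
    qed
    moreover have "G' = (s - K) * \<Phi> + r" by (simp add: G'_def less.prems(1) algebra_simps)
    ultimately have "FW (\<alpha> - int M * u) (s - K) \<and> FW \<alpha> r"
      using less.hyps less.prems(2) FG' by blast
    then show ?thesis using FW_add[OF _ FK, of "s - K"] by auto
  qed
qed

end

section \<open>Polynomials in Y^q and the residue field defined by P\<close>

lemma coeff_pcompose_monom:
  fixes p :: "'b::comm_semiring_1 poly"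
  assumes "q > 0"
  shows "coeff (pcompose p (monom 1 q)) j = (if q dvd j then coeff p (j div q) else 0)"
proof (induction p arbitrary: j)
  case (pCons a p)
  show ?case
  proof (cases "j < q")
    case True
    then show ?thesis using assms
      by (auto simp: pcompose_pCons coeff_monom_mult coeff_pCons dvd_imp_le split: nat.split)
  next
    case False
    then obtain i where i: "j = i + q" by (metis le_add_diff_inverse2 not_less)
    have "j \<noteq> 0" using False assms by simp
    then show ?thesis using assms
      by (auto simp: pcompose_pCons coeff_monom_mult coeff_pCons pCons.IH i split: nat.split)
  qed
qed simp

context subfield_of
begin

text \<open>Inverses come from a Bezout relation with P, evaluated at z; representatives of degree
  below deg P come from division by P.\<close>

lemma quotient_field_facts:
  assumes P: "irreducible_over S P" and Q: "is_quotient_field S P z S'"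
  shows "is_subfield S'" "S \<subseteq> S'" "z \<in> S'" "poly P z = 0"
    and "\<And>A. A \<in> PS \<Longrightarrow> poly A z = 0 \<Longrightarrow> P dvd A"
    and "\<And>c. c \<in> S' \<Longrightarrow> \<exists>A\<in>PS. degree A < degree P \<and> poly A z = c"
    and "\<And>A. A \<in> PS \<Longrightarrow> poly A z \<in> S'"
proof -
  have P': "P \<in> PS" "degree P > 0" "P \<noteq> 0" using P by (auto simp: irreducible_over_def)
  have S': "S' = (\<lambda>A. poly A z) ` PS" using Q by (simp add: is_quotient_field_def)
  have ker: "poly A z = 0 \<longleftrightarrow> (\<exists>Q\<in>PS. A = P * Q)" if "A \<in> PS" for A
    using Q that by (simp add: is_quotient_field_def)
  show Pz: "poly P z = 0" using ker[OF P'(1)] PS_1 by (metis mult.right_neutral)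
  show dvd: "P dvd A" if "A \<in> PS" "poly A z = 0" for A using ker[OF that(1)] that by auto
  show mem: "poly A z \<in> S'" if "A \<in> PS" for A using that S' by blast
  show "S \<subseteq> S'"
  proof
    fix c assume "c \<in> S"
    then show "c \<in> S'" using mem[OF PS_const] by simp
  qed
  have "[:0, 1:] \<in> PS" using PS_monom[OF one_mem, of 1] by (simp add: monom_altdef)
  from mem[OF this] show "z \<in> S'" by simp
  show "\<exists>A\<in>PS. degree A < degree P \<and> poly A z = c" if c: "c \<in> S'" for c
  proof -
    obtain A where A: "A \<in> PS" "c = poly A z" using c S' by blast
    have "poly (A mod P) z = poly A z"
      using Pz by (metis (no_types) add_0 div_mult_mod_eq mult_zero_right poly_add poly_mult)
    moreover have "degree (A mod P) < degree P"
      using P' degree_mod_less'[of P A] by (cases "A mod P = 0") auto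
    ultimately show ?thesis using PS_mod[OF A(1) P'(1)] A(2) by (intro bexI[of _ "A mod P"]) auto
  qed
  show "is_subfield S'"
    unfolding is_subfield_def
  proof (intro conjI ballI)
    show "1 \<in> S'" using mem[OF PS_1] by simp
    fix a b assume "a \<in> S'" "b \<in> S'"
    then obtain A B where AB: "A \<in> PS" "a = poly A z" "B \<in> PS" "b = poly B z" using S' by blast
    show "a - b \<in> S'" using mem[OF PS_diff[OF AB(1,3)]] AB by simp
    show "a * b \<in> S'" using mem[OF PS_mult[OF AB(1,3)]] AB by simp
    show "inverse a \<in> S'"
    proof (cases "a = 0")
      case True
      then show ?thesis using mem[OF PS_0] by simp
    next
      case False
      then have "\<not> P dvd A" using AB Pz by (auto simp: dvd_def)
      then obtain x y where xy: "x \<in> PS" "x * A + y * P = 1" using irreducible_bezout[OF P AB(1)] by blast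
      have "poly x z * a = 1"
        using arg_cong[OF xy(2), of "\<lambda>p. poly p z"] AB Pz by simp
      then have "inverse a = poly x z" using False by (simp add: field_simps)
      then show ?thesis using mem[OF xy(1)] by simp
    qed
  qed
qed

text \<open>A polynomial over S that vanishes at z without being a multiple of P would satisfy a
  Bezout relation with P, impossible at the common root. So every root of P in the ambient field can
  represent the class of Z.\<close>

lemma quotient_field_exists:
  assumes P: "irreducible_over S P" and z: "poly P z = 0"
  shows "is_quotient_field S P z ((\<lambda>A. poly A z) ` PS)"
  unfolding is_quotient_field_def
proof (intro conjI ballI iffI refl)
  fix A assume A: "A \<in> PS" "poly A z = 0"
  have "P dvd A"
  proof (rule ccontr)
    assume "\<not> P dvd A"
    then obtain x y where "x * A + y * P = 1" using irreducible_bezout[OF P A(1)] by blast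
    from arg_cong[OF this, of "\<lambda>p. poly p z"] show False using A z by simp
  qed
  then show "\<exists>Q\<in>PS. A = P * Q" using PS_dvdE[of P A] A P by (metis irreducible_over_def)
qed (use z in auto)

lemma residue_class_poly:
  assumes "f \<in> PS" "\<And>j. coeff f j \<noteq> 0 \<Longrightarrow> j mod q = b" "b < q"
  shows "\<exists>g\<in>PS. f = monom 1 b * pcompose g (monom 1 q) \<and> (\<forall>l. l > 0 \<longrightarrow> degree f < q * l \<longrightarrow> degree g < l)"
proof -
  define g where "g = (\<Sum>i\<le>degree f. monom (coeff f (b + q * i)) i)"
  have cg: "coeff g i = coeff f (b + q * i)" for i
  proof -
    have "degree f < i \<Longrightarrow> coeff f (b + q * i) = 0"
      using assms(3) by (intro coeff_eq_0) (metis Suc_leI gr_implies_not0 less_le_trans mult.left_neutral mult_le_mono1 not_gr_zero trans_le_add2 One_nat_def)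
    then show ?thesis by (auto simp: g_def coeff_sum not_le)
  qed
  have "g \<in> PS" unfolding g_def using assms(1) by (intro PS_sum PS_monom PS_coeff)
  moreover have "f = monom 1 b * pcompose g (monom 1 q)"
  proof (rule poly_eqI)
    fix j
    have "coeff (monom 1 b * pcompose g (monom 1 q)) j =
        (if b \<le> j \<and> q dvd j - b then coeff f (b + q * ((j - b) div q)) else 0)"
      using assms(3) by (simp add: coeff_monom_mult coeff_pcompose_monom cg not_le)
    also have "\<dots> = coeff f j"
    proof (cases "coeff f j = 0")
      case False
      have "b \<le> j" "q dvd j - b"
        using assms(2)[OF False] mod_less_eq_dividend[of j q] by (auto simp: dvd_minus_mod)
      then show ?thesis by simp
    qed auto
    finally show "coeff f j = coeff (monom 1 b * pcompose g (monom 1 q)) j" by simp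
  qed
  moreover have "degree g < l" if l: "l > 0" "degree f < q * l" for l
  proof (cases "g = 0")
    case False
    then have "coeff f (b + q * degree g) \<noteq> 0" by (metis cg leading_coeff_0_iff)
    then have "b + q * degree g < q * l" using le_degree l by fastforce
    then have "q * degree g < q * l" by linarith
    then show ?thesis by simp
  qed (use l in simp)
  ultimately show ?thesis by blast
qed

end

section \<open>Reduction modulo P(Y^q) and the next key polynomial\<close>

locale key_direction = key_slope \<psi> S v Fil \<kappa> q m lam
  for \<psi> :: "'a::field fps poly" and S :: "'e::field set" and v Fil \<kappa> q m lam +
  fixes s t :: int
  assumes st: "int q * s - int m * t = 1"
begin

text \<open>Modulo q, u is m and m t is -1, so multiplication by t gives j the coefficient 1. All
  exponents of Y in degree \<alpha> thus lie in one residue class, that of -t \<alpha>.\<close>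

lemma graded_iff: "int q dvd \<alpha> - int j * u \<longleftrightarrow> int q dvd t * \<alpha> + int j"
proof
  assume "int q dvd \<alpha> - int j * u"
  then have "int q dvd t * (\<alpha> - int j * u)" by simp
  moreover have "t * \<alpha> + int j = t * (\<alpha> - int j * u) + int q * (int j * s + int j * t * v)"
    using arg_cong[OF st, of "\<lambda>x. int j * x"] by (simp add: u_def algebra_simps)
  ultimately show "int q dvd t * \<alpha> + int j" by simp
next
  assume "int q dvd t * \<alpha> + int j"
  then have "int q dvd - int m * (t * \<alpha> + int j)" by simp
  moreover have "\<alpha> - int j * u = - int m * (t * \<alpha> + int j) + int q * (s * \<alpha> - int j * v)"
    using arg_cong[OF st, of "\<lambda>x. \<alpha> * x"] by (simp add: u_def algebra_simps)
  ultimately show "int q dvd \<alpha> - int j * u" by simp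
qed

definition res :: "int \<Rightarrow> nat" where "res \<alpha> = nat ((- t * \<alpha>) mod int q)"

lemma res_less: "res \<alpha> < q"
  using q_pos by (simp add: res_def nat_less_iff)

lemma res_iff: "int q dvd t * \<alpha> + int j \<longleftrightarrow> j mod q = res \<alpha>"
proof -
  have "int q dvd t * \<alpha> + int j \<longleftrightarrow> int q dvd int j - (- t * \<alpha>)" by (simp add: add.commute)
  also have "\<dots> \<longleftrightarrow> int j mod int q = (- t * \<alpha>) mod int q" by (simp add: mod_eq_dvd_iff)
  also have "\<dots> \<longleftrightarrow> int (j mod q) = int (res \<alpha>)" using q_pos by (simp add: res_def zmod_int)
  finally show ?thesis by simp
qed

end

locale key_step = key_direction \<psi> S v Fil \<kappa> q m lam s t
  for \<psi> :: "'a::field fps poly" and S :: "'e::field set" and v Fil \<kappa> q m lam s t +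
  fixes \<psi>' :: "'a fps poly" and P :: "'e poly" and z \<zeta> :: 'e and S' :: "'e set"
  assumes P: "irreducible_over S P" "lead_coeff P = 1"
    and \<psi>': "lead_coeff \<psi>' = 1" "degree \<psi>' = q * degree P * degree \<psi>"
      "FW (int (q * degree P) * u) \<psi>'"
      "KW (int (q * degree P) * u) \<psi>' = smult (lam ^ (q * degree P)) (pcompose P (monom 1 q))"
    and quotient: "is_quotient_field S P z S'"
    and \<zeta>: "\<zeta> ^ q = z" "z \<noteq> 0"
begin

text \<open>Evaluation at Y = \<zeta> kills P(Y^q), but its values may fall outside S'. A monomial
  Y^j in degree \<alpha> has q dividing t \<alpha> + j, so the twist by \<zeta>^(t \<alpha>) leaves
  a power of z. The exponent of the twist is additive in \<alpha>, which keeps the map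
  multiplicative.\<close>

definition \<kappa>' :: "int \<Rightarrow> 'a fps poly \<Rightarrow> 'e" where
  "\<kappa>' \<alpha> G = \<zeta> powi (t * \<alpha>) * poly (KW \<alpha> G) \<zeta>"

lemma \<zeta>_nz: "\<zeta> \<noteq> 0"
  using \<zeta> q_pos by auto

lemma \<zeta>_res: "\<exists>n. \<zeta> powi (t * \<alpha>) * \<zeta> ^ res \<alpha> = z powi n"
proof -
  have "int q dvd t * \<alpha> + int (res \<alpha>)" using res_iff[of \<alpha> "res \<alpha>"] res_less[of \<alpha>] by simp
  then obtain n where "t * \<alpha> + int (res \<alpha>) = int q * n" by (auto simp: dvd_def)
  then have "\<zeta> powi (t * \<alpha>) * \<zeta> ^ res \<alpha> = \<zeta> powi (int q * n)"
    using \<zeta>_nz by (metis power_int_add power_int_of_nat)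
  also have "\<dots> = z powi n" by (simp add: power_int_mult \<zeta>)
  finally show ?thesis by blast
qed

lemma KW_residue:
  assumes "FW \<alpha> G"
  shows "\<exists>g\<in>PS. KW \<alpha> G = monom 1 (res \<alpha>) * pcompose g (monom 1 q) \<and>
    (degree G < degree \<psi>' \<longrightarrow> degree g < degree P)"
proof -
  have "j mod q = res \<alpha>" if "coeff (KW \<alpha> G) j \<noteq> 0" for j
    using coeff_KW_dvd[OF that] graded_iff res_iff by blast
  from residue_class_poly[OF KW_PS[OF assms] this res_less] obtain g where
    g: "g \<in> PS" "KW \<alpha> G = monom 1 (res \<alpha>) * pcompose g (monom 1 q)"
      "\<And>l. l > 0 \<Longrightarrow> degree (KW \<alpha> G) < q * l \<Longrightarrow> degree g < l" by blast
  have "degree P > 0" using P by (simp add: irreducible_over_def)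
  have "degree g < degree P" if "degree G < degree \<psi>'"
    using that \<psi>'(2) q_pos \<open>degree P > 0\<close> by (intro g(3) degree_KW_less) auto
  then show ?thesis using g by blast
qed

lemma \<kappa>'_residue:
  assumes "KW \<alpha> G = monom 1 (res \<alpha>) * pcompose g (monom 1 q)"
  shows "\<exists>n. \<kappa>' \<alpha> G = z powi n * poly g z"
proof -
  have "poly (KW \<alpha> G) \<zeta> = \<zeta> ^ res \<alpha> * poly g z" unfolding assms by (simp add: poly_monom poly_pcompose \<zeta>)
  then show ?thesis using \<zeta>_res[of \<alpha>] by (metis \<kappa>'_def mult.assoc)
qed

lemmas quot = quotient_field_facts[OF P(1) quotient]

text \<open>Below degree deg \<psi>' an initial form is Y^b g(Y^q) with deg g < deg P. As P
  generates the polynomials over S that vanish at z, evaluation is injective there and reaches all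
  of S'. Products are reduced modulo \<psi>', whose initial form vanishes at \<zeta>.\<close>

theorem next_level: "key_level \<psi>' S' (int (q * degree P) * u) FW \<kappa>'"
proof -
  have dP: "degree P > 0" using P by (simp add: irreducible_over_def)
  interpret S': subfield_of S' using quot(1) by unfold_locales
  have pos: "degree \<psi>' > 0" using \<psi>'(2) degree_pos dP q_pos by simp
  interpret M: monic_poly \<psi>' using \<psi>'(1) pos by unfold_locales
  have Qpos: "q * degree P > 0" using q_pos dP by simp
  show ?thesis
  proof unfold_locales
    show "0 \<le> int (q * degree P) * u" using u_pos by simp
    show "FW \<alpha> 0" for \<alpha> by (rule FW_0)
    fix f h :: "'a fps poly" and \<alpha> :: int
    assume f: "degree f < degree \<psi>'"
    show "FW (\<alpha> + 1) f \<longleftrightarrow> FW \<alpha> f \<and> \<kappa>' \<alpha> f = 0"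
    proof (cases "FW \<alpha> f")
      case True
      obtain g where g: "g \<in> PS" "KW \<alpha> f = monom 1 (res \<alpha>) * pcompose g (monom 1 q)" "degree g < degree P"
        using KW_residue[OF True] f by blast
      obtain n where n: "\<kappa>' \<alpha> f = z powi n * poly g z" using \<kappa>'_residue[OF g(2)] by blast
      have "\<kappa>' \<alpha> f = 0 \<longleftrightarrow> g = 0"
      proof
        assume "\<kappa>' \<alpha> f = 0"
        then have "poly g z = 0" using n \<zeta> by (auto simp: power_int_eq_0_iff)
        then have "P dvd g" using quot(5) g(1) by blast
        then show "g = 0" using g(3) dvd_imp_degree_le by (metis not_le)
      qed (simp add: n)
      moreover have "KW \<alpha> f = 0 \<longleftrightarrow> g = 0"
      proof
        assume "KW \<alpha> f = 0"
        then have "pcompose g (monom 1 q) = 0" using g(2) by simp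
        then show "g = 0" using pcompose_eq_0[of g "monom 1 q"] q_pos by (simp add: Polynomial.degree_monom_eq)
      qed (simp add: g(2))
      ultimately show ?thesis by (simp add: FW_succ)
    qed (simp add: FW_succ)
    show "FW \<alpha> f" if "\<alpha> \<le> 0" by (rule FW_nonpos[OF that])
    show "\<kappa>' \<alpha> f \<in> S'" if F: "FW \<alpha> f"
    proof -
      obtain g where g: "g \<in> PS" "KW \<alpha> f = monom 1 (res \<alpha>) * pcompose g (monom 1 q)"
        using KW_residue[OF F] by blast
      then show ?thesis using \<kappa>'_residue[OF g(2)] quot(3,7) S'.mult_mem S'.powi_mem by fastforce
    qed
    assume h: "degree h < degree \<psi>'"
    show "FW \<alpha> (f - h)" if "FW \<alpha> f" "FW \<alpha> h" using that by (rule FW_diff)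
    show "\<kappa>' \<alpha> (f - h) = \<kappa>' \<alpha> f - \<kappa>' \<alpha> h" if "FW \<alpha> f" "FW \<alpha> h"
      using that by (simp add: \<kappa>'_def KW_diff algebra_simps)
    fix a r :: "'a fps poly" and \<beta>
    assume fh: "f * h = a * \<psi>' + r" and r: "degree r < degree \<psi>'" and F: "FW \<alpha> f" "FW \<beta> h"
    let ?Qu = "int (q * degree P) * u"
    have FW: "FW (\<alpha> + \<beta>) (f * h)" "KW (\<alpha> + \<beta>) (f * h) = KW \<alpha> f * KW \<beta> h"
      using FW_KW_mult[OF F] by auto
    have ar: "FW (\<alpha> + \<beta> - ?Qu) a" "FW (\<alpha> + \<beta>) r"
      using FW_division[OF \<psi>'(1,2) Qpos \<psi>'(3) fh r FW(1)] by auto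
    have ap: "FW (\<alpha> + \<beta>) (a * \<psi>')" "KW (\<alpha> + \<beta>) (a * \<psi>') = KW (\<alpha> + \<beta> - ?Qu) a * KW ?Qu \<psi>'"
      using FW_KW_mult[OF ar(1) \<psi>'(3)] by (auto simp: algebra_simps)
    have "poly (KW ?Qu \<psi>') \<zeta> = 0"
      unfolding \<psi>'(4) by (simp add: poly_pcompose poly_monom \<zeta> quot(4))
    then have "poly (KW (\<alpha> + \<beta>) (f * h)) \<zeta> = poly (KW (\<alpha> + \<beta>) r) \<zeta>"
      using KW_add[OF ap(1) ar(2)] ap(2) fh by simp
    then have "\<kappa>' (\<alpha> + \<beta>) r = \<kappa>' \<alpha> f * \<kappa>' \<beta> h"
      using FW(2) \<zeta>_nz by (simp add: \<kappa>'_def distrib_left power_int_add)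
    then show "FW (\<alpha> + \<beta> - ?Qu) a \<and> FW (\<alpha> + \<beta>) r \<and> \<kappa>' (\<alpha> + \<beta>) r = \<kappa>' \<alpha> f * \<kappa>' \<beta> h"
      using ar by blast
  next
    show "\<kappa>' 0 1 = 1" by (simp add: \<kappa>'_def KW_one)
    show "\<exists>\<beta>. \<forall>f. degree f < degree \<psi>' \<longrightarrow> FW \<beta> f \<longrightarrow> [:fps_X ^ M:] dvd f" for M
      using FW_dvd[of "q * degree P" M] \<psi>'(2) by simp
    fix \<alpha> c assume \<alpha>: "int (q * degree P) * u \<le> \<alpha>" and c: "c \<in> S'"
    \<comment> \<open>The twisted power of \<zeta> belonging to degree \<alpha> is z^n; the
      polynomial g is chosen to take the value c z^(-n) at z to compensate it.\<close>
    obtain n where n: "\<zeta> powi (t * \<alpha>) * \<zeta> ^ res \<alpha> = z powi n" using \<zeta>_res by blast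
    have "c * z powi (- n) \<in> S'" using quot(3) by (intro S'.mult_mem S'.powi_mem c)
    then obtain g where g: "g \<in> PS" "degree g < degree P" "poly g z = c * z powi (- n)"
      using quot(6) by blast
    define e where "e = monom 1 (res \<alpha>) * pcompose g (monom 1 q)"
    have co: "coeff e j = (if res \<alpha> \<le> j \<and> q dvd j - res \<alpha> then coeff g ((j - res \<alpha>) div q) else 0)" for j
      using q_pos by (simp add: e_def coeff_monom_mult coeff_pcompose_monom not_le)
    have eP: "e \<in> PS" using g(1) by (auto simp: polys_over_def co zero_mem)
    have ce: "j mod q = res \<alpha> \<and> j < q * degree P" if "coeff e j \<noteq> 0" for j
    proof -
      define i where "i = (j - res \<alpha>) div q"
      have "coeff g i \<noteq> 0" "j = res \<alpha> + q * i" using that by (auto simp: co i_def split: if_splits)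
      then have i: "i \<le> degree g" "j = res \<alpha> + q * i" by (auto simp: le_degree)
      have "j < q * Suc i" using i res_less[of \<alpha>] by simp
      also have "\<dots> \<le> q * degree P" using i g(2) by (intro mult_left_mono) auto
      finally show ?thesis using i res_less[of \<alpha>] by simp
    qed
    have "\<exists>G. degree G < (q * degree P) * degree \<psi> \<and> FW \<alpha> G \<and> KW \<alpha> G = e"
    proof (rule KW_lift[OF eP])
      show "int q dvd \<alpha> - int j * u" if "coeff e j \<noteq> 0" for j
        using ce[OF that] res_iff graded_iff by blast
      \<comment> \<open>j is below q deg P and \<alpha> is at least q deg P times u, so at least one
        u = q v + m remains.\<close>
      show "int q * v \<le> \<alpha> - int j * u" if "coeff e j \<noteq> 0" for j
      proof -
        have "int (Suc j) \<le> int (q * degree P)" using ce[OF that] by (subst of_nat_le_iff) simp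
        then have "int (Suc j) * u \<le> int (q * degree P) * u" using u_pos by (intro mult_right_mono) auto
        then have "int j * u + u \<le> \<alpha>" using \<alpha> by (simp add: algebra_simps)
        then show ?thesis by (simp add: u_def)
      qed
      show "degree e < q * degree P"
        using ce Qpos by (metis degree_0 leading_coeff_0_iff)
    qed
    then obtain G where G: "degree G < degree \<psi>'" "FW \<alpha> G" "KW \<alpha> G = e" using \<psi>'(2) by auto
    have "\<kappa>' \<alpha> G = (\<zeta> powi (t * \<alpha>) * \<zeta> ^ res \<alpha>) * poly g z"
      unfolding \<kappa>'_def G(3) e_def by (simp add: poly_monom poly_pcompose \<zeta>)
    also have "\<dots> = c" using \<zeta> by (simp add: n g(3) power_int_minus)
    finally show "\<exists>f. degree f < degree \<psi>' \<and> FW \<alpha> f \<and> \<kappa>' \<alpha> f = c" using G by blast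
  qed
qed

end

section \<open>Approximate roots and factors along a degenerate edge\<close>

lemma pcompose_hom_power: "pcompose (p ^ n) r = pcompose p r ^ n"
  by (induction n) (simp_all add: pcompose_mult pcompose_1)

lemma pcompose_monom_inj:
  fixes p r :: "'b::comm_semiring_1 poly"
  assumes "q > 0" "pcompose p (monom 1 q) = pcompose r (monom 1 q)"
  shows "p = r"
proof (rule poly_eqI)
  fix i
  from arg_cong[OF assms(2), of "\<lambda>f. coeff f (q * i)"] show "coeff p i = coeff r i"
    using assms(1) by (simp add: coeff_pcompose_monom)
qed

text \<open>Equivalently, the points of the Newton polygon of G left of the last one have positive
  ordinate. This makes the slope of the next edge strict, as \<open>m_pos\<close> demands.\<close>

definition (in key_level) near :: "nat \<Rightarrow> 'a fps poly \<Rightarrow> bool" where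
  "near n G \<longleftrightarrow> lead_coeff G = 1 \<and> degree G = n * degree \<psi> \<and> (\<forall>j<n. Fil (int (n - j) * v + 1) (dig j G))"

lemma (in key_slope) FW_maximal:
  assumes "lead_coeff G = 1" "degree G = n * degree \<psi>"
  obtains \<alpha> where "FW \<alpha> G" "\<not> FW (\<alpha> + 1) G" "\<alpha> \<le> int n * u"
proof -
  have "\<not> FW (int (nat (int n * u) + 1)) G"
    using not_FW_monic[OF assms, of "int (nat (int n * u) + 1)"] u_pos by auto
  then obtain k where k: "\<not> FW (int k) G" "\<And>j. j < k \<Longrightarrow> FW (int j) G"
    using ex_least_nat_le[of "\<lambda>k. \<not> FW (int k) G"] by (metis (no_types))
  have "k \<noteq> 0" using k(1) FW_nonpos[of 0 G] by (metis of_nat_0 order_refl)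
  then have "FW (int k - 1) G" using k(2)[of "k - 1"] by (simp add: of_nat_diff)
  with k(1) show ?thesis using that[of "int k - 1"] not_FW_monic[OF assms] by simp
qed

lemma (in key_slope) FW_power_psi: "FW (int n * u) (\<psi> ^ n)"
  using FW_single[of 1 "int n * u" n] degree_pos cl_exact[of "int n * u" 0 n] Fil_nonpos[of 1 0] by simp

lemma (in key_slope) FW_digits:
  assumes \<Phi>: "lead_coeff \<Phi> = 1" "degree \<Phi> = M * degree \<psi>" "M > 0" "FW (int M * u) \<Phi>" and "FW \<alpha> G"
  shows "FW (\<alpha> - int j * (int M * u)) (monic_poly.dig \<Phi> j G)"
proof -
  interpret M: monic_poly \<Phi> using \<Phi> degree_pos by unfold_locales auto
  note div = FW_division[OF \<Phi> M.quo_rem M.degree_rem]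
  show ?thesis using assms(5)
  proof (induction j arbitrary: G \<alpha>)
    case 0
    then show ?case using div by (simp add: M.dig_0)
  next
    case (Suc j)
    then have "FW (\<alpha> - int M * u - int j * (int M * u)) (M.dig j (M.quo G))" using div by blast
    then show ?case by (simp add: M.dig_Suc algebra_simps)
  qed
qed

text \<open>A monic polynomial of degree n deg \<psi> has value at most n u, and values add because
  nonzero initial forms have a nonzero product. If the product attains the bound, so does each
  factor.\<close>

lemma (in key_slope) FW_factors:
  assumes G: "lead_coeff G = 1" "degree G = n * degree \<psi>"
    and H: "lead_coeff H = 1" "degree H = n' * degree \<psi>" and F: "FW (int (n + n') * u) (G * H)"
  shows "FW (int n * u) G \<and> FW (int n' * u) H"
proof -
  obtain \<alpha> where \<alpha>: "FW \<alpha> G" "\<not> FW (\<alpha> + 1) G" "\<alpha> \<le> int n * u" by (rule FW_maximal[OF G])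
  obtain \<beta> where \<beta>: "FW \<beta> H" "\<not> FW (\<beta> + 1) H" "\<beta> \<le> int n' * u" by (rule FW_maximal[OF H])
  have "KW \<alpha> G * KW \<beta> H \<noteq> 0" using \<alpha> \<beta> by (simp add: FW_succ)
  then have "\<not> FW (\<alpha> + \<beta> + 1) (G * H)" using FW_KW_mult[OF \<alpha>(1) \<beta>(1)] by (simp add: FW_succ)
  then have "\<not> \<alpha> + \<beta> + 1 \<le> int (n + n') * u" using F FW_mono by blast
  then have "\<alpha> = int n * u" "\<beta> = int n' * u" using \<alpha>(3) \<beta>(3) by (simp_all add: algebra_simps)
  then show ?thesis using \<alpha> \<beta> by simp
qed

text \<open>A degenerated edge in terms of initial forms: that of F is the N'-th power of P(Y^q), up
  to the power of \<open>lam\<close> due to the scale of Y.\<close>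

locale key_edge = key_direction \<psi> S v Fil \<kappa> q m lam s t
  for \<psi> :: "'a::field fps poly" and S :: "'e::field set" and v Fil \<kappa> q m lam s t +
  fixes F :: "'a fps poly" and P :: "'e poly" and N' :: nat
  assumes P: "irreducible_over S P" "lead_coeff P = 1" "poly P 0 \<noteq> 0"
    and F: "lead_coeff F = 1" "degree F = q * degree P * N' * degree \<psi>"
      "FW (int (q * degree P * N') * u) F"
      "KW (int (q * degree P * N') * u) F = smult (lam ^ (q * degree P * N')) (pcompose P (monom 1 q) ^ N')"
    and N': "of_nat N' \<noteq> (0::'a)" "of_nat N' \<noteq> (0::'e)"
begin

abbreviation Q :: nat where "Q \<equiv> q * degree P"

lemma N'_pos: "N' > 0"
  using N'(1) by (cases N') auto

lemma Q_pos: "Q > 0"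
  using q_pos P(1) by (simp add: irreducible_over_def)

lemma degree_P_q: "degree (pcompose P (monom 1 q)) = Q" "lead_coeff (pcompose P (monom 1 q)) = 1"
proof -
  show *: "degree (pcompose P (monom 1 q)) = Q"
    by (simp add: degree_pcompose Polynomial.degree_monom_eq mult.commute)
  show "lead_coeff (pcompose P (monom 1 q)) = 1"
    unfolding * using q_pos P(2) by (simp add: coeff_pcompose_monom)
qed

text \<open>The Tschirnhaus iteration starts at \<psi>^Q. If \<phi> has value at least Q u, then F -
  \<phi>^N' has value at least N' Q u and its digit of index N' - 1 still has value Q u, so the
  correction keeps the bound. Uniqueness identifies the outcome with \<psi>'.\<close>

lemma approx_root_FW:
  assumes "is_approx_root N' F \<psi>'"
  shows "FW (int Q * u) \<psi>'"
proof (cases "N' = 1")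
  case True
  \<comment> \<open>For N' = 1 the degree of the error would have to be below 0, which leaves only
    equality.\<close>
  then have "F = \<psi>'" using assms by (auto simp: is_approx_root_def)
  then show ?thesis using F(3) True by simp
next
  case False
  define c where "c = fps_const (inverse (of_nat N') :: 'a)"
  have dF: "degree F = N' * (Q * degree \<psi>)" using F(2) by simp
  have unit: "of_nat N' * c = 1"
    using N'(1) by (simp add: c_def fps_of_nat[symmetric] fps_const_mult)
  have "\<exists>\<phi>. FW (int Q * u) \<phi> \<and> is_approx_root N' F \<phi>"
  proof (rule approx_root_exists[OF F(1) dF _ _ unit, of "\<psi> ^ Q"])
    show "N' > 1" using False N'_pos by simp
    show "Q * degree \<psi> > 0" using Q_pos degree_pos by simp
    show "lead_coeff (\<psi> ^ Q) = 1" "degree (\<psi> ^ Q) = Q * degree \<psi>" by (rule lead_coeff_power_g degree_power_g)+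
    show "FW (int Q * u) (\<psi> ^ Q)" by (rule FW_power_psi)
    fix \<phi> a assume \<phi>: "FW (int Q * u) \<phi>" "lead_coeff \<phi> = 1" "degree \<phi> = Q * degree \<psi>"
      and a: "a = smult c (monic_poly.dig \<phi> (N' - 1) (F - \<phi> ^ N'))"
    have "FW (int N' * (int Q * u)) (F - \<phi> ^ N')"
      using F(3) FW_KW_power[OF \<phi>(1), of N'] by (intro FW_diff) (simp_all add: algebra_simps)
    from FW_digits[OF \<phi>(2,3) Q_pos \<phi>(1) this, of "N' - 1"]
    have "FW (int Q * u) (monic_poly.dig \<phi> (N' - 1) (F - \<phi> ^ N'))"
      using N'_pos by (simp add: of_nat_diff algebra_simps)
    then show "FW (int Q * u) (\<phi> + a)" unfolding a by (intro FW_add \<phi> FW_smult)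
  qed
  then obtain \<phi> where "FW (int Q * u) \<phi>" "is_approx_root N' F \<phi>" by blast
  moreover have "of_nat N' \<noteq> (0 :: 'a fps)" using unit by auto
  ultimately show ?thesis using approx_root_unique[OF assms] by blast
qed

lemma approx_root_degree': "is_approx_root N' F \<psi>' \<Longrightarrow> degree \<psi>' = Q * degree \<psi>"
  using F(2) N'_pos by (simp add: is_approx_root_def)

lemma approx_root_lead: "is_approx_root N' F \<psi>' \<Longrightarrow> lead_coeff \<psi>' = 1"
  unfolding is_approx_root_def by blast

text \<open>The error F - \<psi>'^N' has degree below (N' - 1) deg \<psi>', so its initial form has
  degree below (N' - 1) Q. Hence the monic multiple A of the initial form of \<psi>' and B = P(Y^q)
  are both approximate roots of B^N', and they agree.\<close>

lemma approx_root_KW: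
  assumes "is_approx_root N' F \<psi>'"
  shows "KW (int Q * u) \<psi>' = smult (lam ^ Q) (pcompose P (monom 1 q))"
proof -
  note \<psi>' = approx_root_FW[OF assms] approx_root_degree'[OF assms] approx_root_lead[OF assms]
  define A where "A = smult (inverse (lam ^ Q)) (KW (int Q * u) \<psi>')"
  define B where "B = pcompose P (monom 1 q)"
  have K: "degree (KW (int Q * u) \<psi>') = Q" "coeff (KW (int Q * u) \<psi>') Q = lam ^ Q"
    using KW_monic[OF \<psi>'(3,2)] by auto
  have A: "lead_coeff A = 1" "degree A = Q" using K lam by (auto simp: A_def)
  have B: "lead_coeff B = 1" "degree B = Q" using degree_P_q by (auto simp: B_def)
  have KA: "KW (int Q * u) \<psi>' = smult (lam ^ Q) A" using lam by (simp add: A_def)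
  have pow: "FW (int (Q * N') * u) (\<psi>' ^ N')" "KW (int (Q * N') * u) (\<psi>' ^ N') = KW (int Q * u) \<psi>' ^ N'"
    using FW_KW_power[OF \<psi>'(1), of N'] by (simp_all add: algebra_simps)
  have KWd: "KW (int (Q * N') * u) (F - \<psi>' ^ N') = smult (lam ^ (Q * N')) (B ^ N' - A ^ N')"
    using KW_diff[OF F(3) pow(1)]
    unfolding pow(2) F(4) KA by (simp add: B_def smult_diff_right smult_power power_mult)
  have "B ^ N' = A ^ N' \<or> degree (B ^ N' - A ^ N') < (N' - 1) * Q"
  proof (cases "F = \<psi>' ^ N'")
    case True
    then show ?thesis using KWd lam by simp
  next
    case False
    have "degree F - degree F div N' = ((N' - 1) * Q) * degree \<psi>"
      using F(2) N'_pos diff_div_eq[OF N'_pos, of "Q * degree \<psi>"] by (simp add: ac_simps)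
    then have lt: "degree (F - \<psi>' ^ N') < ((N' - 1) * Q) * degree \<psi>"
      using assms False by (auto simp: is_approx_root_def)
    then have "(N' - 1) * Q > 0" by (metis mult_is_0 not_gr_zero not_less_zero)
    then have "degree (KW (int (Q * N') * u) (F - \<psi>' ^ N')) < (N' - 1) * Q"
      by (rule degree_KW_less[OF lt])
    then show ?thesis unfolding KWd using lam by simp
  qed
  then have "B = A" by (intro power_near_unique[OF B _ A _ N'(2), of "B ^ N'"]) auto
  then show ?thesis using KA by (simp only: B_def)
qed

text \<open>The initial forms of F and \<psi>'^N' coincide, so their difference has value at least
  one more; passing to digit j costs j Q u. This is the condition \<open>near\<close> of the next
  level.\<close>

lemma near_next:
  assumes "is_approx_root N' F \<psi>'" "j < N'"
  shows "FW (int (N' - j) * (int Q * u) + 1) (monic_poly.dig \<psi>' j F)"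
proof -
  note \<psi>' = approx_root_FW[OF assms(1)] approx_root_degree'[OF assms(1)] approx_root_lead[OF assms(1)]
  interpret M: monic_poly \<psi>' using \<psi>' Q_pos degree_pos by unfold_locales auto
  have pow: "FW (int (Q * N') * u) (\<psi>' ^ N')" "KW (int (Q * N') * u) (\<psi>' ^ N') = KW (int Q * u) \<psi>' ^ N'"
    using FW_KW_power[OF \<psi>'(1), of N'] by (simp_all add: algebra_simps)
  have "KW (int (Q * N') * u) (F - \<psi>' ^ N') = 0"
    using KW_diff[OF F(3) pow(1)]
    unfolding pow(2) F(4) approx_root_KW[OF assms(1)] by (simp add: smult_power power_mult)
  then have "FW (int (Q * N') * u + 1) (F - \<psi>' ^ N')"
    using FW_diff[OF F(3) pow(1)] by (simp add: FW_succ)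
  from FW_digits[OF \<psi>'(3,2) Q_pos \<psi>'(1) this, of j]
  have "FW (int (Q * N') * u + 1 - int j * (int Q * u)) (M.dig j (F - \<psi>' ^ N'))" .
  moreover have "M.dig j (F - \<psi>' ^ N') = M.dig j F"
    using M.dig_monomial[of 1 j N'] M.degree_pos assms(2) by (simp add: M.dig_diff)
  ultimately show ?thesis using assms(2) by (simp add: of_nat_diff algebra_simps)
qed

text \<open>The initial forms A and B of G and H multiply to a unit times P(Y^q)^N', which is
  nonzero at Y = 0. Both are then polynomials in Y^q, A is a unit times a power P(Y^q)^k, and its
  degree gives n = k Q.\<close>

lemma factor_degree:
  assumes G: "lead_coeff G = 1" "degree G = n * degree \<psi>"
    and H: "lead_coeff H = 1" "degree H = n' * degree \<psi>" and "F = G * H"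
  shows "Q * degree \<psi> dvd degree G"
proof -
  have nz: "G \<noteq> 0" "H \<noteq> 0" using G H by auto
  have "(n + n') * degree \<psi> = Q * N' * degree \<psi>"
    using F(2) G(2) H(2) nz assms(5) by (simp add: degree_mult_eq add_mult_distrib)
  then have nn: "n + n' = Q * N'" using degree_pos by simp
  then have FWs: "FW (int n * u) G" "FW (int n' * u) H"
    using FW_factors[OF G H] F(3) assms(5) by auto
  define A where "A = KW (int n * u) G"
  define B where "B = KW (int n' * u) H"
  have AB: "A * B = smult (lam ^ (Q * N')) (pcompose (P ^ N') (monom 1 q))"
  proof -
    have "A * B = KW (int (Q * N') * u) F"
      using KW_mult[OF FWs] nn by (simp add: A_def B_def assms(5) flip: distrib_right of_nat_add)
    then show ?thesis using F(4) by (simp add: pcompose_hom_power)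
  qed
  have cls: "coeff A j \<noteq> 0 \<Longrightarrow> j mod q = res (int n * u)" "coeff B j \<noteq> 0 \<Longrightarrow> j mod q = res (int n' * u)" for j
    unfolding A_def B_def using coeff_KW_dvd graded_iff res_iff by blast+
  have "poly (A * B) 0 \<noteq> 0" unfolding AB using P(3) lam q_pos by (simp add: poly_pcompose poly_monom power_0_left)
  then have "coeff A 0 \<noteq> 0" "coeff B 0 \<noteq> 0" by (auto simp: poly_0_coeff_0 coeff_mult_0)
  \<comment> \<open>Exponent 0 occurs in A and in B, so the common residue class of their exponents
    is 0.\<close>
  then have cls0: "coeff A j \<noteq> 0 \<Longrightarrow> j mod q = 0" "coeff B j \<noteq> 0 \<Longrightarrow> j mod q = 0" for j
    using cls(1)[of 0] cls(1)[of j] cls(2)[of 0] cls(2)[of j] by auto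
  have APS: "A \<in> PS" "B \<in> PS" unfolding A_def B_def by (rule KW_PS FWs)+
  obtain a b where ab: "a \<in> PS" "A = pcompose a (monom 1 q)" "B = pcompose b (monom 1 q)"
    using residue_class_poly[OF APS(1) cls0(1) q_pos] residue_class_poly[OF APS(2) cls0(2) q_pos] by auto
  have "pcompose (a * b) (monom 1 q) = pcompose (smult (lam ^ (Q * N')) (P ^ N')) (monom 1 q)"
    using AB ab by (simp add: pcompose_mult pcompose_smult)
  then have eq: "a * b = smult (lam ^ (Q * N')) (P ^ N')"
    using pcompose_monom_inj[OF q_pos] by blast
  have dA: "degree A = n" "lead_coeff A = lam ^ n" using KW_monic[OF G] by (auto simp: A_def)
  have da: "n = q * degree a" using dA(1) ab(2) by (simp add: degree_pcompose Polynomial.degree_monom_eq mult.commute)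
  have la: "lead_coeff a = lam ^ n"
    using dA ab(2) q_pos da by (simp add: coeff_pcompose_monom)
  define a' where "a' = smult (inverse (lam ^ n)) a"
  have a': "a' \<in> PS" "lead_coeff a' = 1" "degree a' = degree a"
    unfolding a'_def using ab(1) la lam by (auto intro!: PS_smult inverse_mem power_mem)
  have "a' * smult (lam ^ n * inverse (lam ^ (Q * N'))) b = smult (inverse (lam ^ (Q * N'))) (a * b)"
  proof -
    have "lam ^ n * inverse (lam ^ (Q * N')) * inverse (lam ^ n) = inverse (lam ^ (Q * N'))"
      using lam by (simp add: field_simps)
    then show ?thesis unfolding a'_def mult_smult_left mult_smult_right smult_smult by (simp only:)
  qed
  also have "\<dots> = P ^ N'" using eq lam by simp
  finally obtain k where "a' = P ^ k" using monic_factor_of_power[OF P(1,2) a'(1,2)] by blast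
  moreover have "P \<noteq> 0" using P(2) by auto
  ultimately have "degree a = k * degree P" using a'(3) by (simp add: degree_power_eq)
  then show ?thesis using G(2) da by simp
qed

end

section \<open>Hensel lifting along an edge\<close>

lemma fps_X_power_dvd_iff: "fps_X ^ M dvd (f :: 'a::field fps) \<longleftrightarrow> (\<forall>n<M. fps_nth f n = 0)"
proof
  assume "fps_X ^ M dvd f"
  then obtain g where "f = fps_X ^ M * g" by (auto simp: dvd_def)
  then show "\<forall>n<M. fps_nth f n = 0" by (simp add: fps_X_power_mult_nth)
next
  assume *: "\<forall>n<M. fps_nth f n = 0"
  have "f = fps_X ^ M * fps_shift M f"
    using * by (intro fps_ext) (simp add: fps_X_power_mult_nth)
  then show "fps_X ^ M dvd f" by (metis dvd_triv_left)
qed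

lemma X_power_dvd_poly_iff:
  "[:fps_X ^ M:] dvd (p :: 'a::field fps poly) \<longleftrightarrow> (\<forall>j. \<forall>n<M. fps_nth (coeff p j) n = 0)"
  by (simp add: const_poly_dvd_iff fps_X_power_dvd_iff)

lemma eq_0_if_X_power_dvd: "(\<And>M. [:fps_X ^ M:] dvd (p :: 'a::field fps poly)) \<Longrightarrow> p = 0"
  unfolding X_power_dvd_poly_iff by (intro poly_eqI fps_ext) (metis coeff_0 fps_zero_nth lessI)

lemma degree_monic_diff:
  fixes f g :: "'b::idom poly"
  assumes "lead_coeff f = 1" "lead_coeff g = 1" "degree f = degree g" "degree f > 0"
  shows "degree (f - g) < degree f"
proof (rule ccontr)
  assume neg: "\<not> ?thesis"
  then have "degree (f - g) = degree f" using degree_diff_le_max[of f g] assms by simp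
  then have "lead_coeff (f - g) = 0" using assms by simp
  then have "f - g = 0" by (rule leading_coeff_0_iff[THEN iffD1])
  then show False using neg assms by simp
qed

lemma lead_coeff_add_small:
  fixes f g :: "'b::idom poly"
  assumes "degree g < degree f"
  shows "lead_coeff (f + g) = lead_coeff f" "degree (f + g) = degree f"
  using assms by (simp_all add: degree_add_eq_left coeff_eq_0)

text \<open>Each coefficient at a power of x is eventually constant. A fixed degree and leading
  coefficient 1 are inherited by the limit.\<close>

lemma monic_limit_exists:
  fixes G :: "nat \<Rightarrow> 'a::field fps poly"
  assumes G: "\<And>i. lead_coeff (G i) = 1" "\<And>i. degree (G i) = J"
    and conv: "\<And>M. \<exists>k. \<forall>i\<ge>k. [:fps_X ^ M:] dvd G (Suc i) - G i"
  shows "\<exists>L. lead_coeff L = 1 \<and> degree L = J \<and> (\<forall>M. \<exists>k. \<forall>i\<ge>k. [:fps_X ^ M:] dvd L - G i)"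
proof -
  obtain k where k: "\<And>M i. i \<ge> k M \<Longrightarrow> [:fps_X ^ M:] dvd G (Suc i) - G i"
    using conv by metis
  have stable: "[:fps_X ^ M:] dvd G i - G (k M)" if "i \<ge> k M" for M i
    using that
  proof (induction i rule: dec_induct)
    case (step i)
    have "G (Suc i) - G (k M) = (G (Suc i) - G i) + (G i - G (k M))" by simp
    then show ?case using k[OF step.hyps(1)] step.IH by (metis dvd_add)
  qed simp
  \<comment> \<open>\<open>Suc n\<close> because stability modulo x^(n+1) is what fixes the
    coefficient at x^n.\<close>
  define c where "c j = Abs_fps (\<lambda>n. fps_nth (coeff (G (k (Suc n))) j) n)" for j
  define L where "L = (\<Sum>j\<le>J. monom (c j) j)"
  have cL: "coeff L j = (if j \<le> J then c j else 0)" for j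
    by (simp add: L_def coeff_sum)
  have "c J = 1"
  proof -
    have "coeff (G i) J = 1" for i using G[of i] by simp
    then show ?thesis by (auto simp: c_def fps_eq_iff)
  qed
  then have "degree L \<le> J" "coeff L J = 1" by (auto simp: cL intro: degree_le)
  then have dL: "degree L = J" by (metis le_antisym le_degree zero_neq_one)
  have "\<exists>k'. \<forall>i\<ge>k'. [:fps_X ^ M:] dvd L - G i" for M
  proof -
    \<comment> \<open>The sum serves as a common upper bound of all \<open>k n\<close> with n \<le>
      M.\<close>
    define K where "K = (\<Sum>n\<le>M. k n)"
    have "[:fps_X ^ M:] dvd L - G i" if i: "i \<ge> K" for i
      unfolding X_power_dvd_poly_iff
    proof (intro allI impI)
      fix j n assume n: "n < M"
      have "k (Suc n) \<le> K" unfolding K_def using n by (intro member_le_sum) auto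
      then have "[:fps_X ^ Suc n:] dvd G i - G (k (Suc n))" using i by (intro stable) simp
      then have "fps_nth (coeff (G i) j) n = fps_nth (coeff (G (k (Suc n))) j) n"
        unfolding X_power_dvd_poly_iff by (metis coeff_diff eq_iff_diff_eq_0 fps_sub_nth lessI)
      moreover have "coeff (G i) j = 0" if "j > J" using G(2)[of i] that by (simp add: coeff_eq_0)
      ultimately show "fps_nth (coeff (L - G i) j) n = 0" by (auto simp: cL c_def)
    qed
    then show ?thesis by blast
  qed
  then show ?thesis using dL \<open>coeff L J = 1\<close> by blast
qed

section \<open>Homogeneous components and the lifting of coprime factors\<close>

context key_slope
begin

text \<open>The component of p in degree \<alpha>. Bezout cofactors of homogeneous polynomials are
  not homogeneous in general; this projection makes them so.\<close>

definition graded_part :: "int \<Rightarrow> 'e poly \<Rightarrow> 'e poly" where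
  "graded_part \<alpha> p = (\<Sum>j\<le>degree p. monom (if int q dvd \<alpha> - int j * u then coeff p j else 0) j)"

lemma coeff_graded_part: "coeff (graded_part \<alpha> p) j = (if int q dvd \<alpha> - int j * u then coeff p j else 0)"
  by (auto simp: graded_part_def coeff_sum coeff_eq_0 not_le)

lemma graded_part_mult:
  assumes "\<And>j. coeff f j \<noteq> 0 \<Longrightarrow> int q dvd \<beta> - int j * u"
  shows "graded_part (\<alpha> + \<beta>) (p * f) = graded_part \<alpha> p * f"
proof (rule poly_eqI)
  fix k
  have "(if int q dvd \<alpha> + \<beta> - int k * u then coeff p i * coeff f (k - i) else 0) =
      coeff (graded_part \<alpha> p) i * coeff f (k - i)" if "i \<le> k" for i
  proof (cases "coeff f (k - i) = 0")
    case False
    have "\<alpha> + \<beta> - int k * u = (\<alpha> - int i * u) + (\<beta> - int (k - i) * u)"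
      using that by (simp add: of_nat_diff algebra_simps)
    then have "int q dvd \<alpha> + \<beta> - int k * u \<longleftrightarrow> int q dvd \<alpha> - int i * u"
      using assms[OF False] by (metis dvd_add_left_iff)
    then show ?thesis by (simp add: coeff_graded_part)
  qed simp
  then show "coeff (graded_part (\<alpha> + \<beta>) (p * f)) k = coeff (graded_part \<alpha> p * f) k"
    by (auto simp: coeff_graded_part coeff_mult intro!: sum.cong sum.neutral)
qed

lemma degree_graded_part: "degree (graded_part \<alpha> p) \<le> degree p"
  by (rule degree_le) (simp add: coeff_graded_part coeff_eq_0)

lemma graded_part_PS: "p \<in> PS \<Longrightarrow> graded_part \<alpha> p \<in> PS"
  by (simp add: polys_over_def coeff_graded_part zero_mem)

lemma graded_part_eq: "(\<And>j. coeff p j \<noteq> 0 \<Longrightarrow> int q dvd \<alpha> - int j * u) \<Longrightarrow> graded_part \<alpha> p = p"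
  by (rule poly_eqI) (auto simp: coeff_graded_part)

lemma graded_part_add: "graded_part \<alpha> (p + r) = graded_part \<alpha> p + graded_part \<alpha> r"
  by (rule poly_eqI) (simp add: coeff_graded_part)

text \<open>The leading term is realized by \<psi>^n itself, as the exponent n leaves no value for
  \<open>KW_lift\<close>. Each lower exponent leaves at least one u, which exceeds q v.\<close>

lemma KW_lift_monic:
  assumes f: "f \<in> PS" "coeff f n = lam ^ n" "degree f = n" "n > 0"
    "\<And>j. coeff f j \<noteq> 0 \<Longrightarrow> int q dvd int n * u - int j * u"
  shows "\<exists>G. lead_coeff G = 1 \<and> degree G = n * degree \<psi> \<and> FW (int n * u) G \<and> KW (int n * u) G = f"
proof -
  define e where "e = f - monom (lam ^ n) n"
  have ce: "coeff e j = (if j = n then 0 else coeff f j)" for j using f(2) by (simp add: e_def)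
  have lt: "j < n" if "coeff e j \<noteq> 0" for j
    using that f(3) le_degree[of f j] by (auto simp: ce order.strict_iff_order split: if_splits)
  have "e \<in> PS" unfolding e_def using f lam by (intro PS_diff PS_monom power_mem)
  moreover have "int q * v \<le> int n * u - int j * u" if "coeff e j \<noteq> 0" for j
  proof -
    have "int (Suc j) * u \<le> int n * u" using lt[OF that] u_pos by (intro mult_right_mono) auto
    then show ?thesis by (simp add: u_def algebra_simps)
  qed
  moreover have "degree e < n" using lt f(4) by (metis degree_0 leading_coeff_0_iff)
  ultimately obtain E where E: "degree E < n * degree \<psi>" "FW (int n * u) E" "KW (int n * u) E = e"
    using KW_lift[of e "int n * u" n] f(5) ce by (metis (no_types, lifting))
  have "KW (int n * u) (1 * \<psi> ^ n) = monom (lam ^ n) n"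
    using degree_pos cl_exact[of "int n * u" 0 n] by (subst KW_single) (auto simp: kw_def \<kappa>_one)
  then have "KW (int n * u) (\<psi> ^ n + E) = f" using KW_add[OF FW_power_psi E(2)] E(3) by (simp add: e_def)
  moreover have "FW (int n * u) (\<psi> ^ n + E)" by (rule FW_add[OF FW_power_psi E(2)])
  moreover have "lead_coeff (\<psi> ^ n + E) = 1" "degree (\<psi> ^ n + E) = n * degree \<psi>"
    using lead_coeff_add_small[of E "\<psi> ^ n"] E(1) lead_coeff_power_g[of n] by simp_all
  ultimately show ?thesis by blast
qed

text \<open>Reducing a modulo f1 bounds its degree, and b f1 = e - a f2 then bounds deg b.
  Projecting a and b to the appropriate degrees preserves the identity, since e, f1 and f2 are
  homogeneous.\<close>

lemma graded_bezout:
  assumes f: "f1 \<in> PS" "f2 \<in> PS" "degree f1 = n1" "degree f2 = n2" "n1 > 0" "n2 > 0"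
    and graded: "\<And>j. coeff f1 j \<noteq> 0 \<Longrightarrow> int q dvd int n1 * u - int j * u"
      "\<And>j. coeff f2 j \<noteq> 0 \<Longrightarrow> int q dvd int n2 * u - int j * u"
    and bezout: "x \<in> PS" "y \<in> PS" "x * f1 + y * f2 = 1"
    and e: "e \<in> PS" "degree e < n1 + n2" "\<And>j. coeff e j \<noteq> 0 \<Longrightarrow> int q dvd \<alpha> - int j * u"
  shows "\<exists>a\<in>PS. \<exists>b\<in>PS. a * f2 + b * f1 = e \<and> degree a < n1 \<and> degree b < n2 \<and>
    (\<forall>j. coeff a j \<noteq> 0 \<longrightarrow> int q dvd \<alpha> - int n2 * u - int j * u) \<and>
    (\<forall>j. coeff b j \<noteq> 0 \<longrightarrow> int q dvd \<alpha> - int n1 * u - int j * u)"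
proof -
  have nz: "f1 \<noteq> 0" "f2 \<noteq> 0" using f by auto
  define a where "a = (e * y) mod f1"
  define b where "b = (e - a * f2) div f1"
  have aPS: "a \<in> PS" unfolding a_def by (intro PS_mod PS_mult e bezout f)
  have bPS: "b \<in> PS" unfolding b_def by (intro PS_div PS_diff PS_mult e aPS f)
  have da: "degree a < n1" unfolding a_def using degree_mod_less[OF nz(1), of "e * y"] f by auto
  have "e - a * f2 = f1 * (e * x + (e * y) div f1 * f2)"
  proof -
    have "a = e * y - (e * y) div f1 * f1" unfolding a_def by (simp add: minus_div_mult_eq_mod)
    then have "e - a * f2 = e * 1 - (e * y - (e * y) div f1 * f1) * f2" by simp
    also have "\<dots> = f1 * (e * x + (e * y) div f1 * f2)"
      unfolding bezout(3)[symmetric] by (simp add: algebra_simps)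
    finally show ?thesis .
  qed
  then have "f1 dvd e - a * f2" by (metis dvd_triv_left)
  then have eq: "a * f2 + b * f1 = e" by (simp add: b_def)
  have db: "degree b < n2"
  proof (cases "b = 0")
    case False
    have "degree (a * f2) < n1 + n2" using degree_mult_le[of a f2] da f by simp
    then have "degree (e - a * f2) < n1 + n2" using e(2) by (intro degree_diff_less)
    moreover have "e - a * f2 = b * f1" using eq by (simp add: algebra_simps)
    ultimately show ?thesis using False nz f by (simp add: degree_mult_eq)
  qed (use f in simp)
  let ?a = "graded_part (\<alpha> - int n2 * u) a" and ?b = "graded_part (\<alpha> - int n1 * u) b"
  have "?a * f2 + ?b * f1 = graded_part \<alpha> (a * f2 + b * f1)"
    using graded_part_mult[of f2 "int n2 * u" "\<alpha> - int n2 * u" a] graded(2)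
      graded_part_mult[of f1 "int n1 * u" "\<alpha> - int n1 * u" b] graded(1)
    by (simp add: graded_part_add)
  also have "\<dots> = e" unfolding eq using e(3) by (rule graded_part_eq)
  finally have "?a * f2 + ?b * f1 = e" .
  moreover have "degree ?a < n1" "degree ?b < n2" using degree_graded_part da db by (meson le_less_trans)+
  ultimately show ?thesis using aPS bPS graded_part_PS
    by (intro bexI[of _ ?a] bexI[of _ ?b]) (auto simp: coeff_graded_part)
qed

text \<open>If the error has value at least \<alpha> > N u, with N = n1 + n2, its component in
  degree \<alpha> is written as a f2 + b f1, and lifts of a and b correct the two factors. The
  product of the corrections has value at least 2 \<alpha> - N u > \<alpha>, so the new error has
  value at least \<alpha> + 1.\<close>

theorem hensel:
  assumes F: "lead_coeff F = 1" "degree F = (n1 + n2) * degree \<psi>"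
      "FW (int (n1 + n2) * u) F" "KW (int (n1 + n2) * u) F = f1 * f2"
    and f: "f1 \<in> PS" "f2 \<in> PS" "degree f1 = n1" "degree f2 = n2" "n1 > 0" "n2 > 0"
      "coeff f1 n1 = lam ^ n1" "coeff f2 n2 = lam ^ n2"
    and graded: "\<And>j. coeff f1 j \<noteq> 0 \<Longrightarrow> int q dvd int n1 * u - int j * u"
      "\<And>j. coeff f2 j \<noteq> 0 \<Longrightarrow> int q dvd int n2 * u - int j * u"
    and bezout: "x \<in> PS" "y \<in> PS" "x * f1 + y * f2 = 1"
  shows "\<exists>G H. lead_coeff G = 1 \<and> lead_coeff H = 1 \<and> degree G = n1 * degree \<psi> \<and>
    degree H = n2 * degree \<psi> \<and> F = G * H"
proof -
  define N where "N = n1 + n2"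
  define good where "good n f G \<longleftrightarrow> lead_coeff G = 1 \<and> degree G = n * degree \<psi> \<and>
    FW (int n * u) G \<and> KW (int n * u) G = f" for n f G
  \<comment> \<open>The offset \<open>Suc i\<close> records that the starting lifts already
    reproduce the initial form of F in degree N u.\<close>
  define I where "I i GH \<longleftrightarrow> good n1 f1 (fst GH) \<and> good n2 f2 (snd GH) \<and>
    FW (int N * u + int (Suc i)) (F - fst GH * snd GH)" for i GH
  define step where "step i GH GH' \<longleftrightarrow> degree (fst GH' - fst GH) < n1 * degree \<psi> \<and>
    degree (snd GH' - snd GH) < n2 * degree \<psi> \<and> FW (int i) (fst GH' - fst GH) \<and> FW (int i) (snd GH' - snd GH)"
    for i :: nat and GH GH'
  have NN: "int N * u = int n1 * u + int n2 * u" by (simp add: N_def algebra_simps)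
  have pos: "n1 * degree \<psi> > 0" "n2 * degree \<psi> > 0" "N * degree \<psi> > 0" using f degree_pos by (auto simp: N_def)
  have prod: "lead_coeff (G * H) = 1 \<and> degree (G * H) = N * degree \<psi> \<and> FW (int N * u) (G * H) \<and>
      KW (int N * u) (G * H) = f1 * f2"
    if "good n1 f1 G" "good n2 f2 H" for G H
  proof -
    have "G \<noteq> 0" "H \<noteq> 0" using that by (auto simp: good_def)
    then have "degree (G * H) = N * degree \<psi>"
      using that by (simp add: good_def degree_mult_eq N_def add_mult_distrib)
    moreover have "lead_coeff (G * H) = 1"
      using that unfolding good_def lead_coeff_mult by (metis mult_1)
    ultimately show ?thesis using that FW_KW_mult[of "int n1 * u" G "int n2 * u" H]
      unfolding good_def NN by blast
  qed
  have small: "degree (F - G * H) < N * degree \<psi>" if "good n1 f1 G" "good n2 f2 H" for G H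
  proof -
    have "degree F = N * degree \<psi>" using F(2) by (simp only: N_def)
    with prod[OF that] pos(3) show ?thesis by (metis degree_monic_diff[OF F(1), of "G * H"])
  qed
  have good_add: "good n f (G + a)"
    if "good n f G" "degree a < n * degree \<psi>" "FW (int n * u + 1) a" for n f G a
  proof -
    have "degree a < degree G" using that by (auto simp: good_def)
    from lead_coeff_add_small[OF this] have "lead_coeff (G + a) = 1" "degree (G + a) = n * degree \<psi>"
      using that(1) unfolding good_def by metis+
    then show ?thesis using that unfolding good_def by (simp add: FW_add KW_add FW_succ)
  qed
  have "\<exists>g. \<forall>n. I n (g n) \<and> step n (g n) (g (Suc n))"
  proof (rule dependent_nat_choice)
    obtain G where G: "good n1 f1 G"
      using KW_lift_monic[OF f(1,7,3,5) graded(1)] by (auto simp: good_def)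
    obtain H where H: "good n2 f2 H"
      using KW_lift_monic[OF f(2,8,4,6) graded(2)] by (auto simp: good_def)
    have "FW (int N * u + 1) (F - G * H)"
      unfolding FW_succ using F(3,4) prod[OF G H] by (simp add: FW_diff KW_diff flip: N_def)
    then have "I 0 (G, H)" using G H by (simp add: I_def)
    then show "\<exists>GH. I 0 GH" by blast
  next
    fix GH :: "'a fps poly \<times> 'a fps poly" and i assume I: "I i GH"
    obtain G H where GH: "GH = (G, H)" by (cases GH)
    have G: "good n1 f1 G" and H: "good n2 f2 H" and FWd: "FW (int N * u + int (Suc i)) (F - G * H)"
      using I by (auto simp: I_def GH)
    define \<alpha> where "\<alpha> = int N * u + int (Suc i)"
    define e where "e = KW \<alpha> (F - G * H)"
    have e: "e \<in> PS" "\<And>j. coeff e j \<noteq> 0 \<Longrightarrow> int q dvd \<alpha> - int j * u"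
      unfolding e_def using KW_PS FWd coeff_KW_dvd by (auto simp: \<alpha>_def)
    have de: "degree e < n1 + n2"
      unfolding e_def using small[OF G H] f(5) by (intro degree_KW_less) (auto simp: N_def)
    obtain a0 b0 where ab0: "a0 \<in> PS" "b0 \<in> PS" "a0 * f2 + b0 * f1 = e" "degree a0 < n1" "degree b0 < n2"
        "\<And>j. coeff a0 j \<noteq> 0 \<Longrightarrow> int q dvd \<alpha> - int n2 * u - int j * u"
        "\<And>j. coeff b0 j \<noteq> 0 \<Longrightarrow> int q dvd \<alpha> - int n1 * u - int j * u"
      using graded_bezout[OF f(1-6) graded bezout e(1) de e(2)] by blast
    \<comment> \<open>The corrections have Y-degree below n, so every exponent leaves at least one
      u, as the lifting demands.\<close>
    have bound: "int q * v \<le> \<alpha> - int n' * u - int j * u" if "j < n" "n + n' = N" for n n' j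
    proof -
      have "int (Suc j) * u \<le> int n * u" using that u_pos by (intro mult_right_mono) auto
      then show ?thesis using that by (simp add: \<alpha>_def u_def algebra_simps flip: that(2))
    qed
    have "\<exists>a. degree a < n1 * degree \<psi> \<and> FW (\<alpha> - int n2 * u) a \<and> KW (\<alpha> - int n2 * u) a = a0"
    proof (rule KW_lift[OF ab0(1,6) _ ab0(4)])
      show "int q * v \<le> \<alpha> - int n2 * u - int j * u" if "coeff a0 j \<noteq> 0" for j
        using le_degree[OF that] ab0(4) by (intro bound) (auto simp: N_def)
    qed
    then obtain a where a: "degree a < n1 * degree \<psi>" "FW (\<alpha> - int n2 * u) a" "KW (\<alpha> - int n2 * u) a = a0"
      by blast
    have "\<exists>b. degree b < n2 * degree \<psi> \<and> FW (\<alpha> - int n1 * u) b \<and> KW (\<alpha> - int n1 * u) b = b0"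
    proof (rule KW_lift[OF ab0(2,7) _ ab0(5)])
      show "int q * v \<le> \<alpha> - int n1 * u - int j * u" if "coeff b0 j \<noteq> 0" for j
        using le_degree[OF that] ab0(5) by (intro bound) (auto simp: N_def)
    qed
    then obtain b where b: "degree b < n2 * degree \<psi>" "FW (\<alpha> - int n1 * u) b" "KW (\<alpha> - int n1 * u) b = b0"
      by blast
    have a': "FW (int n1 * u + 1) a" and b': "FW (int n2 * u + 1) b"
      by (rule FW_mono[OF _ a(2)] FW_mono[OF _ b(2)], simp add: \<alpha>_def NN)+
    have G': "good n1 f1 (G + a)"
      by (rule good_add[OF G a(1) a'])
    have H': "good n2 f2 (H + b)"
      by (rule good_add[OF H b(1) b'])
    have aH: "FW \<alpha> (a * H)" "KW \<alpha> (a * H) = a0 * f2"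
      using FW_KW_mult[OF a(2), of "int n2 * u" H] H a(3) by (auto simp: good_def)
    have bG: "FW \<alpha> (b * G)" "KW \<alpha> (b * G) = b0 * f1"
      using FW_KW_mult[OF b(2), of "int n1 * u" G] G b(3) by (auto simp: good_def)
    have ab: "FW (\<alpha> + 1) (a * b)"
      using FW_mult[OF a(2) b(2)] by (rule FW_mono[rotated]) (simp add: \<alpha>_def NN)
    have FWd': "FW \<alpha> (F - G * H)" using FWd by (simp only: \<alpha>_def)
    have "FW (\<alpha> + 1) (F - G * H - (a * H + b * G))"
      unfolding FW_succ using FWd' aH bG ab0(3)
      by (simp add: FW_diff FW_add KW_diff KW_add e_def)
    from FW_diff[OF this ab] have "FW (\<alpha> + 1) (F - (G + a) * (H + b))" by (simp add: algebra_simps)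
    then have "I (Suc i) (G + a, H + b)" using G' H' by (simp add: I_def \<alpha>_def algebra_simps)
    moreover have "step i GH (G + a, H + b)"
    proof -
      have "0 \<le> int n1 * u" "0 \<le> int n2 * u" using u_pos by simp_all
      then have "FW (int i) a" "FW (int i) b"
        by (intro FW_mono[OF _ a(2)] FW_mono[OF _ b(2)], simp add: \<alpha>_def NN)+
      then show ?thesis using a b by (simp add: step_def GH)
    qed
    ultimately show "\<exists>GH'. I (Suc i) GH' \<and> step i GH GH'" by blast
  qed
  then obtain g where g: "\<And>i. I i (g i)" "\<And>i. step i (g i) (g (Suc i))" by blast
  define G where "G i = fst (g i)" for i
  define H where "H i = snd (g i)" for i
  have good: "good n1 f1 (G i)" "good n2 f2 (H i)" and FWd: "FW (int N * u + int (Suc i)) (F - G i * H i)" for i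
    using g(1)[of i] by (auto simp: I_def G_def H_def)
  have monic: "lead_coeff (G i) = 1" "degree (G i) = n1 * degree \<psi>"
      "lead_coeff (H i) = 1" "degree (H i) = n2 * degree \<psi>" for i
    using good unfolding good_def by blast+
  have conv: "\<exists>k. \<forall>i\<ge>k. [:fps_X ^ M:] dvd d i"
    if "\<And>i. degree (d i) < n * degree \<psi>" "\<And>i. FW (int i) (d i)" for n M and d :: "nat \<Rightarrow> 'a fps poly"
  proof -
    obtain \<beta> where \<beta>: "\<And>f. degree f < n * degree \<psi> \<Longrightarrow> FW \<beta> f \<Longrightarrow> [:fps_X ^ M:] dvd f"
      using FW_dvd by blast
    have "[:fps_X ^ M:] dvd d i" if "i \<ge> nat \<beta>" for i
      using that by (intro \<beta> \<open>\<And>i. degree (d i) < n * degree \<psi>\<close> FW_mono[OF _ \<open>\<And>i. FW (int i) (d i)\<close>]) linarith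
    then show ?thesis by blast
  qed
  have "\<exists>k. \<forall>i\<ge>k. [:fps_X ^ M:] dvd G (Suc i) - G i" for M
    using g(2) by (intro conv[of _ n1]) (auto simp: step_def G_def)
  then obtain L1 where L1: "lead_coeff L1 = 1" "degree L1 = n1 * degree \<psi>" "\<And>M. \<exists>k. \<forall>i\<ge>k. [:fps_X ^ M:] dvd L1 - G i"
    using monic_limit_exists[of G "n1 * degree \<psi>", OF monic(1,2)] by blast
  have "\<exists>k. \<forall>i\<ge>k. [:fps_X ^ M:] dvd H (Suc i) - H i" for M
    using g(2) by (intro conv[of _ n2]) (auto simp: step_def H_def)
  then obtain L2 where L2: "lead_coeff L2 = 1" "degree L2 = n2 * degree \<psi>" "\<And>M. \<exists>k. \<forall>i\<ge>k. [:fps_X ^ M:] dvd L2 - H i"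
    using monic_limit_exists[of H "n2 * degree \<psi>", OF monic(3,4)] by blast
  have "F - L1 * L2 = 0"
  proof (rule eq_0_if_X_power_dvd)
    fix M
    obtain k1 where k1: "\<forall>i\<ge>k1. [:fps_X ^ M:] dvd L1 - G i" using L1(3) by blast
    obtain k2 where k2: "\<forall>i\<ge>k2. [:fps_X ^ M:] dvd L2 - H i" using L2(3) by blast
    have "FW (int i) (F - G i * H i)" for i using u_pos by (intro FW_mono[OF _ FWd]) simp
    then obtain k3 where k3: "\<forall>i\<ge>k3. [:fps_X ^ M:] dvd F - G i * H i"
      using conv[of "\<lambda>i. F - G i * H i" N M] small[OF good] by blast
    define i where "i = k1 + k2 + k3"
    have "F - L1 * L2 = (F - G i * H i) - G i * (L2 - H i) - (L1 - G i) * L2"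
      by (simp add: algebra_simps)
    moreover have "[:fps_X ^ M:] dvd L1 - G i" "[:fps_X ^ M:] dvd L2 - H i" "[:fps_X ^ M:] dvd F - G i * H i"
      using k1 k2 k3 by (auto simp: i_def)
    ultimately show "[:fps_X ^ M:] dvd F - L1 * L2"
      by (metis dvd_diff dvd_mult dvd_mult2)
  qed
  then have "F = L1 * L2" by simp
  then show ?thesis using L1(1,2) L2(1,2) by blast
qed

end

section \<open>Coefficients of adic expansions\<close>

definition psi_chain :: "nat \<Rightarrow> (int \<Rightarrow> nat) \<Rightarrow> (int \<Rightarrow> nat) \<Rightarrow> (int \<Rightarrow> 'a::field fps poly) \<Rightarrow> bool" where
  "psi_chain k q l \<Psi> \<longleftrightarrow> \<Psi> (-1) = [:fps_X:] \<and> degree (\<Psi> 0) = 1 \<and> (\<forall>i\<le>k. lead_coeff (\<Psi> (int i)) = 1) \<and>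
    (\<forall>i<k. q (int (Suc i)) * l (int (Suc i)) > 0 \<and>
      degree (\<Psi> (int (Suc i))) = q (int (Suc i)) * l (int (Suc i)) * degree (\<Psi> (int i)))"

lemma psi_chain_Suc:
  "psi_chain (Suc k) q l \<Psi> \<longleftrightarrow> psi_chain k q l \<Psi> \<and> lead_coeff (\<Psi> (int (Suc k))) = 1 \<and>
    q (int (Suc k)) * l (int (Suc k)) > 0 \<and>
    degree (\<Psi> (int (Suc k))) = q (int (Suc k)) * l (int (Suc k)) * degree (\<Psi> (int k))"
  by (auto simp: psi_chain_def less_Suc_eq le_Suc_eq)

lemma psi_chain_degree_pos: "psi_chain k q l \<Psi> \<Longrightarrow> degree (\<Psi> (int k)) > 0"
  by (induction k) (auto simp: psi_chain_Suc, simp add: psi_chain_def)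

lemma psi_chain_monic:
  assumes "psi_chain k q l \<Psi>"
  shows "monic_poly (\<Psi> (int k))"
  using assms psi_chain_degree_pos[OF assms] by unfold_locales (auto simp: psi_chain_def)

text \<open>The coefficient of the monomial with exponents B at the indices below k, by nested digit
  extraction: the outermost key polynomial, then the next inside its digit, down to a power of x. On
  polynomials of degree below deg \<psi>_k these are all coefficients of the expansion.\<close>

fun cf :: "nat \<Rightarrow> (int \<Rightarrow> 'a::field fps poly) \<Rightarrow> 'a fps poly \<Rightarrow> (int \<Rightarrow> nat) \<Rightarrow> 'a" where
  "cf 0 \<Psi> G B = fps_nth (coeff G 0) (B (-1))"
| "cf (Suc k) \<Psi> G B = cf k \<Psi> (monic_poly.dig (\<Psi> (int k)) (B (int k)) G) B"

definition supp :: "nat \<Rightarrow> (int \<Rightarrow> nat) set" where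
  "supp k = {B. \<forall>i. i \<notin> {-1..<int k} \<longrightarrow> B i = 0}"

lemma cf_cong: "(\<And>i. i \<in> {-1..<int k} \<Longrightarrow> B i = B' i) \<Longrightarrow> cf k \<Psi> G B = cf k \<Psi> G B'"
  by (induction k arbitrary: G) simp_all

lemma cf_update: "cf k \<Psi> G (B(int k := j)) = cf k \<Psi> G B"
  by (rule cf_cong) auto

lemma atLeastLessThan_int_Suc: "{-1..<int (Suc k)} = insert (int k) {-1..<int k}"
  by auto

lemma cf_linear:
  assumes "\<forall>i<k. monic_poly (\<Psi> (int i))"
  shows "cf k \<Psi> (G - H) B = cf k \<Psi> G B - cf k \<Psi> H B"
    and "cf k \<Psi> (smult (fps_const c) G) B = c * cf k \<Psi> G B"
    and "B (-1) < n \<Longrightarrow> [:fps_X ^ n:] dvd G \<Longrightarrow> cf k \<Psi> G B = 0"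
proof -
  show "cf k \<Psi> (G - H) B = cf k \<Psi> G B - cf k \<Psi> H B"
    using assms by (induction k arbitrary: G H) (simp_all add: monic_poly.dig_diff)
  show "cf k \<Psi> (smult (fps_const c) G) B = c * cf k \<Psi> G B"
    using assms by (induction k arbitrary: G) (simp_all add: monic_poly.dig_smult)
  assume n: "B (-1) < n" "[:fps_X ^ n:] dvd G"
  show "cf k \<Psi> G B = 0"
    using n(2) assms
  proof (induction k arbitrary: G)
    case 0
    then show ?case using n(1) by (simp add: X_power_dvd_poly_iff)
  next
    case (Suc k)
    obtain T where "G = [:fps_X ^ n:] * T" using Suc.prems(1) by (auto simp: dvd_def)
    then have "G = smult (fps_X ^ n) T" by simp
    then have "monic_poly.dig (\<Psi> (int k)) (B (int k)) G = smult (fps_X ^ n) (monic_poly.dig (\<Psi> (int k)) (B (int k)) T)"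
      using Suc.prems(2) by (simp add: monic_poly.dig_smult)
    then have "monic_poly.dig (\<Psi> (int k)) (B (int k)) G = [:fps_X ^ n:] * monic_poly.dig (\<Psi> (int k)) (B (int k)) T"
      by simp
    then have "[:fps_X ^ n:] dvd monic_poly.dig (\<Psi> (int k)) (B (int k)) G" by (metis dvd_triv_left)
    then show ?case using Suc by simp
  qed
qed

lemma cf_0:
  assumes "\<forall>i<k. monic_poly (\<Psi> (int i))"
  shows "cf k \<Psi> 0 B = 0"
  using cf_linear(1)[OF assms, of 0 0 B] by simp

lemma cf_sum:
  assumes "\<forall>i<k. monic_poly (\<Psi> (int i))"
  shows "cf k \<Psi> (\<Sum>x\<in>A. g x) B = (\<Sum>x\<in>A. cf k \<Psi> (g x) B)"
proof (induction A rule: infinite_finite_induct)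
  case (insert x A)
  have "cf k \<Psi> (g x + sum g A) B = cf k \<Psi> (g x) B - cf k \<Psi> (0 - sum g A) B"
    using cf_linear(1)[OF assms, of "g x" "0 - sum g A" B] by simp
  then show ?case using insert cf_linear(1)[OF assms, of 0 "sum g A" B] cf_0[OF assms, of B] by simp
qed (simp_all add: cf_0[OF assms])

lemma psi_chain_mono: "psi_chain k q l \<Psi> \<Longrightarrow> i \<le> k \<Longrightarrow> psi_chain i q l \<Psi>"
  by (auto simp: psi_chain_def)

lemma psi_chain_all_monic: "psi_chain k q l \<Psi> \<Longrightarrow> \<forall>i<Suc k. monic_poly (\<Psi> (int i))"
  using psi_chain_monic psi_chain_mono less_Suc_eq_le by blast

definition mp :: "nat \<Rightarrow> (int \<Rightarrow> 'a::field fps poly) \<Rightarrow> (int \<Rightarrow> nat) \<Rightarrow> 'a fps poly" where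
  "mp k \<Psi> B = (\<Prod>i\<in>{-1..<int k}. \<Psi> i ^ B i)"

lemma mp_0: "mp 0 \<Psi> B = \<Psi> (-1) ^ B (-1)"
proof -
  have "{-1..<0::int} = {-1}" by auto
  then show ?thesis by (simp add: mp_def)
qed

lemma mp_Suc: "mp (Suc k) \<Psi> B = mp k \<Psi> B * \<Psi> (int k) ^ B (int k)"
  unfolding mp_def atLeastLessThan_int_Suc by (subst prod.insert) (auto simp: mult.commute)

lemma multi_power_mp: "multi_power k \<Psi> B = mp (Suc k) \<Psi> B"
  unfolding multi_power_def mp_def by (rule prod.cong) auto

definition bounded_exps :: "nat \<Rightarrow> (int \<Rightarrow> nat) \<Rightarrow> (int \<Rightarrow> nat) \<Rightarrow> (int \<Rightarrow> nat) \<Rightarrow> bool" where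
  "bounded_exps k q l B \<longleftrightarrow> (\<forall>i<k. B (int i) < q (int (Suc i)) * l (int (Suc i)))"

lemma bounded_exps_Suc:
  "bounded_exps (Suc k) q l B \<longleftrightarrow> bounded_exps k q l B \<and> B (int k) < q (int (Suc k)) * l (int (Suc k))"
  by (auto simp: bounded_exps_def less_Suc_eq)

lemma admissible_iff: "B \<in> admissible_exponents k q l \<longleftrightarrow> B \<in> supp (Suc k) \<and> bounded_exps k q l B"
proof -
  have "(\<forall>i\<in>{1..int k}. B (i - 1) < q i * l i) \<longleftrightarrow> bounded_exps k q l B"
    unfolding bounded_exps_def
  proof safe
    fix i assume "\<forall>i\<in>{1..int k}. B (i - 1) < q i * l i" "i < k"
    then show "B (int i) < q (int (Suc i)) * l (int (Suc i))" by (auto dest!: bspec[of _ _ "int (Suc i)"])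
  next
    fix i assume *: "\<forall>i<k. B (int i) < q (int (Suc i)) * l (int (Suc i))" "i \<in> {1..int k}"
    have "nat (i - 1) < k" "int (nat (i - 1)) = i - 1" "int (Suc (nat (i - 1))) = i" using *(2) by auto
    then show "B (i - 1) < q i * l i" using *(1) by metis
  qed
  moreover have "{-1..int k} = {-1..<int (Suc k)}" by auto
  ultimately show ?thesis by (simp add: admissible_exponents_def supp_def)
qed

text \<open>The mixed-radix bound: exponents below q l at each level keep the product under the
  degree of the next key polynomial.\<close>

lemma degree_mp:
  assumes "psi_chain k q l \<Psi>" "bounded_exps k q l B"
  shows "degree (mp k \<Psi> B) < degree (\<Psi> (int k))"
  using assms
proof (induction k)
  case 0
  then show ?case by (simp add: mp_0 psi_chain_def poly_const_pow)
next
  case (Suc k)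
  let ?D = "degree (\<Psi> (int k))"
  have ch: "psi_chain k q l \<Psi>" "degree (\<Psi> (int (Suc k))) = q (int (Suc k)) * l (int (Suc k)) * ?D"
    and b: "bounded_exps k q l B" "B (int k) < q (int (Suc k)) * l (int (Suc k))"
    using Suc.prems by (auto simp: psi_chain_Suc bounded_exps_Suc)
  have "degree (mp (Suc k) \<Psi> B) \<le> degree (mp k \<Psi> B) + degree (\<Psi> (int k) ^ B (int k))"
    unfolding mp_Suc by (rule degree_mult_le)
  also have "\<dots> \<le> degree (mp k \<Psi> B) + ?D * B (int k)"
    using degree_power_le[of "\<Psi> (int k)" "B (int k)"] by simp
  also have "\<dots> < Suc (B (int k)) * ?D" using Suc.IH[OF ch(1) b(1)] by simp
  also have "\<dots> \<le> q (int (Suc k)) * l (int (Suc k)) * ?D" using b(2) by (intro mult_right_mono) auto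
  finally show ?case using ch(2) by simp
qed

text \<open>By \<open>degree_mp\<close> the lower part of a monomial is a legitimate digit, so the
  outermost digit can be read off, and induction does the rest. The functionals \<open>cf\<close>
  are dual to the admissible monomials.\<close>

lemma cf_mp:
  assumes "psi_chain k q l \<Psi>" "bounded_exps k q l B'"
  shows "cf (Suc k) \<Psi> (mp (Suc k) \<Psi> B') B = (if \<forall>i\<in>{-1..<int (Suc k)}. B i = B' i then 1 else 0)"
proof -
  have step: "cf (Suc k) \<Psi> (mp (Suc k) \<Psi> B') B = (if B (int k) = B' (int k) then cf k \<Psi> (mp k \<Psi> B') B else 0)"
    if ch: "psi_chain k q l \<Psi>" "bounded_exps k q l B'" for k
  proof -
    interpret monic_poly "\<Psi> (int k)" by (rule psi_chain_monic[OF ch(1)])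
    have "cf k \<Psi> 0 B = 0" using psi_chain_all_monic[OF ch(1)] by (intro cf_0) auto
    then show ?thesis by (simp add: mp_Suc dig_monomial[OF degree_mp[OF ch]])
  qed
  show ?thesis using assms
  proof (induction k)
    case 0
    have i0: "(\<forall>i\<in>{-1..<int (Suc 0)}. B i = B' i) \<longleftrightarrow> B (-1) = B' (-1) \<and> B 0 = B' 0"
    proof -
      have "{-1..<int (Suc 0)} = {-1, 0}" by auto
      then show ?thesis by (simp only:) auto
    qed
    have "cf 0 \<Psi> (mp 0 \<Psi> B') B = (if B (-1) = B' (-1) then 1 else 0)"
      using 0(1) by (simp add: mp_0 psi_chain_def poly_const_pow)
    then show ?case using step[OF 0] unfolding i0 by (simp del: cf.simps)
  next
    case (Suc k)
    then have "cf (Suc k) \<Psi> (mp (Suc k) \<Psi> B') B = (if \<forall>i\<in>{-1..<int (Suc k)}. B i = B' i then 1 else 0)"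
      by (simp add: psi_chain_Suc bounded_exps_Suc del: cf.simps)
    then show ?case using step[OF Suc.prems]
      by (simp only: atLeastLessThan_int_Suc[of "Suc k"] ball_simps) simp
  qed
qed

text \<open>A nonzero digit of index j takes degree at least j times that of the key polynomial, so
  the degree bound enforces the admissibility of the exponents.\<close>

lemma cf_bounded:
  assumes "psi_chain k q l \<Psi>" "degree G < degree (\<Psi> (int k))" "cf k \<Psi> G B \<noteq> 0"
  shows "bounded_exps k q l B"
  using assms
proof (induction k arbitrary: G)
  case (Suc k)
  have ch: "psi_chain k q l \<Psi>" "degree (\<Psi> (int (Suc k))) = q (int (Suc k)) * l (int (Suc k)) * degree (\<Psi> (int k))"
    using Suc.prems by (auto simp: psi_chain_Suc)
  interpret monic_poly "\<Psi> (int k)" by (rule psi_chain_monic[OF ch(1)])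
  have nz: "cf k \<Psi> (dig (B (int k)) G) B \<noteq> 0" using Suc.prems by simp
  have "cf k \<Psi> 0 B = 0" using psi_chain_all_monic[OF ch(1)] by (intro cf_0) auto
  then have "dig (B (int k)) G \<noteq> 0" using nz by auto
  then have "\<not> degree G < B (int k) * degree (\<Psi> (int k))" using dig_eq_0 by blast
  then have "B (int k) * degree (\<Psi> (int k)) < q (int (Suc k)) * l (int (Suc k)) * degree (\<Psi> (int k))"
    using Suc.prems(2) unfolding ch(2) by (rule le_less_trans[OF leI])
  then have "B (int k) < q (int (Suc k)) * l (int (Suc k))" by (meson mult_less_cancel2)
  then show ?case using Suc.IH[OF ch(1) degree_dig nz] by (simp add: bounded_exps_Suc)
qed (simp add: bounded_exps_def)

lemma supp_update: "B \<in> supp k \<Longrightarrow> B(int k := j) \<in> supp (Suc k)"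
  by (auto simp: supp_def)

text \<open>If all digits are divisible by x^n, so is their expansion. At the bottom the polynomial
  is constant in y and its \<open>cf\<close> are the coefficients of a power series.\<close>

lemma X_power_dvd_if_cf:
  assumes "psi_chain k q l \<Psi>" "\<And>B. B \<in> supp (Suc k) \<Longrightarrow> B (-1) < n \<Longrightarrow> cf (Suc k) \<Psi> G B = 0"
  shows "[:fps_X ^ n:] dvd G"
proof -
  have main: "[:fps_X ^ n:] dvd G"
    if "\<And>i. i < k \<Longrightarrow> psi_chain i q l \<Psi>" "k = 0 \<Longrightarrow> degree G = 0"
      "\<And>B. B \<in> supp k \<Longrightarrow> B (-1) < n \<Longrightarrow> cf k \<Psi> G B = 0" for k G
    using that
  proof (induction k arbitrary: G)
    case 0
    have "fps_nth (coeff G 0) i = 0" if "i < n" for i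
      using 0(3)[of "(\<lambda>_. 0)(-1 := i)"] that by (simp add: supp_def)
    moreover have "coeff G j = 0" if "j > 0" for j using 0(2) that by (simp add: coeff_eq_0)
    ultimately show ?case unfolding X_power_dvd_poly_iff by (metis fps_zero_nth not_gr_zero)
  next
    case (Suc k)
    interpret monic_poly "\<Psi> (int k)" using Suc.prems(1) psi_chain_monic by blast
    have "[:fps_X ^ n:] dvd dig j G" for j
    proof (rule Suc.IH)
      show "psi_chain i q l \<Psi>" if "i < k" for i using Suc.prems(1) that by simp
      show "degree (dig j G) = 0" if "k = 0"
        using degree_dig[of j G] Suc.prems(1)[of 0] that by (simp add: psi_chain_def)
      fix B assume B: "B \<in> supp k" "B (-1) < n"
      have "cf (Suc k) \<Psi> G (B(int k := j)) = 0"
        using B by (intro Suc.prems(3) supp_update) auto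
      then show "cf k \<Psi> (dig j G) B = 0" by (simp add: cf_update)
    qed
    moreover have "degree G < Suc (degree G) * degree (\<Psi> (int k))"
      using degree_pos by (metis Suc_leI lessI less_le_trans mult.right_neutral mult_le_mono2 One_nat_def)
    ultimately show ?case
      by (subst dig_expansion[of G "Suc (degree G)"]) (auto simp del: sum.lessThan_Suc intro!: dvd_sum dvd_mult2)
  qed
  show ?thesis using assms psi_chain_mono by (intro main[of "Suc k"]) (auto simp: less_Suc_eq_le)
qed

lemma supp_ext: "B \<in> supp k \<Longrightarrow> B' \<in> supp k \<Longrightarrow> (\<forall>i\<in>{-1..<int k}. B i = B' i) \<longleftrightarrow> B = B'"
  by (auto simp: supp_def fun_eq_iff)

lemma cf_partial_sum:
  assumes ch: "psi_chain k q l \<Psi>" and f: "\<And>B. f B \<noteq> 0 \<Longrightarrow> B \<in> admissible_exponents k q l"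
    and fin: "finite {B. f B \<noteq> 0 \<and> B (-1) < n}" and B: "B \<in> supp (Suc k)" "B (-1) < n"
  shows "cf (Suc k) \<Psi> (\<Sum>B | f B \<noteq> 0 \<and> B (-1) < n. smult (fps_const (f B)) (multi_power k \<Psi> B)) B = f B"
proof -
  let ?A = "{B. f B \<noteq> 0 \<and> B (-1) < n}"
  note mon = psi_chain_all_monic[OF ch]
  have "cf (Suc k) \<Psi> (\<Sum>B\<in>?A. smult (fps_const (f B)) (multi_power k \<Psi> B)) B =
      (\<Sum>B'\<in>?A. f B' * cf (Suc k) \<Psi> (mp (Suc k) \<Psi> B') B)"
    using mon by (simp add: cf_sum cf_linear(2) multi_power_mp del: cf.simps)
  also have "\<dots> = (\<Sum>B'\<in>?A. if B' = B then f B else 0)"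
  proof (rule sum.cong)
    fix B' assume "B' \<in> ?A"
    then have "B' \<in> supp (Suc k)" "bounded_exps k q l B'" using f by (auto simp: admissible_iff)
    then show "f B' * cf (Suc k) \<Psi> (mp (Suc k) \<Psi> B') B = (if B' = B then f B else 0)"
      using cf_mp[OF ch, of B' B] supp_ext[OF B(1)] by (auto simp del: cf.simps)
  qed simp
  also have "\<dots> = f B" using fin B by auto
  finally show ?thesis .
qed

text \<open>At exponents with B(-1) < n, \<open>cf\<close> vanishes on multiples of x^n, so it sees
  only a finite partial sum of the x-adically convergent expansion.\<close>

lemma adic_expansion_unique:
  assumes ch: "psi_chain k q l \<Psi>" and f: "is_adic_expansion k q l \<Psi> F f"
  shows "f B = (if B \<in> admissible_exponents k q l then cf (Suc k) \<Psi> F B else 0)"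
proof (cases "B \<in> admissible_exponents k q l")
  case True
  then have B: "B \<in> supp (Suc k)" by (simp add: admissible_iff)
  define n where "n = Suc (B (-1))"
  let ?S = "\<Sum>B | f B \<noteq> 0 \<and> B (-1) < n. smult (fps_const (f B)) (multi_power k \<Psi> B)"
  have fin: "finite {B. f B \<noteq> 0 \<and> B (-1) < n}" and dvd: "[:fps_X ^ n:] dvd F - ?S"
    and adm: "\<And>B. f B \<noteq> 0 \<Longrightarrow> B \<in> admissible_exponents k q l"
    using f unfolding is_adic_expansion_def by blast+
  note mon = psi_chain_all_monic[OF ch]
  have "cf (Suc k) \<Psi> (F - ?S) B = 0"
    using mon dvd by (intro cf_linear(3)[of "Suc k" \<Psi> B n]) (auto simp: n_def)
  moreover have "cf (Suc k) \<Psi> ?S B = f B"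
    using B by (intro cf_partial_sum[OF ch adm fin]) (auto simp: n_def)
  ultimately show ?thesis using True cf_linear(1)[OF mon, of F ?S B] by (simp del: cf.simps)
next
  case False
  then show ?thesis using f by (auto simp: is_adic_expansion_def)
qed

lemma finite_bounded_functions: "finite {B :: int \<Rightarrow> nat. B \<in> supp k \<and> (\<forall>i. B i \<le> M)}"
proof (rule finite_subset)
  show "{B. B \<in> supp k \<and> (\<forall>i. B i \<le> M)} \<subseteq> {B. \<forall>i. (i \<in> {-1..<int k} \<longrightarrow> B i \<in> {..M}) \<and> (i \<notin> {-1..<int k} \<longrightarrow> B i = 0)}"
    by (auto simp: supp_def)
qed (rule finite_set_of_finite_funs, auto)

text \<open>The \<open>cf\<close> are the coefficients. Below a given exponent of x only finitely
  many occur: the middle exponents are bounded by q l and the top one by deg F.\<close>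

lemma adic_expansion_exists:
  assumes ch: "psi_chain k q l \<Psi>"
  shows "\<exists>f. is_adic_expansion k q l \<Psi> F f"
proof -
  define f where "f B = (if B \<in> admissible_exponents k q l then cf (Suc k) \<Psi> F B else 0)" for B
  note mon = psi_chain_all_monic[OF ch]
  interpret monic_poly "\<Psi> (int k)" by (rule psi_chain_monic[OF ch])
  have adm: "\<And>B. f B \<noteq> 0 \<Longrightarrow> B \<in> admissible_exponents k q l" by (auto simp: f_def split: if_splits)
  have fin: "finite {B. f B \<noteq> 0 \<and> B (-1) < n}" for n
  proof -
    define M where "M = n + degree F + (\<Sum>i<k. q (int (Suc i)) * l (int (Suc i)))"
    have "B \<in> supp (Suc k) \<and> (\<forall>i. B i \<le> M)" if B: "f B \<noteq> 0" "B (-1) < n" for B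
    proof
      show s: "B \<in> supp (Suc k)" using adm[OF B(1)] by (simp add: admissible_iff)
      have b: "bounded_exps k q l B" using adm[OF B(1)] by (simp add: admissible_iff)
      have nz: "cf k \<Psi> (dig (B (int k)) F) B \<noteq> 0" using B(1) by (auto simp: f_def split: if_splits)
      have "cf k \<Psi> 0 B = 0" using mon by (intro cf_0) auto
      then have "dig (B (int k)) F \<noteq> 0" using nz by auto
      then have "\<not> degree F < B (int k) * degree (\<Psi> (int k))" using dig_eq_0 by blast
      then have Bk: "B (int k) \<le> degree F" using degree_pos
        by (metis Suc_leI le_trans mult.right_neutral mult_le_mono2 not_less One_nat_def)
      show "\<forall>i. B i \<le> M"
      proof
        fix i
        consider "i \<notin> {-1..<int (Suc k)}" | "i = -1" | "i = int k" | j where "j < k" "i = int j"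
        proof -
          have "i \<in> {-1..<int (Suc k)} \<Longrightarrow> i \<noteq> -1 \<Longrightarrow> i \<noteq> int k \<Longrightarrow> nat i < k \<and> i = int (nat i)" by auto
          then show thesis using that by blast
        qed
        then show "B i \<le> M"
        proof cases
          case 1 then show ?thesis using s by (auto simp: supp_def)
        next
          case 2 then show ?thesis using B(2) by (simp add: M_def)
        next
          case 3 then show ?thesis using Bk by (simp add: M_def)
        next
          case (4 j)
          have "B i < q (int (Suc j)) * l (int (Suc j))" using b 4 by (simp add: bounded_exps_def)
          also have "\<dots> \<le> (\<Sum>i<k. q (int (Suc i)) * l (int (Suc i)))" using 4 by (intro member_le_sum) auto
          finally show ?thesis by (simp add: M_def)
        qed
      qed
    qed
    then show ?thesis by (intro finite_subset[OF _ finite_bounded_functions[of "Suc k" M]]) auto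
  qed
  have "[:fps_X ^ n:] dvd F - (\<Sum>B | f B \<noteq> 0 \<and> B (-1) < n. smult (fps_const (f B)) (multi_power k \<Psi> B))"
    (is "_ dvd F - ?S") for n
  proof (rule X_power_dvd_if_cf[OF ch])
    fix B assume B: "B \<in> supp (Suc k)" "B (-1) < n"
    have "cf (Suc k) \<Psi> F B = f B"
    proof (cases "cf (Suc k) \<Psi> F B = 0")
      case False
      then have "bounded_exps k q l B" using cf_bounded[OF ch degree_dig] by simp
      then show ?thesis using B by (simp add: f_def admissible_iff del: cf.simps)
    qed (simp add: f_def)
    then show "cf (Suc k) \<Psi> (F - ?S) B = 0"
      using cf_partial_sum[OF ch adm fin B] cf_linear(1)[OF mon, of F ?S B] by (simp del: cf.simps)
  qed
  then show ?thesis using adm fin unfolding is_adic_expansion_def by blast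
qed

section \<open>Initial forms in terms of adic expansions\<close>

locale field_emb =
  fixes h :: "'a::field \<Rightarrow> 'e::field"
  assumes emb: "field_embedding h"
begin

lemma h_1: "h 1 = 1" and h_add: "h (a + b) = h a + h b" and h_mult: "h (a * b) = h a * h b"
  using emb by (auto simp: field_embedding_def)

lemma h_0 [simp]: "h 0 = 0"
  using h_add[of 0 0] by (metis add.right_neutral add_left_cancel)

lemma h_uminus: "h (- a) = - h a"
  using h_add[of a "- a"] by (simp add: eq_neg_iff_add_eq_0 add.commute)

lemma h_diff: "h (a - b) = h a - h b"
  using h_add[of a "- b"] h_uminus by simp

lemma h_eq_0 [simp]: "h a = 0 \<longleftrightarrow> a = 0"
proof
  assume "h a = 0"
  show "a = 0"
  proof (rule ccontr)
    assume "a \<noteq> 0"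
    then have "h a * h (inverse a) = 1" by (simp flip: h_mult add: h_1)
    then show False using \<open>h a = 0\<close> by simp
  qed
qed simp

lemma h_inverse: "h (inverse a) = inverse (h a)"
proof (cases "a = 0")
  case False
  then have "h a * h (inverse a) = 1" by (simp flip: h_mult add: h_1)
  then show ?thesis using inverse_unique by metis
qed simp

lemma h_inj: "h a = h b \<longleftrightarrow> a = b"
  using h_eq_0[of "a - b"] by (simp add: h_diff)

lemma h_of_nat: "h (of_nat n) = of_nat n"
  by (induction n) (simp_all add: h_add h_1)

lemma h_sum: "h (sum f A) = (\<Sum>x\<in>A. h (f x))"
  by (induction A rule: infinite_finite_induct) (simp_all add: h_add)

lemma range_subfield: "is_subfield (range h)"
  unfolding is_subfield_def
  by (auto simp flip: h_diff h_mult h_inverse intro: range_eqI[of 1 h 1] simp: h_1)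

end

section \<open>Values and coefficients attached to monomials\<close>

definition val :: "nat \<Rightarrow> (int \<Rightarrow> nat) \<Rightarrow> (int \<Rightarrow> nat) \<Rightarrow> int" where
  "val k V B = (\<Sum>i\<in>{-1..<int k}. int (B i) * int (V i))"

definition lamp :: "nat \<Rightarrow> (int \<Rightarrow> 'e::field) \<Rightarrow> (int \<Rightarrow> nat) \<Rightarrow> 'e" where
  "lamp k \<Lambda> B = (\<Prod>i\<in>{-1..<int k}. \<Lambda> i ^ B i)"

definition terms_at :: "nat \<Rightarrow> (int \<Rightarrow> 'a::field fps poly) \<Rightarrow> (int \<Rightarrow> nat) \<Rightarrow> 'a fps poly \<Rightarrow> int \<Rightarrow> (int \<Rightarrow> nat) set" where
  "terms_at k \<Psi> V G \<alpha> = {B\<in>supp k. cf k \<Psi> G B \<noteq> 0 \<and> val k V B = \<alpha>}"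

text \<open>The bridge from the filtration to the data of the algorithm: the value of G is the least
  <B,V> over its expansion, and its coefficient in degree \<alpha> is the sum of f_B \<Lambda>^B
  over the B with <B,V> = \<alpha>.\<close>

definition represents ::
    "('a::field \<Rightarrow> 'e::field) \<Rightarrow> nat \<Rightarrow> (int \<Rightarrow> 'a fps poly) \<Rightarrow> (int \<Rightarrow> nat) \<Rightarrow> (int \<Rightarrow> 'e) \<Rightarrow>
     (int \<Rightarrow> 'a fps poly \<Rightarrow> bool) \<Rightarrow> (int \<Rightarrow> 'a fps poly \<Rightarrow> 'e) \<Rightarrow> 'a fps poly \<Rightarrow> bool" where
  "represents h k \<Psi> V \<Lambda> Fil \<kappa> G \<longleftrightarrow> (\<forall>\<alpha>. finite (terms_at k \<Psi> V G \<alpha>) \<and>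
    (Fil \<alpha> G \<longleftrightarrow> (\<forall>B\<in>supp k. cf k \<Psi> G B \<noteq> 0 \<longrightarrow> \<alpha> \<le> val k V B)) \<and>
    (Fil \<alpha> G \<longrightarrow> \<kappa> \<alpha> G = (\<Sum>B\<in>terms_at k \<Psi> V G \<alpha>. h (cf k \<Psi> G B) * lamp k \<Lambda> B)))"

lemma interval_0: "{-1..<int 0} = {-1}"
  by auto

lemma val_0: "val 0 V B = int (B (-1)) * int (V (-1))"
  unfolding val_def interval_0 by simp

lemma lamp_0: "lamp 0 \<Lambda> B = \<Lambda> (-1) ^ B (-1)"
  unfolding lamp_def interval_0 by simp

lemma val_Suc: "val (Suc k) V B = val k V B + int (B (int k)) * int (V (int k))"
  unfolding val_def atLeastLessThan_int_Suc by (subst sum.insert) auto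

lemma lamp_Suc: "lamp (Suc k) \<Lambda> B = lamp k \<Lambda> B * \<Lambda> (int k) ^ B (int k)"
  unfolding lamp_def atLeastLessThan_int_Suc by (subst prod.insert) (auto simp: mult.commute)

lemma val_update: "val k V (B(int k := j)) = val k V B"
  unfolding val_def by (rule sum.cong) auto

lemma lamp_update: "lamp k \<Lambda> (B(int k := j)) = lamp k \<Lambda> B"
  unfolding lamp_def by (rule prod.cong) auto

text \<open>The x-adic valuation. Since \<psi>_0 has degree 1, the polynomials below its degree are
  constants in y, given by the coefficient at 0.\<close>

definition Fil0 :: "int \<Rightarrow> 'a::field fps poly \<Rightarrow> bool" where
  "Fil0 \<alpha> G \<longleftrightarrow> (\<forall>n. fps_nth (coeff G 0) n \<noteq> 0 \<longrightarrow> \<alpha> \<le> int n)"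

definition \<kappa>0 :: "('a::field \<Rightarrow> 'e::field) \<Rightarrow> int \<Rightarrow> 'a fps poly \<Rightarrow> 'e" where
  "\<kappa>0 h \<alpha> G = (if \<alpha> < 0 then 0 else h (fps_nth (coeff G 0) (nat \<alpha>)))"

context field_emb
begin

lemma represents_0:
  assumes "V (-1) = 1" "\<Lambda> (-1) = 1"
  shows "represents h 0 \<Psi> V \<Lambda> Fil0 (\<kappa>0 h) G"
  unfolding represents_def
proof (intro allI conjI impI)
  fix \<alpha>
  define e :: "nat \<Rightarrow> int \<Rightarrow> nat" where "e n = (\<lambda>_. 0)(-1 := n)" for n
  have e: "e n \<in> supp 0" "e n (-1) = n" for n by (auto simp: e_def supp_def)
  have supp: "B = e (B (-1))" if "B \<in> supp 0" for B using that by (auto simp: supp_def e_def fun_eq_iff)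
  have terms: "terms_at 0 \<Psi> V G \<alpha> = (if \<alpha> < 0 \<or> fps_nth (coeff G 0) (nat \<alpha>) = 0 then {} else {e (nat \<alpha>)})"
    using supp e assms by (auto simp: terms_at_def val_0)
  show "finite (terms_at 0 \<Psi> V G \<alpha>)" by (simp add: terms)
  show "Fil0 \<alpha> G \<longleftrightarrow> (\<forall>B\<in>supp 0. cf 0 \<Psi> G B \<noteq> 0 \<longrightarrow> \<alpha> \<le> val 0 V B)"
    using supp e assms by (auto simp: Fil0_def val_0) (metis e)
  show "\<kappa>0 h \<alpha> G = (\<Sum>B\<in>terms_at 0 \<Psi> V G \<alpha>. h (cf 0 \<Psi> G B) * lamp 0 \<Lambda> B)"
    by (auto simp: terms \<kappa>0_def lamp_0 assms e)
qed

lemma key_level_0: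
  assumes \<psi>: "lead_coeff \<psi> = 1" "degree \<psi> = 1"
  shows "key_level \<psi> (range h) 0 Fil0 (\<kappa>0 h)"
proof -
  have low: "Fil0 \<alpha> G" if "\<alpha> \<le> 0" for \<alpha> and G :: "'a fps poly" using that by (auto simp: Fil0_def)
  show ?thesis
  proof unfold_locales
    show "lead_coeff \<psi> = 1" "degree \<psi> > 0" using \<psi> by auto
    show "is_subfield (range h)" by (rule range_subfield)
    show "Fil0 \<alpha> 0" for \<alpha> by (simp add: Fil0_def)
    show "\<kappa>0 h 0 1 = 1" by (simp add: \<kappa>0_def h_1)
    show "\<kappa>0 h \<alpha> f \<in> range h" for \<alpha> f by (auto simp: \<kappa>0_def intro: range_eqI[of 0 h 0])
    show "\<exists>f. degree f < degree \<psi> \<and> Fil0 \<alpha> f \<and> \<kappa>0 h \<alpha> f = c" if c: "0 \<le> \<alpha>" "c \<in> range h" for \<alpha> c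
    proof -
      obtain a where "c = h a" using c by auto
      then show ?thesis using c \<psi>
        by (intro exI[of _ "[:fps_const a * fps_X ^ nat \<alpha>:]"]) (auto simp: Fil0_def \<kappa>0_def)
    qed
    show "\<exists>\<beta>. \<forall>f :: 'a fps poly. degree f < degree \<psi> \<longrightarrow> Fil0 \<beta> f \<longrightarrow> [:fps_X ^ M:] dvd f" for M
    proof (intro exI[of _ "int M"] allI impI)
      fix f :: "'a fps poly" assume f: "degree f < degree \<psi>" "Fil0 (int M) f"
      then have "coeff f j = 0" if "j \<noteq> 0" for j using \<psi> that by (simp add: coeff_eq_0)
      then show "[:fps_X ^ M:] dvd f" using f(2) unfolding X_power_dvd_poly_iff Fil0_def
        by (metis fps_zero_nth not_le of_nat_le_iff)
    qed
    show "Fil0 (\<alpha> + 1) f \<longleftrightarrow> Fil0 \<alpha> f \<and> \<kappa>0 h \<alpha> f = 0" for \<alpha> f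
    proof (cases "\<alpha> < 0")
      case True
      then show ?thesis using low by (simp add: \<kappa>0_def)
    next
      case False
      have "\<alpha> + 1 \<le> int n \<longleftrightarrow> \<alpha> \<le> int n \<and> n \<noteq> nat \<alpha>" for n using False by auto
      then show ?thesis using False by (auto simp: Fil0_def \<kappa>0_def)
    qed
    show "Fil0 \<alpha> f" if "\<alpha> \<le> 0" for \<alpha> and f :: "'a fps poly" by (rule low[OF that])
    fix f g :: "'a fps poly" and \<alpha>
    assume f: "degree f < degree \<psi>" and g: "degree g < degree \<psi>"
    show "Fil0 \<alpha> (f - g)" if "Fil0 \<alpha> f" "Fil0 \<alpha> g"
      using that unfolding Fil0_def by (metis coeff_diff diff_zero fps_sub_nth)
    show "\<kappa>0 h \<alpha> (f - g) = \<kappa>0 h \<alpha> f - \<kappa>0 h \<alpha> g" by (simp add: \<kappa>0_def h_diff)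
    fix s r :: "'a fps poly" and \<beta>
    assume fg: "f * g = s * \<psi> + r" and r: "degree r < degree \<psi>" and F: "Fil0 \<alpha> f" "Fil0 \<beta> g"
    interpret M: monic_poly \<psi> using \<psi> by unfold_locales auto
    \<comment> \<open>A product of constants in y produces no carry.\<close>
    have "degree (f * g) < degree \<psi>" using degree_mult_le[of f g] f g \<psi> by simp
    then have "s = 0" "r = f * g" using M.quo_eqI[OF fg r] M.quo_small M.rem_small by auto
    define a where "a = coeff f 0"
    define b where "b = coeff g 0"
    have ab: "coeff r 0 = a * b" by (simp add: \<open>r = f * g\<close> coeff_mult_0 a_def b_def)
    have az: "fps_nth a i \<noteq> 0 \<Longrightarrow> \<alpha> \<le> int i" and bz: "fps_nth b i \<noteq> 0 \<Longrightarrow> \<beta> \<le> int i" for i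
      using F by (auto simp: Fil0_def a_def b_def)
    have "Fil0 (\<alpha> + \<beta>) r"
      unfolding Fil0_def
    proof (intro allI impI)
      fix n assume "fps_nth (coeff r 0) n \<noteq> 0"
      then have "(\<Sum>i=0..n. fps_nth a i * fps_nth b (n - i)) \<noteq> 0" by (simp add: ab fps_mult_nth)
      then obtain i where "i \<in> {0..n}" "fps_nth a i * fps_nth b (n - i) \<noteq> 0" by (rule sum.not_neutral_contains_not_neutral)
      then show "\<alpha> + \<beta> \<le> int n" using az[of i] bz[of "n - i"] by auto
    qed
    moreover have "\<kappa>0 h (\<alpha> + \<beta>) r = \<kappa>0 h \<alpha> f * \<kappa>0 h \<beta> g"
    proof (cases "\<alpha> + \<beta> < 0")
      case True
      then show ?thesis by (auto simp: \<kappa>0_def)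
    next
      case False
      define n where "n = nat (\<alpha> + \<beta>)"
      have n: "int n = \<alpha> + \<beta>" using False by (simp add: n_def)
      have "fps_nth (a * b) n = (\<Sum>i=0..n. if int i = \<alpha> then fps_nth a i * fps_nth b (n - i) else 0)"
        unfolding fps_mult_nth
      proof (rule sum.cong)
        fix i assume "i \<in> {0..n}"
        then show "fps_nth a i * fps_nth b (n - i) = (if int i = \<alpha> then fps_nth a i * fps_nth b (n - i) else 0)"
          using az[of i] bz[of "n - i"] n by (cases "fps_nth a i * fps_nth b (n - i) = 0") auto
      qed simp
      also have "\<dots> = (if 0 \<le> \<alpha> \<and> 0 \<le> \<beta> then fps_nth a (nat \<alpha>) * fps_nth b (nat \<beta>) else 0)"
      proof (cases "0 \<le> \<alpha> \<and> 0 \<le> \<beta>")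
        case True
        have "int i = \<alpha> \<longleftrightarrow> i = nat \<alpha>" for i using True by auto
        moreover have "n - nat \<alpha> = nat \<beta>" "nat \<alpha> \<le> n" using n True by auto
        ultimately show ?thesis using True by simp
      next
        case False
        then show ?thesis using n by (auto intro!: sum.neutral)
      qed
      finally show ?thesis using False
        by (auto simp: \<kappa>0_def ab h_mult n_def a_def b_def)
    qed
    ultimately show "Fil0 (\<alpha> + \<beta> - 0) s \<and> Fil0 (\<alpha> + \<beta>) r \<and> \<kappa>0 h (\<alpha> + \<beta>) r = \<kappa>0 h \<alpha> f * \<kappa>0 h \<beta> g"
      using \<open>s = 0\<close> by (simp add: Fil0_def)
  qed simp
qed

end

lemma prod_powi_sum:
  assumes "z \<noteq> (0::'e::field)"
  shows "(\<Prod>i\<in>A. z powi f i) = z powi (\<Sum>i\<in>A. f i)"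
  by (induction A rule: infinite_finite_induct) (simp_all add: power_int_add assms)

context key_step
begin

text \<open>The origin of the update formulas. A term of lower value x with exponent j of \<psi>_k
  gets the value \<alpha> = q x + j u, and \<open>\<kappa>'\<close> multiplies it by \<zeta>^(t
  \<alpha> + j). Distributing this power of z over the factors of the monomial gives the new
  \<Lambda> at the indices up to k.\<close>

lemma represents_next:
  fixes \<Psi> :: "int \<Rightarrow> 'a fps poly"
  assumes \<psi>: "\<psi> = \<Psi> (int k)" and v: "v = int (V (int k))" and la: "lam = \<Lambda> (int k)" and h0: "h 0 = 0"
    and rep: "\<And>G. degree G < degree \<psi> \<Longrightarrow> represents h k \<Psi> V \<Lambda> Fil \<kappa> G"
  shows "represents h (Suc k) \<Psi> (update_vals k q m (degree P) V) (update_lams k q P z s t V \<Lambda>) FW \<kappa>' G"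
proof -
  define V' where "V' = update_vals k q m (degree P) V"
  define \<Lambda>' where "\<Lambda>' = update_lams k q P z s t V \<Lambda>"
  have rep_dig: "finite (terms_at k \<Psi> V (dig j G) \<alpha>)"
    "Fil \<alpha> (dig j G) \<longleftrightarrow> (\<forall>B\<in>supp k. cf k \<Psi> (dig j G) B \<noteq> 0 \<longrightarrow> \<alpha> \<le> val k V B)"
    "Fil \<alpha> (dig j G) \<Longrightarrow> \<kappa> \<alpha> (dig j G) = (\<Sum>B\<in>terms_at k \<Psi> V (dig j G) \<alpha>. h (cf k \<Psi> (dig j G) B) * lamp k \<Lambda> B)"
    for j \<alpha>
    using rep[OF degree_dig, of j G] unfolding represents_def by blast+
  have V': "V' i = q * V i" if "i \<in> {-1..<int k}" for i using that by (simp add: V'_def update_vals_def)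
  have V'k: "int (V' (int k)) = u" unfolding u_def by (simp add: V'_def update_vals_def v)
  have val': "val (Suc k) V' B = int q * val k V B + int (B (int k)) * u" for B
    unfolding val_Suc V'k by (simp add: val_def V' sum_distrib_left mult.left_commute)
  have lamp': "lamp (Suc k) \<Lambda>' B = lamp k \<Lambda> B * lam ^ B (int k) *
      z powi (t * val k V B + (t * v + s) * int (B (int k)))" for B
  proof -
    have "lamp k \<Lambda>' B = (\<Prod>i\<in>{-1..<int k}. \<Lambda> i ^ B i * z powi (t * (int (B i) * int (V i))))"
      unfolding lamp_def
    proof (rule prod.cong)
      fix i assume "i \<in> {-1..<int k}"
      then have "\<Lambda>' i = \<Lambda> i * z powi (t * int (V i))" by (simp add: \<Lambda>'_def update_lams_def Let_def)
      moreover have "(z powi (t * int (V i))) ^ B i = z powi (t * int (V i) * int (B i))"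
        by (simp only: power_int_mult power_int_of_nat)
      ultimately show "\<Lambda>' i ^ B i = \<Lambda> i ^ B i * z powi (t * (int (B i) * int (V i)))"
        by (simp add: power_mult_distrib mult_ac)
    qed simp
    also have "\<dots> = lamp k \<Lambda> B * z powi (t * val k V B)"
      using \<zeta>(2) by (simp add: prod.distrib prod_powi_sum lamp_def val_def sum_distrib_left)
    finally have 1: "lamp k \<Lambda>' B = lamp k \<Lambda> B * z powi (t * val k V B)" .
    have "\<Lambda>' (int k) = lam * z powi (t * v + s)" by (simp add: \<Lambda>'_def update_lams_def Let_def la v)
    moreover have "(z powi (t * v + s)) ^ B (int k) = z powi ((t * v + s) * int (B (int k)))"
      by (simp only: power_int_mult power_int_of_nat)
    ultimately have "\<Lambda>' (int k) ^ B (int k) = lam ^ B (int k) * z powi ((t * v + s) * int (B (int k)))"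
      by (simp add: power_mult_distrib)
    then show ?thesis unfolding lamp_Suc 1 using \<zeta>(2) by (simp add: power_int_add mult_ac)
  qed
  \<comment> \<open>From q s - m t = 1 follows t j u + j = q j (t v + s). So the exponent of \<zeta>
    is divisible by q, and t v + s is the exponent in the update of the factor belonging to
    \<psi>_k.\<close>
  have zeta: "\<zeta> powi (t * (int q * x + int j * u)) * \<zeta> ^ j = z powi (t * x + (t * v + s) * int j)" for x j
  proof -
    have "t * (int q * x + int j * u) + int j = int q * (t * x + (t * v + s) * int j)"
      using arg_cong[OF st, of "\<lambda>y. int j * y"] by (simp add: u_def algebra_simps)
    note * = this
    have "\<zeta> powi (t * (int q * x + int j * u)) * \<zeta> ^ j = \<zeta> powi (t * (int q * x + int j * u) + int j)"
      using \<zeta>_nz power_int_add[of \<zeta> "t * (int q * x + int j * u)" "int j"] by simp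
    then show ?thesis by (simp only: * power_int_mult power_int_of_nat \<zeta>(1))
  qed
  have cfS: "cf (Suc k) \<Psi> G B = cf k \<Psi> (dig (B (int k)) G) B" for B by (simp add: \<psi>)
  \<comment> \<open>A term of value \<alpha> with top exponent j has lower value (\<alpha> - j u)/q,
    an integer only if q divides \<alpha> - j u.\<close>
  have part: "{B\<in>terms_at (Suc k) \<Psi> V' G \<alpha>. B (int k) = j} =
      (if int q dvd \<alpha> - int j * u then (\<lambda>B. B(int k := j)) ` terms_at k \<Psi> V (dig j G) (cl \<alpha> j) else {})" for j \<alpha>
  proof (intro equalityI subsetI)
    fix B assume "B \<in> {B\<in>terms_at (Suc k) \<Psi> V' G \<alpha>. B (int k) = j}"
    then have B: "B \<in> supp (Suc k)" "cf k \<Psi> (dig j G) B \<noteq> 0" "\<alpha> = int q * val k V B + int j * u" "B (int k) = j"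
      unfolding terms_at_def by (auto simp: cfS val' simp del: cf.simps)
    have "B(int k := 0) \<in> terms_at k \<Psi> V (dig j G) (cl \<alpha> j)"
      using B cl_exact[OF B(3)] by (auto simp: terms_at_def cf_update val_update supp_def)
    moreover have "B = (B(int k := 0))(int k := j)" using B(4) by auto
    ultimately show "B \<in> (if int q dvd \<alpha> - int j * u then (\<lambda>B. B(int k := j)) ` terms_at k \<Psi> V (dig j G) (cl \<alpha> j) else {})"
    proof -
      assume 1: "B(int k := 0) \<in> terms_at k \<Psi> V (dig j G) (cl \<alpha> j)" and 2: "B = (B(int k := 0))(int k := j)"
      have "int q dvd \<alpha> - int j * u" using B(3) by simp
      then show ?thesis using image_eqI[of B "\<lambda>B. B(int k := j)", OF 2 1] by (simp only: if_True)
    qed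
  next
    fix B assume B: "B \<in> (if int q dvd \<alpha> - int j * u then (\<lambda>B. B(int k := j)) ` terms_at k \<Psi> V (dig j G) (cl \<alpha> j) else {})"
    then obtain B' where B': "int q dvd \<alpha> - int j * u" "B' \<in> supp k" "cf k \<Psi> (dig j G) B' \<noteq> 0"
      "val k V B' = cl \<alpha> j" "B = B'(int k := j)" by (auto simp: terms_at_def split: if_splits)
    then show "B \<in> {B\<in>terms_at (Suc k) \<Psi> V' G \<alpha>. B (int k) = j}"
      using cl_dvd[OF B'(1)] by (simp add: terms_at_def cfS val' cf_update val_update supp_update del: cf.simps)
  qed
  \<comment> \<open>The zero polynomial lies in every \<open>Fil\<close>, so by \<open>rep\<close>
    it has no term; B is first cut down to the indices below k.\<close>
  have cf0: "cf k \<Psi> 0 B = 0" for B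
  proof -
    have "Fil 0 0" "degree (0 :: 'a fps poly) < degree \<psi>" using Fil_0 degree_pos by auto
    show ?thesis
    proof (cases "cf k \<Psi> 0 B = 0")
      case False
      define B' where "B' i = (if i \<in> {-1..<int k} then B i else 0)" for i
      have "B' \<in> supp k" by (simp add: B'_def supp_def)
      moreover have "cf k \<Psi> 0 B' \<noteq> 0" using False cf_cong[of k B' B \<Psi> 0] by (auto simp: B'_def)
      moreover have "Fil (val k V B' + 1) 0" by (rule Fil_0)
      ultimately have "val k V B' + 1 \<le> val k V B'"
        using rep[of 0] degree_pos unfolding represents_def by (metis degree_0)
      then show ?thesis by simp
    qed
  qed
  have range: "B (int k) \<le> degree G" if "cf (Suc k) \<Psi> G B \<noteq> 0" for B
  proof (rule ccontr)
    assume "\<not> B (int k) \<le> degree G"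
    then show False using that cf0 dig_high[of G "B (int k)"] by (simp only: cfS) simp
  qed
  have fin: "finite (terms_at (Suc k) \<Psi> V' G \<alpha>)" for \<alpha>
  proof -
    have "terms_at (Suc k) \<Psi> V' G \<alpha> = (\<Union>j\<le>degree G. {B\<in>terms_at (Suc k) \<Psi> V' G \<alpha>. B (int k) = j})"
      using range by (auto simp: terms_at_def simp del: cf.simps)
    moreover have "finite {B\<in>terms_at (Suc k) \<Psi> V' G \<alpha>. B (int k) = j}" for j
      unfolding part using rep_dig(1) by auto
    ultimately show ?thesis by (metis (no_types, lifting) finite_UN_I finite_atMost)
  qed
  have "FW \<alpha> G \<longleftrightarrow> (\<forall>B\<in>supp (Suc k). cf (Suc k) \<Psi> G B \<noteq> 0 \<longrightarrow> \<alpha> \<le> val (Suc k) V' B)" for \<alpha>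
  proof
    assume F: "FW \<alpha> G"
    show "\<forall>B\<in>supp (Suc k). cf (Suc k) \<Psi> G B \<noteq> 0 \<longrightarrow> \<alpha> \<le> val (Suc k) V' B"
    proof (intro ballI impI)
      fix B assume B: "B \<in> supp (Suc k)" "cf (Suc k) \<Psi> G B \<noteq> 0"
      let ?B = "B(int k := 0)"
      have "?B \<in> supp k" using B(1) by (auto simp: supp_def)
      then have "cl \<alpha> (B (int k)) \<le> val k V ?B"
        using F B(2) rep_dig(2) unfolding FW_def cfS by (metis cf_update)
      then show "\<alpha> \<le> val (Suc k) V' B" by (simp add: val_update cl_le_iff val')
    qed
  next
    assume *: "\<forall>B\<in>supp (Suc k). cf (Suc k) \<Psi> G B \<noteq> 0 \<longrightarrow> \<alpha> \<le> val (Suc k) V' B"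
    show "FW \<alpha> G"
      unfolding FW_def rep_dig(2)
    proof (intro allI ballI impI)
      fix j B assume B: "B \<in> supp k" "cf k \<Psi> (dig j G) B \<noteq> 0"
      have "\<alpha> \<le> val (Suc k) V' (B(int k := j))"
        using B by (intro *[rule_format] supp_update) (simp_all only: cfS cf_update fun_upd_same not_False_eq_True)
      then show "cl \<alpha> j \<le> val k V B" by (simp add: val' val_update cl_le_iff)
    qed
  qed
  moreover have "\<kappa>' \<alpha> G = (\<Sum>B\<in>terms_at (Suc k) \<Psi> V' G \<alpha>. h (cf (Suc k) \<Psi> G B) * lamp (Suc k) \<Lambda>' B)"
    if F: "FW \<alpha> G" for \<alpha>
  proof -
    let ?f = "\<lambda>B. h (cf (Suc k) \<Psi> G B) * lamp (Suc k) \<Lambda>' B"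
    have inner: "\<zeta> powi (t * \<alpha>) * (kw \<alpha> j (dig j G) * \<zeta> ^ j) = (\<Sum>B\<in>{B\<in>terms_at (Suc k) \<Psi> V' G \<alpha>. B (int k) = j}. ?f B)"
      for j
    proof (cases "int q dvd \<alpha> - int j * u")
      case False
      then show ?thesis unfolding part by (simp add: kw_def)
    next
      case True
      let ?T = "terms_at k \<Psi> V (dig j G) (cl \<alpha> j)"
      have inj: "inj_on (\<lambda>B. B(int k := j)) ?T"
      proof (rule inj_onI)
        fix B B' assume B: "B \<in> ?T" "B' \<in> ?T" "B(int k := j) = B'(int k := j)"
        then have "B (int k) = 0" "B' (int k) = 0" by (auto simp: terms_at_def supp_def)
        then show "B = B'" using B(3) by (metis fun_upd_triv fun_upd_upd)
      qed
      have "Fil (cl \<alpha> j) (dig j G)" using F by (simp add: FW_def)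
      then have "\<zeta> powi (t * \<alpha>) * (kw \<alpha> j (dig j G) * \<zeta> ^ j) =
          (\<Sum>B\<in>?T. (\<zeta> powi (t * \<alpha>) * \<zeta> ^ j) * (h (cf k \<Psi> (dig j G) B) * lamp k \<Lambda> B * lam ^ j))"
        using True rep_dig(3) by (simp add: kw_def sum_distrib_left sum_distrib_right mult_ac)
      also have "\<dots> = (\<Sum>B\<in>?T. ?f (B(int k := j)))"
      proof (rule sum.cong)
        fix B assume "B \<in> ?T"
        then have "val k V B = cl \<alpha> j" by (simp add: terms_at_def)
        then have a: "\<alpha> = int q * val k V B + int j * u" using cl_dvd[OF True] by simp
        have "\<zeta> powi (t * \<alpha>) * \<zeta> ^ j = z powi (t * val k V B + (t * v + s) * int j)"
          by (subst a) (rule zeta)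
        then show "(\<zeta> powi (t * \<alpha>) * \<zeta> ^ j) * (h (cf k \<Psi> (dig j G) B) * lamp k \<Lambda> B * lam ^ j) = ?f (B(int k := j))"
          unfolding cfS lamp' by (simp add: cf_update lamp_update val_update mult_ac)
      qed simp
      also have "\<dots> = (\<Sum>B\<in>(\<lambda>B. B(int k := j)) ` ?T. ?f B)" by (simp add: sum.reindex[OF inj] o_def)
      finally show ?thesis unfolding part using True by simp
    qed
    have "\<kappa>' \<alpha> G = (\<Sum>j\<le>degree G. \<zeta> powi (t * \<alpha>) * (kw \<alpha> j (dig j G) * \<zeta> ^ j))"
      by (simp add: \<kappa>'_def KW_def poly_sum poly_monom sum_distrib_left)
    also have "\<dots> = (\<Sum>j\<le>degree G. \<Sum>B\<in>{B\<in>terms_at (Suc k) \<Psi> V' G \<alpha>. B (int k) = j}. ?f B)"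
      by (simp only: inner)
    also have "\<dots> = (\<Sum>B\<in>terms_at (Suc k) \<Psi> V' G \<alpha>. ?f B)"
      using range fin by (intro sum.group) (auto simp: terms_at_def simp del: cf.simps)
    finally show ?thesis .
  qed
  ultimately show ?thesis using fin unfolding represents_def V'_def[symmetric] \<Lambda>'_def[symmetric] by blast
qed

end

section \<open>Weighted homogeneous polynomials\<close>

definition weighted_hom :: "nat \<Rightarrow> nat \<Rightarrow> nat \<Rightarrow> 'e::field poly poly \<Rightarrow> bool" where
  "weighted_hom q m c H \<longleftrightarrow> (\<forall>i e. coeff (coeff H i) e \<noteq> 0 \<longrightarrow> q * e + m * i = c)"

text \<open>H(1, Y). On weighted homogeneous polynomials nothing is lost, because the exponent of y
  determines that of x.\<close>

definition dehom :: "'e::field poly poly \<Rightarrow> 'e poly" where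
  "dehom H = map_poly (\<lambda>p. poly p 1) H"

lemma coeff_dehom: "coeff (dehom H) i = poly (coeff H i) 1"
  by (simp add: dehom_def coeff_map_poly)

lemma dehom_mult: "dehom (G * H) = dehom G * dehom H"
  by (rule poly_eqI) (simp add: coeff_dehom coeff_mult poly_sum)

lemma dehom_1: "dehom 1 = 1"
  by (rule poly_eqI) (simp add: coeff_dehom)

lemma dehom_power: "dehom (G ^ n) = dehom G ^ n"
  by (induction n) (simp_all add: dehom_mult dehom_1)

lemma weighted_hom_mult:
  assumes "weighted_hom q m c G" "weighted_hom q m c' H"
  shows "weighted_hom q m (c + c') (G * H)"
  unfolding weighted_hom_def
proof (intro allI impI)
  fix i e assume "coeff (coeff (G * H) i) e \<noteq> 0"
  then have "(\<Sum>j\<le>i. \<Sum>d\<le>e. coeff (coeff G j) d * coeff (coeff H (i - j)) (e - d)) \<noteq> 0"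
    by (simp add: coeff_mult coeff_sum)
  then obtain j where "j \<le> i" "(\<Sum>d\<le>e. coeff (coeff G j) d * coeff (coeff H (i - j)) (e - d)) \<noteq> 0"
    by (metis (no_types, lifting) atMost_iff sum.neutral)
  then obtain d where d: "d \<le> e" "coeff (coeff G j) d * coeff (coeff H (i - j)) (e - d) \<noteq> 0"
    by (metis (no_types, lifting) atMost_iff sum.neutral)
  then have "q * d + m * j = c" "q * (e - d) + m * (i - j) = c'" using assms by (auto simp: weighted_hom_def)
  moreover have "q * e = q * d + q * (e - d)" "m * i = m * j + m * (i - j)"
    using d \<open>j \<le> i\<close> by (simp_all flip: distrib_left)
  ultimately show "q * e + m * i = c + c'" by linarith
qed

lemma weighted_hom_power: "weighted_hom q m c G \<Longrightarrow> weighted_hom q m (n * c) (G ^ n)"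
proof (induction n)
  case 0
  then show ?case by (auto simp: weighted_hom_def coeff_1 split: if_splits)
next
  case (Suc n)
  then show ?case using weighted_hom_mult[of q m c G "n * c" "G ^ n"] by simp
qed

lemma coeff_quasi_homogenize:
  assumes "q > 0"
  shows "coeff (quasi_homogenize q m P) i =
    (if q dvd i then monom (coeff P (i div q)) (m * (degree P - i div q)) else 0)"
proof -
  have "coeff (quasi_homogenize q m P) i =
      (\<Sum>j\<le>degree P. if q * j = i then monom (coeff P j) (m * (degree P - j)) else 0)"
    by (simp add: quasi_homogenize_def coeff_sum)
  also have "\<dots> = (if q dvd i then monom (coeff P (i div q)) (m * (degree P - i div q)) else 0)"
  proof (cases "q dvd i")
    case True
    then have "q * j = i \<longleftrightarrow> j = i div q" for j using assms by auto
    then show ?thesis using True by (auto simp: coeff_eq_0 not_le)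
  next
    case False
    then show ?thesis by (auto intro!: sum.neutral)
  qed
  finally show ?thesis .
qed

lemma weighted_hom_quasi_homogenize:
  assumes "q > 0"
  shows "weighted_hom q m (q * m * degree P) (quasi_homogenize q m P)"
  unfolding weighted_hom_def coeff_quasi_homogenize[OF assms]
proof (intro allI impI)
  fix i e assume "coeff (if q dvd i then monom (coeff P (i div q)) (m * (degree P - i div q)) else 0) e \<noteq> 0"
  then have *: "q dvd i" "coeff P (i div q) \<noteq> 0" "e = m * (degree P - i div q)"
    by (auto split: if_splits)
  then obtain j where j: "i = q * j" by (auto simp: dvd_def)
  then have "j \<le> degree P" "e = m * (degree P - j)" using * assms by (auto intro: le_degree)
  then have "q * e + m * i = q * m * (degree P - j) + q * m * j" by (simp add: j)
  then show "q * e + m * i = q * m * degree P" using \<open>j \<le> degree P\<close> by (simp flip: distrib_left)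
qed

lemma dehom_quasi_homogenize: "q > 0 \<Longrightarrow> dehom (quasi_homogenize q m P) = pcompose P (monom 1 q)"
  by (rule poly_eqI) (simp add: coeff_dehom coeff_quasi_homogenize coeff_pcompose_monom poly_monom)

lemma weighted_hom_eqI:
  assumes "weighted_hom q m c G" "weighted_hom q m c H" "dehom G = dehom H" "q > 0"
  shows "G = H"
proof (rule poly_eqI)
  fix i
  have mono: "coeff G i = monom (coeff (dehom G) i) ((c - m * i) div q)" if "weighted_hom q m c G" for G
  proof -
    have *: "e = (c - m * i) div q" if "coeff (coeff G i) e \<noteq> 0" for e
    proof -
      have "q * e + m * i = c" using \<open>weighted_hom q m c G\<close> that by (auto simp: weighted_hom_def)
      then have "c - m * i = q * e" by simp
      then show ?thesis using assms(4) by simp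
    qed
    have "coeff G i = monom (coeff (coeff G i) ((c - m * i) div q)) ((c - m * i) div q)"
      by (rule poly_eqI) (use * in auto)
    then show ?thesis unfolding coeff_dehom by (metis mult.right_neutral poly_monom power_one)
  qed
  show "coeff G i = coeff H i" using mono[OF assms(1)] mono[OF assms(2)] assms(3) by simp
qed

lemma (in subfield_of) PS_pcompose_monom: "p \<in> PS \<Longrightarrow> n > 0 \<Longrightarrow> pcompose p (monom 1 n) \<in> PS"
  by (simp add: polys_over_def coeff_pcompose_monom zero_mem)

lemma (in subfield_of) irreducible_over_X: "irreducible_over S [:0, 1:]"
  unfolding irreducible_over_def
proof (intro conjI ballI impI)
  show "[:0, 1:] \<in> PS" using PS_monom[OF one_mem, of 1] by (simp add: monom_altdef)
  fix A B :: "'e poly" assume AB: "[:0, 1:] = A * B"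
  then have "A \<noteq> 0" "B \<noteq> 0" by auto
  then have "degree A + degree B = 1" using arg_cong[OF AB, of degree] by (simp add: degree_mult_eq)
  then show "degree A = 0 \<or> degree B = 0" by linarith
qed simp

lemma (in subfield_of) irreducible_root_0:
  assumes "irreducible_over S P" "lead_coeff P = 1" "poly P 0 = 0"
  shows "P = [:0, 1:]"
proof -
  have P: "P \<in> PS" and X: "[:0, 1:] \<in> PS" using assms(1) irreducible_over_X by (auto simp: irreducible_over_def)
  have "[:0, 1:] dvd P" using assms(3) poly_eq_0_iff_dvd[of P 0] by simp
  then obtain R where R: "R \<in> PS" "P = [:0, 1:] * R" using PS_dvdE[OF _ P X] by blast
  then have "degree R = 0" using assms(1) X by (auto simp: irreducible_over_def)
  moreover have "lead_coeff R = 1" by (rule monic_mult_cancel[of "[:0, 1:]" R]) (use assms(2) R(2) in auto)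
  ultimately have "R = 1" by (metis degree_eq_zeroE lead_coeff_pCons(2) one_pCons)
  then show ?thesis using R by simp
qed

text \<open>f is Y^r g0(Y^q) with g0(0) nonzero. For r > 0 the two factors are coprime, and the
  monomial of exponent i < N makes the second one nonconstant. For r = 0 the dichotomy is applied to
  g0 and not to f, so that the factors come out homogeneous.\<close>

lemma (in subfield_of) edge_alternatives:
  assumes f: "f \<in> PS" "lead_coeff f = 1" "degree f = N" "q > 0"
    and graded: "\<And>j. coeff f j \<noteq> 0 \<Longrightarrow> int q dvd int N - int j"
    and low: "i < N" "coeff f i \<noteq> 0"
  shows "(\<exists>P n. irreducible_over S P \<and> lead_coeff P = 1 \<and> f = pcompose P (monom 1 q) ^ n) \<or>
    (\<exists>A\<in>PS. \<exists>B\<in>PS. lead_coeff A = 1 \<and> lead_coeff B = 1 \<and> degree A > 0 \<and> degree B > 0 \<and> f = A * B \<and>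
      (\<forall>j. coeff A j \<noteq> 0 \<longrightarrow> int q dvd int (degree A) - int j) \<and>
      (\<forall>j. coeff B j \<noteq> 0 \<longrightarrow> int q dvd int (degree B) - int j) \<and>
      (\<exists>x\<in>PS. \<exists>y\<in>PS. x * A + y * B = 1))"
proof -
  have "j mod q = N mod q" if "coeff f j \<noteq> 0" for j
    using graded[OF that] by (metis mod_eq_dvd_iff of_nat_mod of_nat_eq_iff)
  then obtain g where g: "g \<in> PS" "f = monom 1 (N mod q) * pcompose g (monom 1 q)"
    using residue_class_poly[OF f(1), of q "N mod q"] f(4) by auto
  have "g \<noteq> 0" using g f by auto
  then obtain e g0 where g0: "g = [:0, 1:] ^ e * g0" "\<not> [:0, 1:] dvd g0"
    using power_factor_split[of g "[:0, 1:]"] by auto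
  have X: "[:0, 1:] \<in> PS" using irreducible_over_X by (simp add: irreducible_over_def)
  obtain s where "s \<in> PS" "g = [:0, 1:] ^ e * s"
    by (rule PS_dvdE[of "[:0, 1:] ^ e" g]) (use g0(1) g(1) X PS_power in auto)
  moreover have "[:0, 1:] ^ e \<noteq> (0 :: 'e poly)" by simp
  ultimately have g0S: "g0 \<in> PS" using g0(1) by (metis mult_cancel_left)
  have g00: "poly g0 0 \<noteq> 0" using g0(2) poly_eq_0_iff_dvd[of g0 0] by simp
  define r where "r = N mod q + q * e"
  define A where "A = monom (1::'e) r"
  define B where "B = pcompose g0 (monom 1 q)"
  have fAB: "f = A * B"
  proof -
    have "pcompose ([:0, 1:] ^ e) (monom (1::'e) q) = monom 1 (q * e)"
      by (simp add: pcompose_hom_power pcompose_pCons monom_power mult.commute)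
    then have "pcompose g (monom 1 q) = monom 1 (q * e) * B"
      by (simp add: g0(1) pcompose_mult B_def)
    then show ?thesis unfolding g(2) A_def r_def by (simp add: mult_monom flip: mult.assoc)
  qed
  have A: "A \<in> PS" "lead_coeff A = 1" "degree A = r"
    using PS_monom[OF one_mem] by (simp_all add: A_def Polynomial.degree_monom_eq)
  have B: "B \<in> PS" "lead_coeff B = 1" "degree B = q * degree g0"
    using PS_pcompose_monom[OF g0S f(4)] monic_mult_cancel[of A B] f(2) A(2)
    by (auto simp: B_def fAB degree_pcompose Polynomial.degree_monom_eq)
  have gradedB: "int q dvd int (degree B) - int j" if "coeff B j \<noteq> 0" for j
    using that f(4) unfolding B(3) by (auto simp: B_def coeff_pcompose_monom split: if_splits)
  show ?thesis
  proof (cases "r = 0")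
    case False
    have "degree B > 0"
    proof (rule ccontr)
      assume "\<not> ?thesis"
      then have "B = 1" using B(2) by (metis degree_eq_zeroE gr0I lead_coeff_pCons(2) one_pCons)
      then have "f = monom 1 r" by (simp add: fAB A_def)
      then show False using low f(3) by (auto simp: Polynomial.degree_monom_eq split: if_splits)
    qed
    moreover have "\<not> [:0, 1:] dvd B"
      using g00 poly_eq_0_iff_dvd[of B 0] f(4) by (simp add: B_def poly_pcompose poly_monom power_0_left)
    then obtain x y where "x \<in> PS" "y \<in> PS" "x * B + y * [:0, 1:] = 1"
      using irreducible_bezout[OF irreducible_over_X B(1)] by blast
    then obtain x y where "x \<in> PS" "y \<in> PS" "x * B + y * [:0, 1:] ^ r = 1"
      using bezout_power[OF B(1) X] by blast
    then have "\<exists>x\<in>PS. \<exists>y\<in>PS. x * A + y * B = 1"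
      by (intro bexI[of _ y] bexI[of _ x]) (simp_all add: A_def monom_altdef add.commute)
    moreover have "int q dvd int (degree A) - int j" if "coeff A j \<noteq> 0" for j
      using that unfolding A(3) by (auto simp: A_def split: if_splits)
    ultimately show ?thesis using A B False fAB gradedB by (intro disjI2 bexI[of _ A] bexI[of _ B]) auto
  next
    case True
    then have fB: "f = B" by (simp add: fAB A_def)
    have lg: "lead_coeff g0 = 1" using B(2,3) f(4) by (simp add: B_def coeff_pcompose_monom)
    have "degree g0 > 0" using B(3) fB f(3) low by (metis gr0I mult_0_right not_less_zero)
    from power_of_irreducible_or_coprime_split[OF g0S lg this] show ?thesis
    proof
      assume "\<exists>P n. irreducible_over S P \<and> lead_coeff P = 1 \<and> g0 = P ^ n"
      then obtain P n where P: "irreducible_over S P" "lead_coeff P = 1" "g0 = P ^ n" by blast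
      then have "f = pcompose P (monom 1 q) ^ n" using fB by (simp add: B_def pcompose_hom_power)
      then show ?thesis using P by blast
    next
      assume "\<exists>C\<in>PS. \<exists>D\<in>PS. lead_coeff C = 1 \<and> lead_coeff D = 1 \<and> degree C > 0 \<and> degree D > 0 \<and> g0 = C * D \<and>
        (\<exists>x\<in>PS. \<exists>y\<in>PS. x * C + y * D = 1)"
      then obtain C D x y where CD: "C \<in> PS" "D \<in> PS" "lead_coeff C = 1" "lead_coeff D = 1" "degree C > 0"
        "degree D > 0" "g0 = C * D" and xy: "x \<in> PS" "y \<in> PS" "x * C + y * D = 1" by blast
      let ?c = "\<lambda>p :: 'e poly. pcompose p (monom 1 q)"
      have deg: "degree (?c p) = q * degree p" for p
        by (simp add: degree_pcompose Polynomial.degree_monom_eq)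
      have lead: "lead_coeff (?c p) = lead_coeff p" for p
        using f(4) by (simp add: deg coeff_pcompose_monom)
      have gr: "int q dvd int (degree (?c p)) - int j" if "coeff (?c p) j \<noteq> 0" for p j
        using that f(4) unfolding deg by (auto simp: coeff_pcompose_monom split: if_splits)
      have "?c x * ?c C + ?c y * ?c D = 1"
        using arg_cong[OF xy(3), of ?c] by (simp add: pcompose_add pcompose_mult pcompose_1)
      then have "\<exists>x\<in>PS. \<exists>y\<in>PS. x * ?c C + y * ?c D = 1"
        using PS_pcompose_monom xy f(4) by blast
      moreover have "f = ?c C * ?c D" by (simp add: fB B_def CD(7) pcompose_mult)
      moreover have "degree (?c C) > 0" "degree (?c D) > 0" using CD f(4) by (simp_all add: deg)
      ultimately show ?thesis
        using PS_pcompose_monom CD f(4) gr lead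
        by (intro disjI2 bexI[of _ "?c C"] bexI[of _ "?c D"]) auto
    qed
  qed
qed

section \<open>One round of the algorithm\<close>

text \<open>The state of knowledge when a round is entered with its \<psi>_k. \<open>nearF\<close>
  will make the slope of the edge positive, \<open>factor_dvd\<close> accumulates what gives
  irreducibility once N = 1, and \<open>char_ok\<close> makes N, q and deg P invertible.\<close>

locale irr_round = field_emb h + key_level "\<Psi> (int k)" S "int (V (int k))" Fil \<kappa>
  for h :: "'a::field \<Rightarrow> 'e::field" and \<Psi> :: "int \<Rightarrow> 'a fps poly" and k :: nat and S :: "'e set" and V :: "int \<Rightarrow> nat"
    and Fil \<kappa> +
  fixes \<Lambda> :: "int \<Rightarrow> 'e" and qs ls :: "int \<Rightarrow> nat" and F :: "'a fps poly" and N :: nat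
  assumes chain: "psi_chain k qs ls \<Psi>"
    and rep: "\<And>G. degree G < degree (\<Psi> (int k)) \<Longrightarrow> represents h k \<Psi> V \<Lambda> Fil \<kappa> G"
    and \<Lambda>k: "\<Lambda> (int k) \<in> S" "\<Lambda> (int k) \<noteq> 0"
    and F_monic: "lead_coeff F = 1"
    and approx: "is_approx_root N F (\<Psi> (int k))"
    and nearF: "near N F"
    and factor_dvd: "\<And>G H. lead_coeff G = 1 \<Longrightarrow> F = G * H \<Longrightarrow> degree (\<Psi> (int k)) dvd degree G"
    and char_ok: "\<And>i. 0 < i \<Longrightarrow> i \<le> degree F \<Longrightarrow> of_nat i \<noteq> (0::'a)"
begin

abbreviation \<psi> where "\<psi> \<equiv> \<Psi> (int k)"
abbreviation v where "v \<equiv> int (V (int k))"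
abbreviation lam where "lam \<equiv> \<Lambda> (int k)"

text \<open>By \<open>Fil_dvd\<close>, a polynomial lying in every \<open>Fil\<close> is divisible
  by all powers of x, hence zero.\<close>

lemma order_exists:
  assumes "degree a < degree \<psi>" "a \<noteq> 0"
  shows "\<exists>\<alpha>. Fil \<alpha> a \<and> \<not> Fil (\<alpha> + 1) a"
proof (rule ccontr)
  assume none: "\<not> ?thesis"
  have "Fil (int n) a" for n
    by (induction n) (use none Fil_nonpos assms in \<open>auto simp: add.commute\<close>)
  then have "Fil \<alpha> a" for \<alpha> using Fil_nonpos[OF assms(1)] by (metis int_eq_iff linear)
  then have "[:fps_X ^ M:] dvd a" for M using Fil_dvd[of M] assms(1) by blast
  then show False using assms(2) eq_0_if_X_power_dvd by blast
qed

lemma degree_F: "degree F = N * degree \<psi>"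
  using approx_root_degree[OF approx] .

end

locale irr_round_expansion = irr_round h \<Psi> k S V Fil \<kappa> \<Lambda> qs ls F N
  for h :: "'a::field \<Rightarrow> 'e::field" and \<Psi> k S V Fil \<kappa> \<Lambda> qs ls F N +
  fixes f :: "(int \<Rightarrow> nat) \<Rightarrow> 'a"
  assumes N1: "N > 1" and expansion: "is_adic_expansion k qs ls \<Psi> F f"
begin

lemma f_eq: "f B = (if B \<in> admissible_exponents k qs ls then cf (Suc k) \<Psi> F B else 0)"
  by (rule adic_expansion_unique[OF chain expansion])

lemma f_update:
  assumes "B \<in> supp k"
  shows "f (B(int k := i)) = cf k \<Psi> (dig i F) B"
proof (cases "cf k \<Psi> (dig i F) B = 0")
  case True
  then show ?thesis by (simp add: f_eq cf_update)
next
  case False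
  have "bounded_exps k qs ls B" by (rule cf_bounded[OF chain degree_dig False])
  then have "bounded_exps k qs ls (B(int k := i))" by (auto simp: bounded_exps_def)
  then show ?thesis using supp_update[OF assms] by (simp add: f_eq admissible_iff cf_update)
qed

lemma f_supp: "f B \<noteq> 0 \<Longrightarrow> B \<in> supp (Suc k)"
  using f_eq[of B] by (auto simp: admissible_iff split: if_splits)

lemma exponent_value_eq: "int (exponent_value k B V) = val (Suc k) V B"
proof -
  have "{-1..int k} = {-1..<int (Suc k)}" by auto
  then show ?thesis by (simp add: exponent_value_def val_def)
qed

lemma reduce:
  assumes "B \<in> supp (Suc k)"
  shows "B(int k := 0) \<in> supp k" "B = (B(int k := 0))(int k := B (int k))"
  using assms by (auto simp: supp_def)

lemma Fil_dig_iff: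
  "Fil \<alpha> (dig i F) \<longleftrightarrow> (\<forall>B. f B \<noteq> 0 \<longrightarrow> B (int k) = i \<longrightarrow> \<alpha> + int i * v \<le> int (exponent_value k B V))"
proof -
  have "Fil \<alpha> (dig i F) \<longleftrightarrow> (\<forall>B\<in>supp k. cf k \<Psi> (dig i F) B \<noteq> 0 \<longrightarrow> \<alpha> \<le> val k V B)"
    using rep[OF degree_dig] unfolding represents_def by blast
  also have "\<dots> \<longleftrightarrow> (\<forall>B. f B \<noteq> 0 \<longrightarrow> B (int k) = i \<longrightarrow> \<alpha> + int i * v \<le> int (exponent_value k B V))"
  proof (intro iffI allI impI ballI)
    fix B assume *: "\<forall>B\<in>supp k. cf k \<Psi> (dig i F) B \<noteq> 0 \<longrightarrow> \<alpha> \<le> val k V B" and B: "f B \<noteq> 0" "B (int k) = i"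
    note r = reduce[OF f_supp[OF B(1)]]
    have "cf k \<Psi> (dig i F) (B(int k := 0)) \<noteq> 0" using f_update[OF r(1), of i] r(2) B by metis
    then have "\<alpha> \<le> val k V B" using * r(1) by (metis val_update)
    then show "\<alpha> + int i * v \<le> int (exponent_value k B V)" by (simp add: exponent_value_eq val_Suc B(2))
  next
    fix B assume *: "\<forall>B. f B \<noteq> 0 \<longrightarrow> B (int k) = i \<longrightarrow> \<alpha> + int i * v \<le> int (exponent_value k B V)"
      and B: "B \<in> supp k" "cf k \<Psi> (dig i F) B \<noteq> 0"
    have "\<alpha> + int i * v \<le> int (exponent_value k (B(int k := i)) V)"
      using * f_update[OF B(1), of i] B(2) by simp
    then show "\<alpha> \<le> val k V B" by (simp add: exponent_value_eq val_Suc val_update)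
  qed
  finally show ?thesis .
qed

text \<open>Ordinates are measured from N v, and the i-th power of \<psi>_k accounts for i v. So a
  point (i, w) stands for a digit of value exactly w + (N - i) v.\<close>

lemma point_iff:
  "(i, w) \<in> polygon_points k N V f \<longleftrightarrow> i \<le> N \<and>
    Fil (w + (int N - int i) * v) (dig i F) \<and> \<not> Fil (w + (int N - int i) * v + 1) (dig i F)"
proof -
  define M where "M = {exponent_value k B V |B. f B \<noteq> 0 \<and> B (int k) = i}"
  have Fil_M: "Fil \<alpha> (dig i F) \<longleftrightarrow> (\<forall>e\<in>M. \<alpha> + int i * v \<le> int e)" for \<alpha>
    unfolding Fil_dig_iff M_def by blast
  have pt: "(i, w) \<in> polygon_points k N V f \<longleftrightarrow> i \<le> N \<and> M \<noteq> {} \<and> int (Inf M) - int N * v = w"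
  proof -
    have "ordinate k N V f i = (if M = {} then None else Some (int (Inf M) - int (N * V (int k))))"
      unfolding ordinate_def M_def Let_def by (rule refl)
    then show ?thesis by (auto simp: polygon_points_def)
  qed
  define \<alpha> where "\<alpha> = w + (int N - int i) * v"
  have \<alpha>: "\<alpha> + int i * v = w + int N * v" by (simp add: \<alpha>_def algebra_simps)
  have "M \<noteq> {} \<and> int (Inf M) = w + int N * v \<longleftrightarrow> Fil \<alpha> (dig i F) \<and> \<not> Fil (\<alpha> + 1) (dig i F)"
  proof
    assume *: "M \<noteq> {} \<and> int (Inf M) = w + int N * v"
    then have "Inf M \<in> M" by (simp add: Inf_nat_def1)
    moreover have "\<forall>e\<in>M. Inf M \<le> e" by (simp add: cInf_lower)
    ultimately show "Fil \<alpha> (dig i F) \<and> \<not> Fil (\<alpha> + 1) (dig i F)"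
      unfolding Fil_M using * \<alpha> by fastforce
  next
    assume *: "Fil \<alpha> (dig i F) \<and> \<not> Fil (\<alpha> + 1) (dig i F)"
    then obtain e where e: "e \<in> M" "\<not> \<alpha> + 1 + int i * v \<le> int e" unfolding Fil_M by blast
    have low: "\<forall>e\<in>M. \<alpha> + int i * v \<le> int e" using * unfolding Fil_M by blast
    then have ee: "int e = \<alpha> + int i * v" using e by force
    have "Inf M = e"
    proof (rule antisym)
      show "Inf M \<le> e" using e(1) by (simp add: cInf_lower)
      have "Inf M \<in> M" using e(1) by (intro Inf_nat_def1) auto
      then show "e \<le> Inf M" using low ee by fastforce
    qed
    then show "M \<noteq> {} \<and> int (Inf M) = w + int N * v" using e(1) ee \<alpha> by auto
  qed
  then show ?thesis unfolding pt \<alpha>_def by auto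
qed

text \<open>Division by \<Lambda>^B0 leaves \<open>lam\<close> with exponent i - N; the remaining
  sum is the coefficient of digit i as given by \<open>represents\<close>.\<close>

lemma edge_coefficient:
  assumes "(i, w) \<in> polygon_points k N V f"
  shows "(\<Sum>B | f B \<noteq> 0 \<and> B (int k) = i \<and> int (exponent_value k B V) = w + int (N * V (int k)).
      h (f B) * (\<Prod>j\<in>{-1..int k}. \<Lambda> j powi (int (B j) - int (if j = int k then N else 0)))) =
    \<kappa> (w + (int N - int i) * v) (dig i F) * lam powi (int i - int N)"
proof -
  define \<alpha> where "\<alpha> = w + (int N - int i) * v"
  let ?T = "terms_at k \<Psi> V (dig i F) \<alpha>"
  have Fil: "Fil \<alpha> (dig i F)" using assms point_iff by (simp add: \<alpha>_def)
  have set: "{B. f B \<noteq> 0 \<and> B (int k) = i \<and> int (exponent_value k B V) = w + int (N * V (int k))} =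
      (\<lambda>B. B(int k := i)) ` ?T"
  proof (intro equalityI subsetI)
    fix B assume "B \<in> {B. f B \<noteq> 0 \<and> B (int k) = i \<and> int (exponent_value k B V) = w + int (N * V (int k))}"
    then have B: "f B \<noteq> 0" "B (int k) = i" "int (exponent_value k B V) = w + int N * v" by auto
    note r = reduce[OF f_supp[OF B(1)]]
    have "cf k \<Psi> (dig i F) (B(int k := 0)) \<noteq> 0" using f_update[OF r(1), of i] r(2) B by metis
    moreover have "val k V (B(int k := 0)) = \<alpha>"
      using B(2,3) by (simp add: exponent_value_eq val_Suc val_update \<alpha>_def algebra_simps)
    ultimately have "B(int k := 0) \<in> ?T" using r(1) by (simp add: terms_at_def)
    then show "B \<in> (\<lambda>B. B(int k := i)) ` ?T" using r(2) B(2) by (metis image_eqI)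
  next
    fix B assume "B \<in> (\<lambda>B. B(int k := i)) ` ?T"
    then obtain B' where B': "B' \<in> supp k" "cf k \<Psi> (dig i F) B' \<noteq> 0" "val k V B' = \<alpha>" "B = B'(int k := i)"
      by (auto simp: terms_at_def)
    then show "B \<in> {B. f B \<noteq> 0 \<and> B (int k) = i \<and> int (exponent_value k B V) = w + int (N * V (int k))}"
      by (simp add: f_update exponent_value_eq val_Suc val_update \<alpha>_def algebra_simps)
  qed
  have inj: "inj_on (\<lambda>B. B(int k := i)) ?T"
  proof (rule inj_onI)
    fix B B' assume B: "B \<in> ?T" "B' \<in> ?T" "B(int k := i) = B'(int k := i)"
    then have "B (int k) = 0" "B' (int k) = 0" by (auto simp: terms_at_def supp_def)
    then show "B = B'" using B(3) by (metis fun_upd_triv fun_upd_upd)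
  qed
  have prod: "(\<Prod>j\<in>{-1..int k}. \<Lambda> j powi (int ((B(int k := i)) j) - int (if j = int k then N else 0))) =
      lamp k \<Lambda> B * lam powi (int i - int N)" for B
  proof -
    have I: "{-1..int k} = insert (int k) {-1..<int k}" by auto
    have "(\<Prod>j\<in>{-1..<int k}. \<Lambda> j powi (int ((B(int k := i)) j) - int (if j = int k then N else 0))) = lamp k \<Lambda> B"
      unfolding lamp_def by (rule prod.cong) auto
    then show ?thesis unfolding I by (subst prod.insert) auto
  qed
  have "(\<Sum>B\<in>?T. h (cf k \<Psi> (dig i F) B) * (lamp k \<Lambda> B * lam powi (int i - int N))) =
      \<kappa> \<alpha> (dig i F) * lam powi (int i - int N)"
    using rep[OF degree_dig, of i F] Fil unfolding represents_def
    by (simp add: sum_distrib_right mult.assoc)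
  moreover have "B \<in> ?T \<Longrightarrow> f (B(int k := i)) = cf k \<Psi> (dig i F) B" for B
    by (simp add: terms_at_def f_update)
  ultimately show ?thesis
    unfolding set \<alpha>_def[symmetric] by (simp add: sum.reindex[OF inj] prod del: fun_upd_apply)
qed

lemma point_pos: "(i, w) \<in> polygon_points k N V f \<Longrightarrow> i < N \<Longrightarrow> w > 0"
proof (rule ccontr)
  assume pt: "(i, w) \<in> polygon_points k N V f" and i: "i < N" and w: "\<not> w > 0"
  have 1: "Fil ((int N - int i) * v + 1) (dig i F)" using nearF i by (auto simp: near_def of_nat_diff)
  have "w + (int N - int i) * v + 1 \<le> (int N - int i) * v + 1" using w by linarith
  then have "Fil (w + (int N - int i) * v + 1) (dig i F)" by (rule Fil_mono[OF degree_dig _ 1])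
  then show False using pt point_iff by blast
qed

lemma top_point: "(N, 0) \<in> polygon_points k N V f"
proof -
  have d: "dig N F = 1" by (rule dig_top_monic[OF F_monic degree_F])
  have "Fil 0 1" using degree_pos by (intro Fil_nonpos) auto
  moreover have "\<not> Fil (0 + 1) 1" using Fil_succ[of 1 0] degree_pos by (simp add: \<kappa>_one)
  ultimately show ?thesis by (simp add: point_iff d)
qed

lemma polygon_points_functional:
  "(i, w) \<in> polygon_points k N V f \<Longrightarrow> (i, w') \<in> polygon_points k N V f \<Longrightarrow> w = w'"
  by (simp add: polygon_points_def)

text \<open>Among the points left of (N, 0), one with the least quotient w/(N - i) spans the edge.
  Such points exist because F has a nonzero digit below N unless it equals
  \<open>\<psi> ^ N\<close>.\<close>

lemma lower_edge_exists:
  assumes "F \<noteq> \<psi> ^ N"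
  shows "\<exists>E. is_lower_edge (polygon_points k N V f) E \<and> (N, 0) \<in> E"
proof -
  let ?S = "polygon_points k N V f"
  define L where "L = {(i, w) \<in> ?S. i < N}"
  have "finite L"
  proof (rule finite_subset)
    show "L \<subseteq> (\<lambda>i. (i, THE w. (i, w) \<in> ?S)) ` {..N}"
    proof
      fix p assume "p \<in> L"
      then obtain i w where p: "p = (i, w)" "(i, w) \<in> ?S" "i < N" by (auto simp: L_def)
      then have "(THE w. (i, w) \<in> ?S) = w" using polygon_points_functional by blast
      then show "p \<in> (\<lambda>i. (i, THE w. (i, w) \<in> ?S)) ` {..N}" using p by auto
    qed
  qed simp
  have "\<exists>i<N. dig i F \<noteq> 0"
  proof (rule ccontr)
    assume none: "\<not> ?thesis"
    have "degree F < Suc N * degree \<psi>" using degree_F degree_pos by simp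
    then have "F = (\<Sum>j<Suc N. dig j F * \<psi> ^ j)" by (rule dig_expansion)
    also have "\<dots> = \<psi> ^ N" using none dig_top_monic[OF F_monic degree_F] by simp
    finally show False using assms by simp
  qed
  then obtain i where i: "i < N" "dig i F \<noteq> 0" by blast
  obtain \<alpha> where \<alpha>: "Fil \<alpha> (dig i F)" "\<not> Fil (\<alpha> + 1) (dig i F)"
    using order_exists[OF degree_dig i(2)] by blast
  then have "(i, \<alpha> - (int N - int i) * v) \<in> L" using i by (simp add: L_def point_iff)
  then have "L \<noteq> {}" by blast
  define slope where "slope p = real_of_int (snd p) / (real N - real (fst p))" for p :: "nat \<times> int"
  obtain p where p: "p \<in> L" "\<And>p'. p' \<in> L \<Longrightarrow> slope p \<le> slope p'"
    using ex_min_if_finite[OF finite_imageI[OF \<open>finite L\<close>], of slope] \<open>L \<noteq> {}\<close> by (auto simp: not_less)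
  define a where "a = - slope p"
  define b where "b = slope p * real N"
  define E where "E = {(i, w) \<in> ?S. real_of_int w = a * real i + b}"
  have line: "a * real i + b = slope p * (real N - real i)" for i
    by (simp add: a_def b_def algebra_simps)
  have "a * real i + b \<le> real_of_int w" if iw: "(i, w) \<in> ?S" for i w
  proof (cases "i < N")
    case True
    then have "slope p \<le> slope (i, w)" using p(2) iw by (simp add: L_def)
    then show ?thesis unfolding line using True by (simp add: slope_def pos_le_divide_eq)
  next
    case False
    then have "i = N" using iw point_iff by auto
    then show ?thesis unfolding line using polygon_points_functional[OF top_point] iw by auto
  qed
  moreover have "(N, 0) \<in> E" using top_point by (auto simp: E_def line)
  moreover have "p \<in> E" "p \<noteq> (N, 0)"
    using p(1) by (auto simp: E_def L_def line slope_def)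
  ultimately show ?thesis unfolding is_lower_edge_def using E_def by blast
qed

end

section \<open>The slope of the lowest edge and the initial form of F\<close>

locale irr_round_edge = irr_round_expansion h \<Psi> k S V Fil \<kappa> \<Lambda> qs ls F N f
  for h :: "'a::field \<Rightarrow> 'e::field" and \<Psi> k S V Fil \<kappa> \<Lambda> qs ls F N f +
  fixes H :: "'e poly poly" and E
  assumes edge: "is_lower_edge (polygon_points k N V f) E" "(N, 0) \<in> E"
    and H: "H = edge_polynomial h k N V \<Lambda> f E"
begin

text \<open>(N, 0) and a second point (i0, w0) determine the slope. Cancelling the gcd of N - i0 and
  w0 gives -m/q in lowest terms and replaces the real line by integer relations;
  \<open>point_pos\<close> provides m > 0.\<close>

lemma edge_slope:
  obtains q m i0 w0 where "q > 0" "m > 0" "coprime q m"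
    "\<And>i w. (i, w) \<in> polygon_points k N V f \<Longrightarrow> int m * (int N - int i) \<le> int q * w"
    "E = {(i, w) \<in> polygon_points k N V f. int q * w = int m * (int N - int i)}"
    "i0 < N" "(i0, w0) \<in> E"
proof -
  let ?S = "polygon_points k N V f"
  obtain a b :: real where ab: "\<And>i w. (i, w) \<in> ?S \<Longrightarrow> a * real i + b \<le> real_of_int w"
    and E: "E = {(i, w)\<in>?S. real_of_int w = a * real i + b}"
    using edge(1) unfolding is_lower_edge_def by fastforce
  have b: "b = - a * real N" using edge(2) unfolding E by auto
  obtain p where p: "p \<in> E" "p \<noteq> (N, 0)" using edge(1) unfolding is_lower_edge_def by metis
  obtain i0 w0 where i0w0: "p = (i0, w0)" by (cases p)
  have pE: "(i0, w0) \<in> ?S" "real_of_int w0 = a * (real i0 - real N)"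
    using p(1) unfolding E i0w0 by (auto simp: b algebra_simps)
  have "i0 \<le> N" using pE(1) point_iff by blast
  moreover have "i0 \<noteq> N"
  proof
    assume "i0 = N"
    then have "w0 = 0" using pE(2) by simp
    then show False using p(2) i0w0 \<open>i0 = N\<close> by simp
  qed
  ultimately have i0: "i0 < N" by simp
  have w0: "w0 > 0" by (rule point_pos[OF pE(1) i0])
  define n where "n = N - i0"
  define g where "g = gcd n (nat w0)"
  define q where "q = n div g"
  define m where "m = nat w0 div g"
  have n: "n > 0" using i0 by (simp add: n_def)
  then have gpos: "g > 0" by (simp add: g_def)
  have nq: "n = g * q" and wm: "nat w0 = g * m" by (simp_all add: q_def m_def g_def)
  have qm: "q > 0" "m > 0" using n w0 nq wm by (auto intro: gr0I)
  have cop: "coprime q m"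
    unfolding q_def m_def g_def using n by (intro div_gcd_coprime) auto
  have a: "a = - (real m / real q)"
  proof -
    have "real_of_int w0 = real (nat w0)" using w0 by simp
    also have "\<dots> = real g * real m" by (simp add: wm)
    finally have 1: "real_of_int w0 = real g * real m" .
    have "real (N - i0) = real g * real q" using nq by (simp add: n_def)
    then have "real i0 - real N = - (real g * real q)" using i0 by (simp add: of_nat_diff)
    then have "real g * real m = - a * (real g * real q)" using pE(2) unfolding 1 by simp
    then have "real g * real m = real g * (- a * real q)" by (simp only: mult_ac)
    then have "real m = - a * real q" using gpos unfolding mult_cancel_left by simp
    then show ?thesis using qm by (simp add: field_simps)
  qed
  have eqv: "a * real i + b \<le> real_of_int w \<longleftrightarrow> int m * (int N - int i) \<le> int q * w"
    "real_of_int w = a * real i + b \<longleftrightarrow> int q * w = int m * (int N - int i)" for i w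
  proof -
    have line: "a * real i + b = real m * (real N - real i) / real q" by (simp add: a b algebra_simps diff_divide_distrib)
    have "a * real i + b \<le> real_of_int w \<longleftrightarrow> real m * (real N - real i) \<le> real q * real_of_int w"
      "real_of_int w = a * real i + b \<longleftrightarrow> real q * real_of_int w = real m * (real N - real i)"
      unfolding line using qm by (simp_all add: pos_divide_le_eq eq_divide_eq mult.commute)
    moreover have e: "real m * (real N - real i) = real_of_int (int m * (int N - int i))"
      "real q * real_of_int w = real_of_int (int q * w)" by simp_all
    ultimately show "a * real i + b \<le> real_of_int w \<longleftrightarrow> int m * (int N - int i) \<le> int q * w"
      "real_of_int w = a * real i + b \<longleftrightarrow> int q * w = int m * (int N - int i)"
      unfolding e of_int_le_iff of_int_eq_iff by simp_all
  qed
  show thesis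
    using that[of q m i0 w0] qm cop ab E i0 p(1) i0w0 unfolding eqv by auto
qed

end

locale irr_round_slope = irr_round_edge h \<Psi> k S V Fil \<kappa> \<Lambda> qs ls F N f H E
  for h :: "'a::field \<Rightarrow> 'e::field" and \<Psi> k S V Fil \<kappa> \<Lambda> qs ls F N f H E +
  fixes q m i0 :: nat and w0 :: int
  assumes qm: "q > 0" "m > 0" "coprime q m"
    and above: "\<And>i w. (i, w) \<in> polygon_points k N V f \<Longrightarrow> int m * (int N - int i) \<le> int q * w"
    and E_eq: "E = {(i, w) \<in> polygon_points k N V f. int q * w = int m * (int N - int i)}"
    and low: "i0 < N" "(i0, w0) \<in> E"

sublocale irr_round_slope \<subseteq> key_slope "\<Psi> (int k)" S "int (V (int k))" Fil \<kappa> q m "\<Lambda> (int k)"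
  using qm \<Lambda>k by unfold_locales

context irr_round_slope
begin

text \<open>After the shift by (N - j) v, a point on or above the line q w = m (N - j) is a digit of
  value \<alpha> with q \<alpha> + j u \<ge> N u.\<close>

lemma FW_F: "FW (int N * u) F"
  unfolding FW_def
proof
  fix j
  show "Fil (cl (int N * u) j) (dig j F)"
  proof (cases "dig j F = 0")
    case False
    then have "\<not> degree F < j * degree \<psi>" using dig_eq_0 by blast
    then have "j \<le> N" using degree_F degree_pos by simp
    obtain \<alpha> where \<alpha>: "Fil \<alpha> (dig j F)" "\<not> Fil (\<alpha> + 1) (dig j F)"
      using order_exists[OF degree_dig False] by blast
    define w where "w = \<alpha> - (int N - int j) * v"
    have "(j, w) \<in> polygon_points k N V f" using \<alpha> \<open>j \<le> N\<close> by (simp add: point_iff w_def)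
    then have "int m * (int N - int j) \<le> int q * w" by (rule above)
    then have "int N * u \<le> int q * \<alpha> + int j * u" by (simp add: w_def u_def algebra_simps)
    then show ?thesis by (rule Fil_clI[OF degree_dig \<alpha>(1)])
  qed (simp add: Fil_0)
qed

text \<open>The ordinate of the edge line at i; the division is exact at the points of the
  edge.\<close>

definition W :: "nat \<Rightarrow> int" where "W i = (int m * (int N - int i)) div int q"

definition I :: "nat set" where "I = {i. (i, W i) \<in> E}"

lemma E_W: "(i, w) \<in> E \<longleftrightarrow> i \<in> I \<and> w = W i"
proof -
  have "w = W i" if "(i, w) \<in> E"
  proof -
    have "int q * w = int m * (int N - int i)" using that E_eq by auto
    then show ?thesis using qm unfolding W_def by (metis nonzero_mult_div_cancel_left of_nat_0_eq_iff less_numeral_extra(3))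
  qed
  then show ?thesis by (auto simp: I_def)
qed

lemma I_facts:
  assumes "i \<in> I"
  shows "i \<le> N" "int q * W i = int m * (int N - int i)" "W i \<ge> 0"
    "Fil (W i + (int N - int i) * v) (dig i F)" "\<kappa> (W i + (int N - int i) * v) (dig i F) \<noteq> 0"
proof -
  have "(i, W i) \<in> E" using assms by (simp add: I_def)
  then have E: "(i, W i) \<in> polygon_points k N V f" "int q * W i = int m * (int N - int i)"
    using E_eq by auto
  then show "i \<le> N" "int q * W i = int m * (int N - int i)"
    "Fil (W i + (int N - int i) * v) (dig i F)" "\<kappa> (W i + (int N - int i) * v) (dig i F) \<noteq> 0"
    using point_iff Fil_succ[OF degree_dig] by auto
  then have "0 \<le> int q * W i" by simp
  then show "W i \<ge> 0" using qm by (simp add: zero_le_mult_iff)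
qed

lemma coeff_H: "coeff H i =
  (if i \<in> I then monom (\<kappa> (W i + (int N - int i) * v) (dig i F) * lam powi (int i - int N)) (nat (W i)) else 0)"
proof -
  let ?c = "\<lambda>i w. \<kappa> (w + (int N - int i) * v) (dig i F) * lam powi (int i - int N)"
  have "finite I" using I_facts(1) by (meson finite_atMost finite_subset subsetI atMost_iff)
  have EI: "E = (\<lambda>i. (i, W i)) ` I" using E_W by auto
  have "H = (\<Sum>(i, w)\<in>E. monom (monom (?c i w) (nat w)) i)"
    unfolding H edge_polynomial_def Let_def
  proof (intro sum.cong refl, clarify)
    fix i w assume "(i, w) \<in> E"
    then have "(i, w) \<in> polygon_points k N V f" using E_eq by auto
    from edge_coefficient[OF this]
    show "monom (monom (\<Sum>B | f B \<noteq> 0 \<and> B (int k) = i \<and> int (exponent_value k B V) = w + int (N * V (int k)).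
        h (f B) * (\<Prod>j\<in>{-1..int k}. \<Lambda> j powi (int (B j) - int (if j = int k then N else 0)))) (nat w)) i =
      monom (monom (?c i w) (nat w)) i" by (simp only:)
  qed
  also have "\<dots> = (\<Sum>i\<in>I. monom (monom (?c i (W i)) (nat (W i))) i)"
  proof -
    have "inj_on (\<lambda>i. (i, W i)) I" by (rule inj_onI) simp
    then show ?thesis by (subst sum.cong[OF EI refl]) (simp add: sum.reindex)
  qed
  finally show ?thesis using \<open>finite I\<close> by (simp add: coeff_sum)
qed

lemma weighted_H: "weighted_hom q m (m * N) H"
  unfolding weighted_hom_def
proof (intro allI impI)
  fix i e assume "coeff (coeff H i) e \<noteq> 0"
  then have i: "i \<in> I" "e = nat (W i)" by (auto simp: coeff_H split: if_splits)
  have "int (q * e + m * i) = int (m * N)"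
    using I_facts[OF i(1)] i(2) by (simp add: algebra_simps)
  then show "q * e + m * i = m * N" by (simp only: of_nat_eq_iff)
qed

text \<open>A point lies on the edge exactly when the term of its digit has value N u, so the same
  monomials survive on both sides; \<open>lam ^ N\<close> undoes the division by
  \<Lambda>^B0.\<close>

lemma KW_F: "KW (int N * u) F = smult (lam ^ N) (dehom H)"
proof (rule poly_eqI)
  fix i
  show "coeff (KW (int N * u) F) i = coeff (smult (lam ^ N) (dehom H)) i"
  proof (cases "i \<in> I")
    case True
    define \<alpha> where "\<alpha> = W i + (int N - int i) * v"
    have ex: "int N * u = int q * \<alpha> + int i * u"
      using I_facts(2)[OF True] by (simp add: \<alpha>_def u_def algebra_simps)
    then have "int q dvd int N * u - int i * u" by simp
    then have "coeff (KW (int N * u) F) i = \<kappa> \<alpha> (dig i F) * lam ^ i"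
      using cl_exact[OF ex] by (simp add: coeff_KW kw_def)
    moreover have "lam ^ i = lam ^ N * lam powi (int i - int N)"
      using \<Lambda>k(2) by (simp add: power_int_diff)
    ultimately show ?thesis using True by (simp add: coeff_dehom coeff_H poly_monom \<alpha>_def mult_ac)
  next
    case False
    have "kw (int N * u) i (dig i F) = 0"
    proof (rule ccontr)
      assume nz: "kw (int N * u) i (dig i F) \<noteq> 0"
      define x where "x = cl (int N * u) i"
      have x: "int q dvd int N * u - int i * u" "\<kappa> x (dig i F) \<noteq> 0"
        using nz by (auto simp: kw_def x_def split: if_splits)
      have Nu: "int N * u = int q * x + int i * u" unfolding x_def by (rule cl_dvd[OF x(1)])
      have "dig i F \<noteq> 0" using x(2) by auto
      then have "\<not> degree F < i * degree \<psi>" using dig_eq_0 by blast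
      then have iN: "i \<le> N" using degree_F degree_pos by simp
      have "Fil x (dig i F)" using FW_F by (simp add: FW_def x_def)
      moreover have "\<not> Fil (x + 1) (dig i F)" using x(2) Fil_succ[OF degree_dig] by simp
      ultimately have "(i, x - (int N - int i) * v) \<in> polygon_points k N V f"
        using iN by (simp add: point_iff)
      moreover have "int q * (x - (int N - int i) * v) = int m * (int N - int i)"
        using Nu by (simp add: u_def algebra_simps)
      ultimately have "(i, x - (int N - int i) * v) \<in> E" using E_eq by auto
      then show False using False E_W by blast
    qed
    then show ?thesis using False by (simp add: coeff_dehom coeff_H coeff_KW)
  qed
qed

lemma dehom_H: "lead_coeff (dehom H) = 1" "degree (dehom H) = N" "dehom H \<in> PS"
  and dehom_H_graded: "coeff (dehom H) j \<noteq> 0 \<Longrightarrow> int q dvd int N - int j"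
  and dehom_H_low: "coeff (dehom H) i0 \<noteq> 0"
proof -
  note K = KW_monic[OF F_monic degree_F]
  show d: "degree (dehom H) = N" using K(2) \<Lambda>k(2) unfolding KW_F by simp
  show "lead_coeff (dehom H) = 1" using K(1) \<Lambda>k(2) unfolding KW_F d by simp
  have "dehom H = smult (inverse (lam ^ N)) (KW (int N * u) F)" using \<Lambda>k(2) by (simp add: KW_F)
  then show "dehom H \<in> PS" using KW_PS[OF FW_F] \<Lambda>k(1) by (auto intro!: PS_smult inverse_mem power_mem)
  show "int q dvd int N - int j" if "coeff (dehom H) j \<noteq> 0"
  proof -
    have "coeff (KW (int N * u) F) j \<noteq> 0" using that \<Lambda>k(2) by (simp add: KW_F)
    then have "int q dvd int N * u - int j * u" by (rule coeff_KW_dvd)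
    \<comment> \<open>u is congruent to m modulo q, and m is prime to q.\<close>
    then have "int q dvd (int N - int j) * int m + int q * ((int N - int j) * v)"
      by (simp add: u_def algebra_simps)
    then have "int q dvd (int N - int j) * int m" by (metis dvd_add_left_iff dvd_triv_left)
    moreover have "coprime (int q) (int m)" using qm(3) by simp
    ultimately show ?thesis by (simp add: coprime_dvd_mult_left_iff)
  qed
  have "i0 \<in> I" using low(2) E_W by blast
  then show "coeff (dehom H) i0 \<noteq> 0"
    using I_facts(5) \<Lambda>k(2) by (simp add: coeff_dehom coeff_H poly_monom)
qed

text \<open>In the first alternative the powers of x are restored by weighted homogeneity, which
  would exhibit edge data. The second one is lifted to F by \<open>hensel\<close>.\<close>

theorem reducible_if_not_degenerated:
  assumes "\<not> degenerated S H"
  shows "\<exists>G1 G2. lead_coeff G1 = 1 \<and> lead_coeff G2 = 1 \<and> degree G1 > 0 \<and> degree G2 > 0 \<and> F = G1 * G2"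
  using edge_alternatives[OF dehom_H(3,1,2) qm(1) dehom_H_graded low(1) dehom_H_low]
proof
  assume "\<exists>P n. irreducible_over S P \<and> lead_coeff P = 1 \<and> dehom H = pcompose P (monom 1 q) ^ n"
  then obtain P n where P: "irreducible_over S P" "lead_coeff P = 1" "dehom H = pcompose P (monom 1 q) ^ n"
    by blast
  have nz: "pcompose P (monom 1 q) \<noteq> 0"
    using P(2) qm(1) pcompose_eq_0[of P "monom 1 q"] by (auto simp: Polynomial.degree_monom_eq)
  have N: "N = n * (q * degree P)"
    using dehom_H(2) nz unfolding P(3)
    by (simp add: degree_power_eq degree_pcompose Polynomial.degree_monom_eq mult.commute)
  have "H = quasi_homogenize q m P ^ n"
  proof (rule weighted_hom_eqI[OF weighted_H _ _ qm(1)])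
    have "weighted_hom q m (n * (q * m * degree P)) (quasi_homogenize q m P ^ n)"
      by (rule weighted_hom_power[OF weighted_hom_quasi_homogenize[OF qm(1)]])
    then show "weighted_hom q m (m * N) (quasi_homogenize q m P ^ n)" by (simp add: N mult_ac)
    show "dehom H = dehom (quasi_homogenize q m P ^ n)"
      using qm(1) by (simp add: dehom_power dehom_quasi_homogenize P(3))
  qed
  then have "edge_data S H q m P n" using P qm by (simp add: edge_data_def)
  then show ?thesis using assms by (auto simp: degenerated_def)
next
  assume "\<exists>A\<in>PS. \<exists>B\<in>PS. lead_coeff A = 1 \<and> lead_coeff B = 1 \<and> degree A > 0 \<and> degree B > 0 \<and> dehom H = A * B \<and>
      (\<forall>j. coeff A j \<noteq> 0 \<longrightarrow> int q dvd int (degree A) - int j) \<and>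
      (\<forall>j. coeff B j \<noteq> 0 \<longrightarrow> int q dvd int (degree B) - int j) \<and>
      (\<exists>x\<in>PS. \<exists>y\<in>PS. x * A + y * B = 1)"
  then obtain A B x y where A: "A \<in> PS" "lead_coeff A = 1" "degree A > 0"
      "\<And>j. coeff A j \<noteq> 0 \<Longrightarrow> int q dvd int (degree A) - int j"
    and B: "B \<in> PS" "lead_coeff B = 1" "degree B > 0"
      "\<And>j. coeff B j \<noteq> 0 \<Longrightarrow> int q dvd int (degree B) - int j"
    and AB: "dehom H = A * B" and xy: "x \<in> PS" "y \<in> PS" "x * A + y * B = 1" by blast
  define n1 where "n1 = degree A"
  define n2 where "n2 = degree B"
  have "A \<noteq> 0" "B \<noteq> 0" using A B by auto
  then have N: "N = n1 + n2" using dehom_H(2) by (simp add: AB degree_mult_eq n1_def n2_def)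
  let ?s = "\<lambda>n p. smult (lam ^ n) p" and ?t = "\<lambda>n p. smult (inverse (lam ^ n)) p"
  have "\<exists>G1 G2. lead_coeff G1 = 1 \<and> lead_coeff G2 = 1 \<and> degree G1 = n1 * degree \<psi> \<and>
      degree G2 = n2 * degree \<psi> \<and> F = G1 * G2"
  \<comment> \<open>Initial forms of monic polynomials have leading coefficient a power of
    \<open>lam\<close>, so the monic factors are rescaled, and the cofactors by the inverse
    powers.\<close>
  proof (rule hensel[of F n1 n2 "?s n1 A" "?s n2 B" "?t n1 x" "?t n2 y"])
    show "lead_coeff F = 1" "degree F = (n1 + n2) * degree \<psi>" "FW (int (n1 + n2) * u) F"
      using F_monic degree_F FW_F by (simp_all only: N)
    show "KW (int (n1 + n2) * u) F = ?s n1 A * ?s n2 B"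
      using KW_F by (simp add: AB power_add mult.commute flip: N) (simp add: N power_add mult.commute)
    show "?s n1 A \<in> PS" "?s n2 B \<in> PS" using A B \<Lambda>k by (auto intro!: PS_smult power_mem)
    show "degree (?s n1 A) = n1" "degree (?s n2 B) = n2" using \<Lambda>k by (simp_all add: n1_def n2_def)
    show "n1 > 0" "n2 > 0" using A B by (simp_all add: n1_def n2_def)
    show "coeff (?s n1 A) n1 = lam ^ n1" "coeff (?s n2 B) n2 = lam ^ n2" using A B by (simp_all add: n1_def n2_def)
    show "?t n1 x \<in> PS" "?t n2 y \<in> PS" using xy \<Lambda>k by (auto intro!: PS_smult inverse_mem power_mem)
    show "?t n1 x * ?s n1 A + ?t n2 y * ?s n2 B = 1" using xy(3) \<Lambda>k(2) by simp
    show "int q dvd int n1 * u - int j * u" if "coeff (?s n1 A) j \<noteq> 0" for j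
      using A(4)[of j] that by (simp add: n1_def flip: left_diff_distrib)
    show "int q dvd int n2 * u - int j * u" if "coeff (?s n2 B) j \<noteq> 0" for j
      using B(4)[of j] that by (simp add: n2_def flip: left_diff_distrib)
  qed
  then show ?thesis using A B degree_pos by (metis n1_def n2_def nat_0_less_mult_iff)
qed

text \<open>Two monomials of H fix the slope, which forces q' = q and m' = m. P(0) = 0 would give P
  = Z and a single monomial, although i0 < N occurs. If q deg P = 1, then P(Y) and Y would both be
  approximate N-th roots of H(1, Y), whose coefficient at Y^(N-1) vanishes; so P would be Z.\<close>

theorem edge_data_facts:
  assumes "edge_data S H q' m' P N'"
  shows "q' = q" "m' = m" "irreducible_over S P" "lead_coeff P = 1" "poly P 0 \<noteq> 0"
    "dehom H = pcompose P (monom 1 q) ^ N'" "N = q * degree P * N'" "N' > 0" "N' < N"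
proof -
  have D: "q' > 0" "coprime q' m'" "lead_coeff P = 1" "irreducible_over S P" "H = quasi_homogenize q' m' P ^ N'"
    using assms by (auto simp: edge_data_def)
  show "irreducible_over S P" "lead_coeff P = 1" using D by auto
  have dP: "degree P > 0" using D(4) by (simp add: irreducible_over_def)
  define c where "c = N' * (q' * m' * degree P)"
  have wh: "weighted_hom q' m' c H"
    unfolding D(5) c_def by (rule weighted_hom_power[OF weighted_hom_quasi_homogenize[OF D(1)]])
  have nonz: "coeff (coeff H i) (nat (W i)) \<noteq> 0" if "i \<in> I" for i
    using I_facts(5)[OF that] that \<Lambda>k(2) by (simp add: coeff_H)
  have NI: "N \<in> I" "W N = 0" using edge(2) E_W by (auto simp: W_def)
  have i0I: "i0 \<in> I" using low(2) E_W by blast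
  have "m' * N = c" using wh nonz[OF NI(1)] NI(2) unfolding weighted_hom_def by fastforce
  moreover have "q' * nat (W i0) + m' * i0 = c" using wh nonz[OF i0I] unfolding weighted_hom_def by blast
  ultimately have e1: "q' * nat (W i0) + m' * i0 = m' * N" by simp
  have e2: "q * nat (W i0) + m * i0 = m * N"
    using weighted_H nonz[OF i0I] unfolding weighted_hom_def by blast
  define n where "n = N - i0"
  have n: "N = n + i0" "n > 0" using low(1) by (auto simp: n_def)
  have "q' * nat (W i0) = m' * n" "q * nat (W i0) = m * n" using e1 e2 by (simp_all add: n algebra_simps)
  then have "q * (m' * n) = q' * (m * n)" by (metis mult.left_commute)
  then have "q * m' = q' * m" using n(2) by (metis mult.assoc mult_cancel2 not_less_zero)
  then have "q = q' \<and> m = m'"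
    using coprime_crossproduct_nat[OF qm(3) D(2)] by auto
  then show qq: "q' = q" and mm: "m' = m" by auto
  show dh: "dehom H = pcompose P (monom 1 q) ^ N'"
    unfolding D(5) using D(1) by (simp add: dehom_power dehom_quasi_homogenize qq)
  have lP: "lead_coeff (pcompose P (monom 1 q)) = 1" and deg: "degree (pcompose P (monom 1 q)) = q * degree P"
    using D(3) qm(1) by (simp_all add: degree_pcompose Polynomial.degree_monom_eq coeff_pcompose_monom mult.commute)
  then have nz: "pcompose P (monom 1 q) \<noteq> 0" by auto
  show N: "N = q * degree P * N'"
    using dehom_H(2) unfolding dh by (simp add: degree_power_eq[OF nz] deg mult.commute)
  show N'pos: "N' > 0" using N N1 by (cases N') auto
  show P0: "poly P 0 \<noteq> 0"
  proof
    assume "poly P 0 = 0"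
    then have "P = [:0, 1:]" by (rule irreducible_root_0[OF D(4,3)])
    then have "dehom H = monom 1 (q * N')" unfolding dh by (simp add: pcompose_pCons monom_power)
    then show False using dehom_H_low low(1) dehom_H(2)
      by (auto simp: Polynomial.degree_monom_eq split: if_splits)
  qed
  have "q * degree P \<noteq> 1"
  proof
    assume one: "q * degree P = 1"
    then have q1: "q = 1" and NN: "N' = N" using N by auto
    \<comment> \<open>The defining property of the approximate root: F and \<open>\<psi> ^ N\<close>
      differ only in digits of index below N - 1.\<close>
    have "dig (N - 1) F = 0"
    proof -
      have "dig (N - 1) (\<psi> ^ N) = 0" using dig_monomial[of 1 "N - 1" N] degree_pos N1 by simp
      moreover have "dig (N - 1) (F - \<psi> ^ N) = 0"
      proof (cases "F = \<psi> ^ N")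
        case False
        have "degree F - degree F div N = (N - 1) * degree \<psi>"
          using degree_F N1 diff_div_eq[of N "degree \<psi>"] by simp
        then have "degree (F - \<psi> ^ N) < (N - 1) * degree \<psi>" using approx False by (auto simp: is_approx_root_def)
        then show ?thesis by (rule dig_eq_0)
      qed simp
      ultimately show ?thesis by (metis dig_diff diff_self dig_add diff_add_cancel add_0)
    qed
    then have c0: "coeff (dehom H) (N - 1) = 0" using \<Lambda>k(2) arg_cong[OF KW_F, of "\<lambda>p. coeff p (N - 1)"]
      by (simp add: coeff_KW)
    have X: "lead_coeff [:0, 1 :: 'e:] = 1" "degree [:0, 1 :: 'e:] = 1" by simp_all
    have Y: "lead_coeff (pcompose P (monom 1 q)) = 1" "degree (pcompose P (monom 1 q)) = 1" using lP deg one by simp_all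
    have "dehom H = [:0, 1:] ^ N \<or> degree (dehom H - [:0, 1:] ^ N) < (N - 1) * 1"
    proof (cases "N = 1")
      case False
      let ?d = "dehom H - [:0, 1:] ^ N"
      have "coeff ?d i = 0" if "i \<ge> N - 1" for i
      proof -
        have "i = N - 1 \<or> i = N \<or> i > N" using that by linarith
        moreover have "[:0, 1:] ^ N = monom (1::'e) N" by (simp add: monom_altdef)
        ultimately show ?thesis using c0 dehom_H(1,2) N1 by (elim disjE) (simp_all add: coeff_eq_0)
      qed
      then have "?d = 0 \<or> degree ?d < N - 1" by (metis leading_coeff_0_iff not_le)
      then show ?thesis by auto
    qed (use N1 in simp)
    moreover have "dehom H = pcompose P (monom 1 q) ^ N \<or> degree (dehom H - pcompose P (monom 1 q) ^ N) < (N - 1) * 1"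
      using dh NN by simp
    moreover have "of_nat N \<noteq> (0::'e)"
    proof -
      have "of_nat N \<noteq> (0::'a)" using char_ok[of N] N1 degree_F degree_pos by simp
      then show ?thesis using h_of_nat[of N] by (metis h_eq_0)
    qed
    ultimately have "[:0, 1:] = pcompose P (monom 1 q)" by (intro power_near_unique[OF X _ Y])
    then have "poly (pcompose P (monom 1 q)) 0 = poly [:0, 1:] 0" by (simp only:)
    then have "poly P 0 = 0" using qm(1) by (simp add: poly_pcompose poly_monom power_0_left)
    then show False using P0 by simp
  qed
  moreover have "q * degree P > 0" using qm(1) dP by simp
  ultimately have "q * degree P > 1" by linarith
  then show "N' < N" using N N'pos by simp
qed

end

section \<open>Transfer of the invariant to the next round\<close>

lemma cf_cong_psi: "(\<And>i. i < k \<Longrightarrow> \<Psi> (int i) = \<Psi>' (int i)) \<Longrightarrow> cf k \<Psi> G B = cf k \<Psi>' G B"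
  by (induction k arbitrary: G) simp_all

lemma represents_cong:
  assumes "\<And>i. i < k \<Longrightarrow> \<Psi> (int i) = \<Psi>' (int i)"
  shows "represents h k \<Psi> V \<Lambda> Fil \<kappa> G \<longleftrightarrow> represents h k \<Psi>' V \<Lambda> Fil \<kappa> G"
proof -
  have "cf k \<Psi> G = cf k \<Psi>' G" by (intro ext cf_cong_psi assms)
  then show ?thesis unfolding represents_def terms_at_def by simp
qed

lemma psi_chain_cong:
  assumes "\<Psi> (-1) = \<Psi>' (-1)" "\<And>i. i \<le> k \<Longrightarrow> \<Psi> (int i) = \<Psi>' (int i)"
    "\<And>i. i < k \<Longrightarrow> q (int (Suc i)) = q' (int (Suc i)) \<and> l (int (Suc i)) = l' (int (Suc i))"
  shows "psi_chain k q l \<Psi> \<longleftrightarrow> psi_chain k q' l' \<Psi>'"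
proof -
  have 1: "\<Psi> 0 = \<Psi>' 0" using assms(2)[of 0] by simp
  have 2: "\<Psi> (int (Suc i)) = \<Psi>' (int (Suc i))" if "i < k" for i using assms(2)[of "Suc i"] that by simp
  show ?thesis unfolding psi_chain_def using assms 1 2 by (metis less_imp_le)
qed

lemma irr_roundI:
  fixes qs ls :: "int \<Rightarrow> nat"
  assumes "field_emb h" "key_level (\<Psi> (int k)) S (int (V (int k))) Fil \<kappa>" "psi_chain k qs ls \<Psi>"
    and "\<And>G. degree G < degree (\<Psi> (int k)) \<Longrightarrow> represents h k \<Psi> V \<Lambda> Fil \<kappa> G"
    and "\<Lambda> (int k) \<in> S" "\<Lambda> (int k) \<noteq> 0" "lead_coeff F = 1" "is_approx_root N F (\<Psi> (int k))"
    and "\<And>j. j < N \<Longrightarrow> Fil (int (N - j) * int (V (int k)) + 1) (monic_poly.dig (\<Psi> (int k)) j F)"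
    and "\<And>G H. lead_coeff G = 1 \<Longrightarrow> F = G * H \<Longrightarrow> degree (\<Psi> (int k)) dvd degree G"
    and "\<And>i. 0 < i \<Longrightarrow> i \<le> degree F \<Longrightarrow> of_nat i \<noteq> (0::'a)"
  shows "irr_round (h :: 'a::field \<Rightarrow> 'e::field) \<Psi> k S V Fil \<kappa> \<Lambda> qs ls F N"
proof -
  interpret field_emb h by (rule assms(1))
  interpret key_level "\<Psi> (int k)" S "int (V (int k))" Fil \<kappa> by (rule assms(2))
  have "near N F"
    using assms(7,9) approx_root_degree[OF assms(8)] by (simp add: near_def)
  then show ?thesis using assms by unfold_locales auto
qed

context irr_round_slope
begin

text \<open>The current edge instantiates \<open>key_edge\<close> and \<open>key_step\<close>, which
  supply the new filtration, the bound on the digits and the divisibility of degrees. What remains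
  is that the new \<lambda>_(k+1,k+1) is a nonzero element of S'.\<close>

theorem next_round:
  assumes ed: "edge_data S H q' m' P N'" and quot: "is_quotient_field S P z S'"
    and st: "int q' * s - int m' * t = 1" and \<zeta>: "\<zeta> ^ q' = z" and \<psi>': "is_approx_root N' F \<psi>'"
    and \<Psi>2: "\<Psi>2 (-1) = \<Psi> (-1)" "\<And>i. i \<le> k \<Longrightarrow> \<Psi>2 (int i) = \<Psi> (int i)" "\<Psi>2 (int (Suc k)) = \<psi>'"
  shows "\<exists>Fil2 \<kappa>2. irr_round h \<Psi>2 (Suc k) S' (update_vals k q' m' (degree P) V) Fil2 \<kappa>2
    (update_lams k q' P z s t V \<Lambda>) (qs(int (Suc k) := q')) (ls(int (Suc k) := degree P)) F N'"
proof -
  note facts = edge_data_facts[OF ed]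
  have st': "int q * s - int m * t = 1" and \<zeta>': "\<zeta> ^ q = z" using st \<zeta> facts(1,2) by auto
  have ok: "of_nat i \<noteq> (0::'a) \<and> of_nat i \<noteq> (0::'e)" if "0 < i" "i \<le> N" for i
  proof -
    have "N \<le> degree F" using degree_F degree_pos by simp
    then have "of_nat i \<noteq> (0::'a)" using char_ok that by simp
    then show ?thesis using h_of_nat[of i] by (metis h_eq_0)
  qed
  have dP: "degree P > 0" using facts(3) by (simp add: irreducible_over_def)
  have le: "N' \<le> N" "q \<le> N" "degree P \<le> N"
    using facts(7,8) qm(1) dP by auto
  interpret D: key_direction \<psi> S v Fil \<kappa> q m lam s t
    using st' by unfold_locales
  interpret Ed: key_edge \<psi> S v Fil \<kappa> q m lam s t F P N'
  proof unfold_locales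
    show "degree F = q * degree P * N' * degree \<psi>" using degree_F facts(7) by simp
    show "FW (int (q * degree P * N') * u) F" unfolding facts(7)[symmetric] by (rule FW_F)
    show "KW (int (q * degree P * N') * u) F = smult (lam ^ (q * degree P * N')) (pcompose P (monom 1 q) ^ N')"
      unfolding facts(7)[symmetric] facts(6)[symmetric] by (rule KW_F)
    show "of_nat N' \<noteq> (0::'a)" "of_nat N' \<noteq> (0::'e)" using ok facts(8) le by auto
  qed (use facts F_monic in auto)
  note qf = quotient_field_facts[OF facts(3) quot]
  have z: "z \<noteq> 0" using qf(4) facts(5) by auto
  interpret St: key_step \<psi> S v Fil \<kappa> q m lam s t \<psi>' P z \<zeta> S'
  proof unfold_locales
    show "lead_coeff \<psi>' = 1" by (rule Ed.approx_root_lead[OF \<psi>'])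
    show "degree \<psi>' = q * degree P * degree \<psi>" by (rule Ed.approx_root_degree'[OF \<psi>'])
    show "FW (int (q * degree P) * u) \<psi>'" by (rule Ed.approx_root_FW[OF \<psi>'])
    show "KW (int (q * degree P) * u) \<psi>' = smult (lam ^ (q * degree P)) (pcompose P (monom 1 q))"
      by (rule Ed.approx_root_KW[OF \<psi>'])
  qed (use facts quot \<zeta>' z in auto)
  interpret S': subfield_of S' using qf(1) by unfold_locales
  define V' where "V' = update_vals k q m (degree P) V"
  define \<Lambda>' where "\<Lambda>' = update_lams k q P z s t V \<Lambda>"
  have V'k: "int (V' (int (Suc k))) = int (q * degree P) * u"
    by (simp add: V'_def update_vals_def u_def)
  have mu: "lam * z powi (t * v + s) \<in> S'" "lam * z powi (t * v + s) \<noteq> 0"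
    using qf(2,3) \<Lambda>k z by (auto intro!: S'.mult_mem S'.powi_mem)
  \<comment> \<open>Separability: P' is nonzero because deg P is invertible, and it has smaller
    degree than P, which generates the polynomials vanishing at z.\<close>
  have pd: "poly (pderiv P) z \<noteq> 0" "poly (pderiv P) z \<in> S'"
  proof -
    have pS: "pderiv P \<in> PS" using facts(3) by (simp add: irreducible_over_def PS_pderiv)
    then show "poly (pderiv P) z \<in> S'" by (rule qf(7))
    have "coeff (pderiv P) (degree P - 1) = of_nat (degree P)"
      using dP facts(4) by (simp add: coeff_pderiv)
    then have nz: "pderiv P \<noteq> 0" using ok[OF dP le(3)] by auto
    show "poly (pderiv P) z \<noteq> 0"
    proof
      assume "poly (pderiv P) z = 0"
      then have "P dvd pderiv P" using qf(5) pS by blast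
      then have "degree P \<le> degree (pderiv P)" using nz by (rule dvd_imp_degree_le)
      moreover have "degree (pderiv P) \<le> degree P - 1"
        by (rule degree_le) (use dP in \<open>auto simp: coeff_pderiv coeff_eq_0\<close>)
      ultimately show False using dP by simp
    qed
  qed
  have \<Lambda>'k: "\<Lambda>' (int (Suc k)) = of_nat q * z powi (1 - s - int (degree P)) * poly (pderiv P) z *
      (lam * z powi (t * v + s)) ^ (q * degree P)"
    by (simp add: \<Lambda>'_def update_lams_def Let_def)
  have "irr_round h \<Psi>2 (Suc k) S' V' FW St.\<kappa>' \<Lambda>' (qs(int (Suc k) := q)) (ls(int (Suc k) := degree P)) F N'"
  proof (rule irr_roundI)
    show "field_emb h" by unfold_locales
    show "key_level (\<Psi>2 (int (Suc k))) S' (int (V' (int (Suc k)))) FW St.\<kappa>'"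
      unfolding \<Psi>2(3) V'k by (rule St.next_level)
    have "psi_chain k (qs(int (Suc k) := q)) (ls(int (Suc k) := degree P)) \<Psi>2"
    proof -
      have "psi_chain k qs ls \<Psi> \<longleftrightarrow> psi_chain k (qs(int (Suc k) := q)) (ls(int (Suc k) := degree P)) \<Psi>2"
        by (rule psi_chain_cong) (use \<Psi>2 in auto)
      then show ?thesis using chain by blast
    qed
    then show "psi_chain (Suc k) (qs(int (Suc k) := q)) (ls(int (Suc k) := degree P)) \<Psi>2"
      unfolding psi_chain_Suc using \<Psi>2(2)[of k] \<Psi>2(3) St.\<psi>'(1,2) qm(1) dP by simp
    show "represents h (Suc k) \<Psi>2 V' \<Lambda>' FW St.\<kappa>' G" for G
    proof -
      have cong: "\<Psi>2 (int i) = \<Psi> (int i)" if "i < Suc k" for i using \<Psi>2(2) that by simp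
      have "represents h (Suc k) \<Psi> V' \<Lambda>' FW St.\<kappa>' G"
        unfolding V'_def \<Lambda>'_def by (rule St.represents_next[OF refl refl refl h_0 rep])
      then show ?thesis using represents_cong[where k = "Suc k" and \<Psi> = \<Psi>2 and \<Psi>' = \<Psi>] cong by blast
    qed
    show "\<Lambda>' (int (Suc k)) \<in> S'"
      unfolding \<Lambda>'k using pd qf(2,3) \<Lambda>k by (auto intro!: S'.mult_mem S'.power_mem S'.of_nat_mem S'.powi_mem)
    show "\<Lambda>' (int (Suc k)) \<noteq> 0"
      unfolding \<Lambda>'k using mu pd z ok[OF qm(1) le(2)] by simp
    show "lead_coeff F = 1" by (rule F_monic)
    show "is_approx_root N' F (\<Psi>2 (int (Suc k)))" using \<psi>' \<Psi>2(3) by simp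
    show "FW (int (N' - j) * int (V' (int (Suc k))) + 1) (monic_poly.dig (\<Psi>2 (int (Suc k))) j F)" if "j < N'" for j
      unfolding V'k \<Psi>2(3) by (rule Ed.near_next[OF \<psi>' that])
    show "degree (\<Psi>2 (int (Suc k))) dvd degree G" if G: "lead_coeff G = 1" "F = G * H'" for G H'
    proof -
      have H1: "lead_coeff H' = 1" using F_monic G by (metis monic_mult_cancel)
      have "degree \<psi> dvd degree G" by (rule factor_dvd[OF G])
      then obtain n where n: "degree G = n * degree \<psi>" by (metis dvd_def mult.commute)
      have "degree \<psi> dvd degree H'" by (rule factor_dvd[OF H1, of G]) (simp add: G(2) mult.commute)
      then obtain n' where n': "degree H' = n' * degree \<psi>" by (metis dvd_def mult.commute)
      show ?thesis unfolding \<Psi>2(3) St.\<psi>'(2) by (rule Ed.factor_degree[OF G(1) n H1 n' G(2)])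
    qed
    show "of_nat i \<noteq> (0::'a)" if "0 < i" "i \<le> degree F" for i using char_ok that by blast
  qed
  then show ?thesis unfolding V'_def \<Lambda>'_def facts(1,2) by blast
qed

end

lemma irr_round_slope_exists:
  fixes qs ls :: "int \<Rightarrow> nat"
  assumes "irr_round_edge h \<Psi> k S V Fil \<kappa> \<Lambda> qs ls F N f H E"
  shows "\<exists>q m i0 w0. irr_round_slope h \<Psi> k S V Fil \<kappa> \<Lambda> qs ls F N f H E q m i0 w0"
proof -
  interpret irr_round_edge h \<Psi> k S V Fil \<kappa> \<Lambda> qs ls F N f H E by (rule assms)
  obtain q m i0 w0 where "q > 0" "m > 0" "coprime q m"
    "\<And>i w. (i, w) \<in> polygon_points k N V f \<Longrightarrow> int m * (int N - int i) \<le> int q * w"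
    "E = {(i, w) \<in> polygon_points k N V f. int q * w = int m * (int N - int i)}"
    "i0 < N" "(i0, w0) \<in> E" by (rule edge_slope) blast
  then have "irr_round_slope h \<Psi> k S V Fil \<kappa> \<Lambda> qs ls F N f H E q m i0 w0"
    by unfold_locales
  then show ?thesis by blast
qed

text \<open>The leading coefficients of two factors of a monic polynomial are inverse units;
  multiplying each factor by the leading coefficient of the other makes both monic.\<close>

lemma monic_irreducible_iff:
  fixes F :: "'b::idom poly"
  assumes F: "lead_coeff F = 1" "degree F > 0"
  shows "irreducible F \<longleftrightarrow> \<not> (\<exists>G H. lead_coeff G = 1 \<and> lead_coeff H = 1 \<and> degree G > 0 \<and> degree H > 0 \<and> F = G * H)"
proof
  assume irr: "irreducible F"
  show "\<not> (\<exists>G H. lead_coeff G = 1 \<and> lead_coeff H = 1 \<and> degree G > 0 \<and> degree H > 0 \<and> F = G * H)"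
  proof
    assume "\<exists>G H. lead_coeff G = 1 \<and> lead_coeff H = 1 \<and> degree G > 0 \<and> degree H > 0 \<and> F = G * H"
    then obtain G H where GH: "degree G > 0" "degree H > 0" "F = G * H" by blast
    then have "G dvd 1 \<or> H dvd 1" using irreducibleD[OF irr GH(3)] by simp
    then show False using GH by (auto simp: is_unit_poly_iff)
  qed
next
  assume none: "\<not> (\<exists>G H. lead_coeff G = 1 \<and> lead_coeff H = 1 \<and> degree G > 0 \<and> degree H > 0 \<and> F = G * H)"
  show "irreducible F"
  proof (rule irreducibleI)
    show "F \<noteq> 0" using F by auto
    show "\<not> F dvd 1" using F(2) by (auto simp: is_unit_poly_iff)
    fix A B assume AB: "F = A * B"
    have l: "lead_coeff A * lead_coeff B = 1" using F(1) by (simp only: AB lead_coeff_mult)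
    define G where "G = smult (lead_coeff B) A"
    define H where "H = smult (lead_coeff A) B"
    have nz: "lead_coeff A \<noteq> 0" "lead_coeff B \<noteq> 0" using l by auto
    have "lead_coeff G = 1" "lead_coeff H = 1"
      using l by (simp_all only: G_def H_def lead_coeff_smult mult.commute)
    moreover have "F = G * H" using l by (simp add: G_def H_def AB mult.commute)
    ultimately have "degree G = 0 \<or> degree H = 0" using none by (metis gr0I)
    then have "degree A = 0 \<or> degree B = 0" using nz by (simp add: G_def H_def)
    moreover have "p dvd 1" if "degree p = 0" "lead_coeff p dvd 1" for p :: "'b poly"
      using that by (metis degree_eq_zeroE is_unit_poly_iff lead_coeff_pCons(2))
    moreover have "lead_coeff A dvd 1" "lead_coeff B dvd 1" using l by (metis dvd_triv_left dvd_triv_right)+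
    ultimately show "A dvd 1 \<or> B dvd 1" by blast
  qed
qed

section \<open>Base change\<close>

context field_emb
begin

definition fext :: "'a fps \<Rightarrow> 'e fps" where
  "fext c = Abs_fps (\<lambda>n. h (fps_nth c n))"

abbreviation ext :: "'a fps poly \<Rightarrow> 'e fps poly" where
  "ext \<equiv> extend_scalars h"

lemma nth_fext [simp]: "fps_nth (fext c) n = h (fps_nth c n)"
  by (simp add: fext_def)

lemma fext_simps [simp]:
  "fext 0 = 0" "fext 1 = 1" "fext (a + b) = fext a + fext b" "fext (a - b) = fext a - fext b"
  "fext (a * b) = fext a * fext b" "fext a = 0 \<longleftrightarrow> a = 0" "fext fps_X = fps_X" "fext (fps_const x) = fps_const (h x)"
  by (auto simp: fps_eq_iff h_add h_diff h_1 fps_mult_nth h_sum h_mult fps_X_def fps_one_nth)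

lemma fext_inj: "fext a = fext b \<longleftrightarrow> a = b"
  by (simp add: fps_eq_iff h_inj)

lemma coeff_ext [simp]: "coeff (ext p) i = fext (coeff p i)"
proof -
  have "fext 0 = 0" by simp
  then show ?thesis unfolding extend_scalars_def fext_def by (intro coeff_map_poly) simp
qed

lemma fext_sum: "fext (sum f A) = (\<Sum>x\<in>A. fext (f x))"
  by (induction A rule: infinite_finite_induct) simp_all

lemma ext_simps [simp]:
  "ext 0 = 0" "ext 1 = 1" "ext (p + r) = ext p + ext r" "ext (p - r) = ext p - ext r"
  "ext (p * r) = ext p * ext r" "ext (smult c p) = smult (fext c) (ext p)" "ext [:c:] = [:fext c:]"
  by (auto simp: poly_eq_iff coeff_mult fext_sum coeff_pCons coeff_1 split: nat.split)

lemma ext_power [simp]: "ext (p ^ n) = ext p ^ n"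
  by (induction n) simp_all

lemma ext_sum: "ext (sum f A) = (\<Sum>x\<in>A. ext (f x))"
  by (induction A rule: infinite_finite_induct) simp_all

lemma ext_prod: "ext (prod f A) = (\<Prod>x\<in>A. ext (f x))"
  by (induction A rule: infinite_finite_induct) simp_all

lemma ext_inj: "ext p = ext r \<longleftrightarrow> p = r"
  by (simp add: poly_eq_iff fext_inj)

lemma degree_ext [simp]: "degree (ext p) = degree p"
proof (rule antisym)
  show "degree (ext p) \<le> degree p" by (rule degree_le) (simp add: coeff_eq_0)
  show "degree p \<le> degree (ext p)"
  proof (rule degree_le, intro allI impI)
    fix i assume "i > degree (ext p)"
    then have "fext (coeff p i) = 0" by (simp add: coeff_eq_0 flip: coeff_ext)
    then show "coeff p i = 0" by simp
  qed
qed

lemma lead_coeff_ext: "lead_coeff (ext p) = 1 \<longleftrightarrow> lead_coeff p = 1"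
  using fext_inj[of "lead_coeff p" 1] by simp

lemma X_power_dvd_ext: "[:fps_X ^ n:] dvd p \<Longrightarrow> [:fps_X ^ n:] dvd ext p"
  by (simp add: X_power_dvd_poly_iff)

lemma is_approx_root_ext: "is_approx_root N F \<psi> \<Longrightarrow> is_approx_root N (ext F) (ext \<psi>)"
  using degree_ext[of "F - \<psi> ^ N"] lead_coeff_ext[of \<psi>] by (auto simp: is_approx_root_def)

text \<open>The algorithm expands F over K, whereas the valuations are taken over L. Injectivity of
  h preserves the set of exponents that occur.\<close>

lemma is_adic_expansion_ext:
  assumes "is_adic_expansion k q l \<Psi> F f"
  shows "is_adic_expansion k q l (\<lambda>i. ext (\<Psi> i)) (ext F) (\<lambda>B. h (f B))"
  unfolding is_adic_expansion_def
proof (intro conjI allI impI)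
  show "h (f B) \<noteq> 0 \<Longrightarrow> B \<in> admissible_exponents k q l" for B
    using assms by (auto simp: is_adic_expansion_def)
  fix n
  show "finite {B. h (f B) \<noteq> 0 \<and> B (-1) < n}" using assms by (simp add: is_adic_expansion_def)
  have "[:fps_X ^ n:] dvd ext (F - (\<Sum>B | f B \<noteq> 0 \<and> B (-1) < n. smult (fps_const (f B)) (multi_power k \<Psi> B)))"
    using assms by (intro X_power_dvd_ext) (simp add: is_adic_expansion_def)
  then show "[:fps_X ^ n:] dvd ext F -
      (\<Sum>B | h (f B) \<noteq> 0 \<and> B (-1) < n. smult (fps_const (h (f B))) (multi_power k (\<lambda>i. ext (\<Psi> i)) B))"
    by (simp add: ext_sum multi_power_def ext_prod)
qed

lemma polygon_points_ext: "polygon_points k N V (\<lambda>B. h (f B)) = polygon_points k N V f"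
  by (simp add: polygon_points_def ordinate_def)

lemma edge_polynomial_ext:
  "edge_polynomial (\<lambda>a. g (h a)) k N V \<Lambda> f E = edge_polynomial g k N V \<Lambda> (\<lambda>B. h (f B)) E"
  by (simp add: edge_polynomial_def)

lemma psi_chain_ext: "psi_chain k q l (\<lambda>i. ext (\<Psi> i)) \<longleftrightarrow> psi_chain k q l \<Psi>"
  using ext_inj[of "\<Psi> (-1)" "[:fps_X:]"] lead_coeff_ext by (simp add: psi_chain_def)

end

section \<open>The initial state\<close>

definition red :: "'a::field fps poly \<Rightarrow> 'a poly" where
  "red p = map_poly (\<lambda>c. fps_nth c 0) p"

lemma coeff_red: "coeff (red p) i = fps_nth (coeff p i) 0"
  by (simp add: red_def coeff_map_poly)

lemma red_simps: "red (p - r) = red p - red r" "red (p * r) = red p * red r" "red 1 = 1" "red 0 = 0"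
  "red (p + r) = red p + red r"
  by (auto simp: poly_eq_iff coeff_red coeff_mult fps_sum_nth fps_mult_nth coeff_1)

lemma red_power: "red (p ^ n) = red p ^ n"
  by (induction n) (simp_all add: red_simps)

lemma red_sum: "red (sum f A) = (\<Sum>x\<in>A. red (f x))"
  by (induction A rule: infinite_finite_induct) (simp_all add: red_simps)

lemma degree_red: "degree (red p) \<le> degree p"
  by (rule degree_le) (simp add: coeff_red coeff_eq_0)

text \<open>At x = 0, F becomes Y^d. The reduction of \<psi> is an approximate d-th root of it,
  hence Y, and reducing the \<psi>-adic expansion shows that the digits below d vanish at x = 0.
  With v = 0 this is the condition \<open>near\<close> of the initial state.\<close>

lemma weierstrass_digits:
  fixes F :: "'a::field fps poly"
  assumes F: "weierstrass F" "degree F = d" "d > 0" "of_nat d \<noteq> (0::'a)"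
    and \<psi>: "is_approx_root d F \<psi>" and j: "j < d"
  shows "Fil0 1 (monic_poly.dig \<psi> j F)"
proof -
  have \<psi>': "lead_coeff \<psi> = 1" "degree \<psi> = 1" using \<psi> F by (auto simp: is_approx_root_def)
  interpret monic_poly \<psi> using \<psi>' by unfold_locales auto
  have redF: "red F = [:0, 1:] ^ d"
  proof -
    have "red F = monom 1 d"
    proof (rule poly_eqI)
      fix i
      show "coeff (red F) i = coeff (monom 1 d) i"
        using F by (cases i d rule: linorder_cases) (auto simp: coeff_red weierstrass_def coeff_eq_0)
    qed
    then show ?thesis by (simp add: monom_altdef)
  qed
  have c1: "coeff (red \<psi>) 1 = 1" using \<psi>' by (simp add: coeff_red)
  then have r\<psi>: "degree (red \<psi>) = 1" using degree_red[of \<psi>] \<psi>' le_degree[of "red \<psi>" 1] by simp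
  have "red F = red \<psi> ^ d \<or> degree (red F - red \<psi> ^ d) < (d - 1) * 1"
  proof (cases "F = \<psi> ^ d")
    case False
    then have "degree (F - \<psi> ^ d) < d - 1" using \<psi> F by (simp add: is_approx_root_def)
    then have "degree (red (F - \<psi> ^ d)) < d - 1" using degree_red le_less_trans by blast
    then show ?thesis by (simp add: red_simps red_power)
  qed (simp add: red_power)
  then have eq: "red \<psi> = [:0, 1:]"
    using c1 r\<psi> redF by (intro power_near_unique[of "red \<psi>" 1 "red F" d "[:0, 1:]"] F(4)) auto
  have "degree F < Suc d * degree \<psi>" using F \<psi>' by simp
  then have "F = (\<Sum>j<Suc d. dig j F * \<psi> ^ j)" by (rule dig_expansion)
  from arg_cong[OF this, of red] have "red F = (\<Sum>j<Suc d. red (dig j F) * monom 1 j)"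
    by (simp add: red_sum red_simps red_power eq monom_altdef del: sum.lessThan_Suc)
  moreover have "red (dig j F) = [:fps_nth (coeff (dig j F) 0) 0:]" for j
  proof -
    have "degree (red (dig j F)) = 0" using degree_red[of "dig j F"] degree_dig[of j F] \<psi>' by simp
    then show ?thesis by (metis degree_0_id coeff_red)
  qed
  ultimately have "red F = (\<Sum>j<Suc d. monom (fps_nth (coeff (dig j F) 0) 0) j)"
    by (simp add: smult_monom del: sum.lessThan_Suc)
  then have "coeff (red F) j = fps_nth (coeff (dig j F) 0) 0"
    using j by (simp add: coeff_sum del: sum.lessThan_Suc)
  moreover have "coeff (red F) j = 0" using redF j by (simp flip: monom_altdef[of 1, simplified])
  ultimately show ?thesis unfolding Fil0_def by (metis int_one_le_iff_zero_less not_gr_zero of_nat_0_less_iff)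
qed

section \<open>Correctness of the algorithm\<close>

lemma bezout_normalized:
  fixes q m :: nat
  assumes "coprime q m" "q > 0"
  shows "\<exists>s t. int q * s - int m * t = 1 \<and> 0 \<le> t \<and> t < int q"
proof -
  obtain x y where xy: "x * int q + y * int m = 1"
    using bezout_int[of "int q" "int m"] assms(1) by auto
  define t where "t = (- y) mod int q"
  have t: "0 \<le> t" "t < int q" using assms(2) by (simp_all add: t_def)
  have "1 + int m * t = int q * (x - int m * ((- y) div int q))"
  proof -
    have "t = - y - int q * ((- y) div int q)" unfolding t_def by (simp add: minus_mult_div_eq_mod)
    then have "1 + int m * t = (x * int q + y * int m) + int m * (- y - int q * ((- y) div int q))"
      by (simp only: xy)
    then show ?thesis by (simp add: algebra_simps)
  qed
  then have "int q * (x - int m * ((- y) div int q)) - int m * t = 1" by simp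
  then show ?thesis using t by blast
qed

lemma to_ac_embedding: "field_embedding (to_ac :: 'l::field \<Rightarrow> 'l alg_closure)"
  by (simp add: field_embedding_def)

section \<open>The loop invariant and the runs of the algorithm\<close>

locale irr_setup = field_emb \<iota> for \<iota> :: "'k::field \<Rightarrow> 'l::field" +
  fixes F :: "'k fps poly"
  assumes weier: "weierstrass F" and degree_ge: "degree F \<ge> 1"
    and char_cond: "CHAR('k) = 0 \<or> CHAR('k) > degree F" and sqfree: "squarefree F"
begin

definition emb :: "'k \<Rightarrow> 'l alg_closure" where "emb = (\<lambda>a. to_ac (\<iota> a))"

lemma char_okK: "0 < i \<Longrightarrow> i \<le> degree F \<Longrightarrow> of_nat i \<noteq> (0::'k)"
  using char_cond by (auto simp: of_nat_eq_0_iff_char_dvd dest: dvd_imp_le)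

lemma char_okL: "0 < i \<Longrightarrow> i \<le> degree (ext F) \<Longrightarrow> of_nat i \<noteq> (0::'l)"
  using char_okK[of i] h_of_nat[of i] h_eq_0 by (metis degree_ext)

lemma F_monic: "lead_coeff F = 1"
  using weier by (simp add: weierstrass_def)

lemma weier_ext: "weierstrass (ext F)"
  using weier lead_coeff_ext[of F] by (simp add: weierstrass_def)

text \<open>The state keeps its \<psi>_i over K; they are extended to L, and \<open>to_ac\<close>
  places the residue fields in the algebraic closure of L.\<close>

definition state_round ::
    "('k, 'l alg_closure) irr_state \<Rightarrow> 'k fps poly \<Rightarrow> (int \<Rightarrow> 'l fps poly \<Rightarrow> bool) \<Rightarrow>
     (int \<Rightarrow> 'l fps poly \<Rightarrow> 'l alg_closure) \<Rightarrow> bool" where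
  "state_round st \<psi> Fil \<kappa> \<longleftrightarrow> irr_round to_ac (\<lambda>i. ext (((psis st)(int (rank st) := \<psi>)) i)) (rank st) (fld st)
     (vals st) Fil \<kappa> (lams st) (qs st) (ells st) (ext F) (mult st)"

text \<open>A state does not yet contain its own \<psi>_k, so the invariant is asserted for every
  approximate root the round may take.\<close>

definition state_ok :: "('k, 'l alg_closure) irr_state \<Rightarrow> bool" where
  "state_ok st \<longleftrightarrow> mult st > 0 \<and> mult st dvd degree F \<and>
    (\<forall>\<psi>. is_approx_root (mult st) F \<psi> \<longrightarrow> (\<exists>Fil \<kappa>. state_round st \<psi> Fil \<kappa>))"

lemma initial_state_ok: "state_ok (initial_state (degree F) (range to_ac))"
proof -
  let ?st = "initial_state (degree F) (range to_ac) :: ('k, 'l alg_closure) irr_state"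
  interpret ac: field_emb "to_ac :: 'l \<Rightarrow> 'l alg_closure" by unfold_locales (rule to_ac_embedding)
  have "state_round ?st \<psi> Fil0 (\<kappa>0 to_ac)" if a: "is_approx_root (degree F) F \<psi>" for \<psi>
  proof -
    define \<Psi> where "\<Psi> = (\<lambda>i. ext (((psis ?st)(int (rank ?st) := \<psi>)) i))"
    have \<Psi>: "\<Psi> (-1) = [:fps_X:]" "\<Psi> 0 = ext \<psi>" "\<Psi> (int 0) = ext \<psi>"
      by (simp_all add: \<Psi>_def initial_state_def)
    have aL: "is_approx_root (degree F) (ext F) (ext \<psi>)" by (rule is_approx_root_ext[OF a])
    have m: "lead_coeff (ext \<psi>) = 1" "degree (ext \<psi>) = 1"
      using aL degree_ge by (auto simp: is_approx_root_def)
    have "irr_round to_ac \<Psi> 0 (range to_ac) (\<lambda>i. if i = -1 then 1 else 0) Fil0 (\<kappa>0 to_ac) (\<lambda>i. 1)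
      (\<lambda>i. 0) (\<lambda>i. 0) (ext F) (degree F)"
    proof (rule irr_roundI)
      show "field_emb (to_ac :: 'l \<Rightarrow> 'l alg_closure)" by unfold_locales
      show "key_level (\<Psi> (int 0)) (range to_ac) (int (if int 0 = -1 then 1 else 0)) Fil0 (\<kappa>0 to_ac)"
        unfolding \<Psi> using ac.key_level_0[OF m] by simp
      show "psi_chain 0 (\<lambda>i. 0) (\<lambda>i. 0) \<Psi>" using m by (simp add: psi_chain_def \<Psi>)
      show "represents to_ac 0 \<Psi> (\<lambda>i. if i = -1 then 1 else 0) (\<lambda>i. 1) Fil0 (\<kappa>0 to_ac) G" for G
        by (rule ac.represents_0) simp_all
      show "(1 :: 'l alg_closure) \<in> range to_ac" by (rule range_eqI[of _ _ 1]) simp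
      show "lead_coeff (ext F) = 1" using lead_coeff_ext F_monic by blast
      show "is_approx_root (degree F) (ext F) (\<Psi> (int 0))" unfolding \<Psi> by (rule aL)
      show "Fil0 (int (degree F - j) * int (if int 0 = -1 then 1 else 0) + 1) (monic_poly.dig (\<Psi> (int 0)) j (ext F))"
        if "j < degree F" for j
        using weierstrass_digits[OF weier_ext degree_ext _ _ aL that] char_okL degree_ge unfolding \<Psi> by simp
      show "degree (\<Psi> (int 0)) dvd degree G" for G :: "'l fps poly" unfolding \<Psi> m by simp
    qed (use char_okL in auto)
    then show ?thesis
      unfolding state_round_def \<Psi>_def[symmetric] by (simp only: initial_state_def irr_state.simps)
  qed
  then show ?thesis using degree_ge by (auto simp: state_ok_def initial_state_def)
qed

text \<open>For N = 1 the approximate root is F itself, so by \<open>factor_dvd\<close> deg F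
  divides the degree of every monic factor.\<close>

lemma irreducible_if_finished:
  assumes "state_ok st" "mult st = 1"
  shows "irreducible (ext F)"
proof -
  have "is_approx_root 1 F F" using F_monic by (simp add: is_approx_root_def)
  then obtain Fil \<kappa> where "state_round st F Fil \<kappa>" using assms by (auto simp: state_ok_def)
  then interpret R: irr_round to_ac "\<lambda>i. ext (((psis st)(int (rank st) := F)) i)" "rank st" "fld st"
     "vals st" Fil \<kappa> "lams st" "qs st" "ells st" "ext F" "mult st" by (simp add: state_round_def)
  have "\<not> (\<exists>G H. lead_coeff G = 1 \<and> lead_coeff H = 1 \<and> degree G > 0 \<and> degree H > 0 \<and> ext F = G * H)"
  proof
    assume "\<exists>G H. lead_coeff G = 1 \<and> lead_coeff H = 1 \<and> degree G > 0 \<and> degree H > 0 \<and> ext F = G * H"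
    then obtain G H where GH: "lead_coeff G = 1" "degree G > 0" "degree H > 0" "ext F = G * H" by blast
    have "degree F dvd degree G" using R.factor_dvd[OF GH(1,4)] by simp
    then have "degree F \<le> degree G" using GH(2) by (rule dvd_imp_le)
    moreover have "G \<noteq> 0" "H \<noteq> 0" using GH by auto
    then have "degree F = degree G + degree H" using degree_ext[of F] GH(4) by (simp add: degree_mult_eq)
    ultimately show False using GH(3) by simp
  qed
  then show ?thesis using monic_irreducible_iff[of "ext F"] lead_coeff_ext F_monic degree_ge by auto
qed

lemma approx_root_existsK:
  assumes "N dvd degree F" "N > 1"
  shows "\<exists>\<psi>. is_approx_root N F \<psi>"
proof -
  obtain n where n: "degree F = N * n" using assms(1) by (auto simp: dvd_def)
  have "n > 0" using n degree_ge by (cases n) auto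
  have "N \<le> degree F" using assms degree_ge by (intro dvd_imp_le) auto
  then have "of_nat N * inverse (of_nat N) = (1::'k)" using char_okK[of N] assms by simp
  then have unit: "of_nat N * fps_const (inverse (of_nat N)) = (1 :: 'k fps)"
    by (simp add: fps_of_nat[symmetric] fps_const_mult)
  have "\<exists>\<psi>. True \<and> is_approx_root N F \<psi>"
    using approx_root_exists[OF F_monic n assms(2) \<open>n > 0\<close> unit, of "monom 1 n" "\<lambda>_. True"]
    by (simp add: Polynomial.degree_monom_eq)
  then show ?thesis by simp
qed

lemma round_edge:
  assumes st: "state_ok st" "mult st > 1" and rp: "round_polynomial emb F st \<psi> H"
  shows "\<exists>Fil \<kappa> f E q m i0 w0. irr_round_slope to_ac (\<lambda>i. ext (((psis st)(int (rank st) := \<psi>)) i)) (rank st) (fld st)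
     (vals st) Fil \<kappa> (lams st) (qs st) (ells st) (ext F) (mult st) f H E q m i0 w0"
proof -
  define \<Psi> where "\<Psi> = (\<lambda>i. ext (((psis st)(int (rank st) := \<psi>)) i))"
  obtain f E where a: "is_approx_root (mult st) F \<psi>"
    and f: "is_adic_expansion (rank st) (qs st) (ells st) ((psis st)(int (rank st) := \<psi>)) F f"
    and E: "is_lower_edge (polygon_points (rank st) (mult st) (vals st) f) E" "(mult st, 0) \<in> E"
    and H: "H = edge_polynomial emb (rank st) (mult st) (vals st) (lams st) f E"
    using rp unfolding round_polynomial_def by blast
  obtain Fil \<kappa> where "state_round st \<psi> Fil \<kappa>" using st a by (auto simp: state_ok_def)
  then have R: "irr_round to_ac \<Psi> (rank st) (fld st) (vals st) Fil \<kappa> (lams st) (qs st) (ells st) (ext F) (mult st)"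
    by (simp add: state_round_def \<Psi>_def)
  have f': "is_adic_expansion (rank st) (qs st) (ells st) \<Psi> (ext F) (\<lambda>B. \<iota> (f B))"
    unfolding \<Psi>_def by (rule is_adic_expansion_ext[OF f])
  have E': "is_lower_edge (polygon_points (rank st) (mult st) (vals st) (\<lambda>B. \<iota> (f B))) E"
    using E(1) by (simp only: polygon_points_ext)
  have H': "H = edge_polynomial to_ac (rank st) (mult st) (vals st) (lams st) (\<lambda>B. \<iota> (f B)) E"
    unfolding H emb_def by (rule edge_polynomial_ext)
  have "irr_round_edge to_ac \<Psi> (rank st) (fld st) (vals st) Fil \<kappa> (lams st) (qs st) (ells st) (ext F) (mult st)
      (\<lambda>B. \<iota> (f B)) H E"
    using R st(2) f' E' E(2) H'
    by (simp add: irr_round_edge_def irr_round_expansion_def irr_round_edge_axioms_def irr_round_expansion_axioms_def)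
  from irr_round_slope_exists[OF this] show ?thesis unfolding \<Psi>_def by blast
qed

lemma reducible_if_not_degenerated:
  assumes st: "state_ok st" "mult st > 1" and rp: "round_polynomial emb F st \<psi> H"
    and nd: "\<not> degenerated (fld st) H"
  shows "\<not> irreducible (ext F)"
proof -
  obtain Fil \<kappa> f E q m i0 w0 where "irr_round_slope to_ac (\<lambda>i. ext (((psis st)(int (rank st) := \<psi>)) i)) (rank st) (fld st)
     (vals st) Fil \<kappa> (lams st) (qs st) (ells st) (ext F) (mult st) f H E q m i0 w0"
    using round_edge[OF st rp] by blast
  from irr_round_slope.reducible_if_not_degenerated[OF this nd]
  show ?thesis using monic_irreducible_iff[of "ext F"] lead_coeff_ext F_monic degree_ge by auto
qed

lemma next_state_ok:
  assumes st: "state_ok st" "mult st > 1" and rp: "round_polynomial emb F st \<psi> H"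
    and ed: "edge_data (fld st) H q m P N" and quot: "is_quotient_field (fld st) P z L"
    and bez: "int q * s - int m * t = 1"
  shows "state_ok (next_state st \<psi> q m P N z L s t)" "N < mult st" "N > 0"
proof -
  define k where "k = rank st"
  obtain Fil \<kappa> f E q' m' i0 w0 where "irr_round_slope to_ac (\<lambda>i. ext (((psis st)(int (rank st) := \<psi>)) i)) (rank st) (fld st)
     (vals st) Fil \<kappa> (lams st) (qs st) (ells st) (ext F) (mult st) f H E q' m' i0 w0"
    using round_edge[OF st rp] by blast
  then interpret R: irr_round_slope to_ac "\<lambda>i. ext (((psis st)(int k := \<psi>)) i)" k "fld st"
     "vals st" Fil \<kappa> "lams st" "qs st" "ells st" "ext F" "mult st" f H E q' m' i0 w0 by (simp add: k_def)
  note facts = R.edge_data_facts[OF ed]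
  show "N < mult st" "N > 0" using facts by auto
  have "N dvd mult st" using facts(7) by (metis dvd_triv_right)
  then have dvd: "N dvd degree F" using st(1) dvd_trans unfolding state_ok_def by blast
  have "q > 0" using facts(1) R.qm(1) by simp
  \<comment> \<open>The algebraic closure provides the q-th root at which initial forms are
    evaluated.\<close>
  then obtain \<zeta> where \<zeta>: "\<zeta> ^ q = z" using nth_root_exists by blast
  let ?st = "next_state st \<psi> q m P N z L s t"
  have "\<exists>Fil \<kappa>. state_round ?st \<psi>' Fil \<kappa>" if a: "is_approx_root N F \<psi>'" for \<psi>'
  proof -
    let ?\<Psi> = "\<lambda>i. ext (((psis ?st)(int (rank ?st) := \<psi>')) i)"
    have ps: "psis ?st = (psis st)(int k := \<psi>)" "rank ?st = Suc k" by (simp_all add: next_state_def k_def)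
    have "\<exists>Fil2 \<kappa>2. irr_round to_ac ?\<Psi> (Suc k) L (update_vals k q m (degree P) (vals st)) Fil2 \<kappa>2
        (update_lams k q P z s t (vals st) (lams st)) ((qs st)(int (Suc k) := q)) ((ells st)(int (Suc k) := degree P)) (ext F) N"
      by (rule R.next_round[OF ed quot bez \<zeta> is_approx_root_ext[OF a]]) (auto simp: ps)
    then show ?thesis by (simp add: state_round_def next_state_def k_def)
  qed
  then show "state_ok ?st" using dvd \<open>N > 0\<close> by (simp add: state_ok_def next_state_def)
qed

text \<open>Square-freeness enters here: it excludes F = \<psi>^N with N > 1, where the polygon
  would have no second point.\<close>

lemma round_polynomial_exists:
  assumes st: "state_ok st" "mult st > 1"
  shows "\<exists>\<psi> H. round_polynomial emb F st \<psi> H"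
proof -
  let ?N = "mult st"
  have N: "?N dvd degree F" using st(1) by (simp add: state_ok_def)
  obtain \<psi> where a: "is_approx_root ?N F \<psi>" using approx_root_existsK[OF N st(2)] by blast
  define \<Psi> where "\<Psi> = (psis st)(int (rank st) := \<psi>)"
  obtain Fil \<kappa> where "state_round st \<psi> Fil \<kappa>" using st a by (auto simp: state_ok_def)
  then have R: "irr_round to_ac (\<lambda>i. ext (\<Psi> i)) (rank st) (fld st) (vals st) Fil \<kappa> (lams st) (qs st) (ells st) (ext F) ?N"
    by (simp add: state_round_def \<Psi>_def)
  have "psi_chain (rank st) (qs st) (ells st) \<Psi>" using irr_round.chain[OF R] psi_chain_ext by blast
  then obtain f where f: "is_adic_expansion (rank st) (qs st) (ells st) \<Psi> F f" using adic_expansion_exists by blast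
  interpret X: irr_round_expansion to_ac "\<lambda>i. ext (\<Psi> i)" "rank st" "fld st" "vals st" Fil \<kappa> "lams st" "qs st" "ells st"
      "ext F" ?N "\<lambda>B. \<iota> (f B)"
    using R st(2) is_adic_expansion_ext[OF f]
    by (simp add: irr_round_expansion_def irr_round_expansion_axioms_def)
  have "F \<noteq> \<psi> ^ ?N"
  proof
    assume eq: "F = \<psi> ^ ?N"
    have "\<psi> ^ 2 dvd F" unfolding eq using st(2) by (intro le_imp_power_dvd) simp
    then have "\<psi> dvd 1" using sqfree by (simp add: squarefree_def)
    then have "degree \<psi> = 0" by (auto simp: is_unit_poly_iff)
    then show False using approx_root_degree[OF a] degree_ge by simp
  qed
  then have "ext F \<noteq> ext (\<Psi> (int (rank st))) ^ ?N"
    using ext_inj[of F "\<psi> ^ ?N"] by (simp add: \<Psi>_def)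
  then obtain E where "is_lower_edge (polygon_points (rank st) ?N (vals st) f) E" "(?N, 0) \<in> E"
    using X.lower_edge_exists by (auto simp: polygon_points_ext)
  then have "round_polynomial emb F st \<psi> (edge_polynomial emb (rank st) ?N (vals st) (lams st) f E)"
    unfolding round_polynomial_def using a f by (auto simp: \<Psi>_def)
  then show ?thesis by blast
qed

text \<open>N_k decreases strictly. A root of P in the algebraic closure yields the quotient field,
  and coprimality of the slope data yields the normalized Bezout pair.\<close>

lemma run_exists: "state_ok st \<Longrightarrow> \<exists>b. irreducible_run emb F st b"
proof (induction "mult st" arbitrary: st rule: less_induct)
  case (less st)
  show ?case
  proof (cases "mult st = 1")
    case True
    then show ?thesis using irreducible_run.finished by blast
  next
    case False
    then have m: "mult st > 1" using less.prems by (simp add: state_ok_def)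
    obtain \<psi> H where rp: "round_polynomial emb F st \<psi> H"
      using round_polynomial_exists[OF less.prems m] by blast
    show ?thesis
    proof (cases "degenerated (fld st) H")
      case False
      then show ?thesis using irreducible_run.not_degenerated[OF m rp] by blast
    next
      case True
      then obtain q n P N where ed: "edge_data (fld st) H q n P N" by (auto simp: degenerated_def)
      then have P: "q > 0" "coprime q n" "irreducible_over (fld st) P" by (auto simp: edge_data_def)
      then have "degree P > 0" by (simp add: irreducible_over_def)
      then obtain z where z: "poly P z = 0" using alg_closed_imp_poly_has_root by blast
      obtain s t where st: "int q * s - int n * t = 1" "0 \<le> t" "t < int q"
        using bezout_normalized[OF P(2,1)] by blast
      have "is_subfield (fld st)"
      proof -
        obtain Fil \<kappa> f E q' m' i0 w0 where "irr_round_slope to_ac (\<lambda>i. ext (((psis st)(int (rank st) := \<psi>)) i)) (rank st)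
          (fld st) (vals st) Fil \<kappa> (lams st) (qs st) (ells st) (ext F) (mult st) f H E q' m' i0 w0"
          using round_edge[OF less.prems m rp] by blast
        then interpret R: irr_round_slope to_ac "\<lambda>i. ext (((psis st)(int (rank st) := \<psi>)) i)" "rank st" "fld st"
           "vals st" Fil \<kappa> "lams st" "qs st" "ells st" "ext F" "mult st" f H E q' m' i0 w0 .
        show ?thesis by (rule R.sub)
      qed
      then interpret S: subfield_of "fld st" by unfold_locales
      have quot: "is_quotient_field (fld st) P z ((\<lambda>A. poly A z) ` polys_over (fld st))"
        by (rule S.quotient_field_exists[OF P(3) z])
      let ?st = "next_state st \<psi> q n P N z ((\<lambda>A. poly A z) ` polys_over (fld st)) s t"
      have "state_ok ?st" "mult ?st < mult st"
        using next_state_ok[OF less.prems m rp ed quot st(1)] by (auto simp: next_state_def)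
      then obtain b where "irreducible_run emb F ?st b" using less.hyps by blast
      then show ?thesis using irreducible_run.continue[OF m rp ed quot st] by blast
    qed
  qed
qed

lemma run_sound: "irreducible_run emb F st b \<Longrightarrow> state_ok st \<Longrightarrow> b \<longleftrightarrow> irreducible (ext F)"
proof (induction rule: irreducible_run.induct)
  case (finished st)
  then show ?case using irreducible_if_finished by simp
next
  case (not_degenerated st \<psi> H)
  then show ?case using reducible_if_not_degenerated by blast
next
  case (continue st \<psi> H q m P N z L s t b)
  then show ?case using next_state_ok(1)[OF continue.prems continue.hyps(1-5)] by blast
qed

end

text \<open>By \<open>run_sound\<close> every run tells the truth, whichever roots z it takes, and
  by \<open>run_exists\<close> there is one; together this gives both equivalences.\<close>

theorem theorem5:
  fixes F :: "'k::field fps poly" and \<iota> :: "'k \<Rightarrow> 'l::field" and d :: nat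
  assumes "perfect_field TYPE('k)"
    and "field_embedding \<iota>"
    and "weierstrass F" and "degree F = d" and "d \<ge> 1"
    and "CHAR('k) = 0 \<or> CHAR('k) > d"
    and "squarefree F"
  shows "(Irreducible_returns \<iota> F True \<longleftrightarrow> irreducible (extend_scalars \<iota> F)) \<and>
         (Irreducible_returns \<iota> F False \<longleftrightarrow> \<not> irreducible (extend_scalars \<iota> F))"
proof -
  interpret irr_setup \<iota> F using assms by unfold_locales auto
  let ?st = "initial_state (degree F) (range to_ac) :: ('k, 'l alg_closure) irr_state"
  have returns: "Irreducible_returns \<iota> F b \<longleftrightarrow> irreducible_run emb F ?st b" for b
    by (simp add: Irreducible_returns_def emb_def)
  obtain b where b: "irreducible_run emb F ?st b" using run_exists[OF initial_state_ok] by blast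
  have "irreducible_run emb F ?st b' \<longleftrightarrow> b' = irreducible (ext F)" for b'
  proof
    show "irreducible_run emb F ?st b' \<Longrightarrow> b' = irreducible (ext F)"
      using run_sound initial_state_ok by blast
    assume "b' = irreducible (ext F)"
    then have "b' = b" using run_sound[OF b initial_state_ok] by simp
    then show "irreducible_run emb F ?st b'" using b by simp
  qed
  then show ?thesis unfolding returns by simp
qed

end
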